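(* Let $\tau>0$, $s_*\in(0,1)$, and boundary data $s_0,p_0\in C^1(\Sigma)$ be given with $p_c(s_* )\le p_c(s_0)<p_0$ on $\Sigma$, and let $F_\infty$ satisfy $$gL\,[k(s_* )+k'(s_* )(1-s_* )]<F_\infty<gLk(1).$$ Set $c_1:=k'(s_* )g$ and $c_2:=g(k(1)-k(s_* ))/(1-s_* )$. Assume that for every $c\in[c_1,c_2]$ there is a sequence $(s_H,p_H)$, $H\to\infty$, of $TW_H$-solutions to the data $c,\tau,F_\infty,s_0,p_0$ such that, with constants $\bar p<\infty$ and $C_P>0$ independent of $H$, $$p_H\le\bar p\ \text{ in }\Omega^H,\qquad \|\nabla p_H\|_{L^\infty(\Omega^H)}\le C_P,\qquad s_H,\ \partial_z s_H\in H^1(\Omega^H).$$ For each $c\in[c_1,c_2]$ consider the corresponding limit solution $(s,p)$ on $\Omega$ and its flux $$F_c=\int_\Sigma\big(k(s_0)[\partial_z p+g]-c\,s_0\big),$$ and assume that $F_c$ depends continuously on $c\in[c_1,c_2]$. Then there exists a wave speed $\bar c\in(c_1,c_2)$ such that the pair $(s,p)$ corresponding to $c=\bar c$ satisfies $$F_{\bar c}=(g\,k(s_* )-\bar c\,s_* )\,L .$$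
   Context: Constants $g,L>0$ are fixed. Points of $\mathbb{R}^2$ are written $(y,z)$, $e_z=(0,1)$, $[q]_+=\max\{0,q\}$. Domains: $\Omega=(0,L)\times(0,\infty)$, $\Sigma=(0,L)\times\{0\}$, $\Omega^H=(0,L)\times(0,H)$, $\Sigma^H=(0,L)\times\{H\}$. Homogeneous Neumann (no flux) conditions are always imposed on the lateral boundaries $y=0$ and $y=L$. Saturations take values in $[0,1]$ (with the convention $p_c(1)=+\infty$), and $s_0<1$. The coefficient functions $k:[0,1]\to[0,\infty)$ and $p_c:(0,1)\to\mathbb{R}$ are fixed and satisfy the following. (i) $p_c$ is differentiable, $p_c'\ge\rho$ on $(0,1)$ for some $\rho>0$, $p_c(s_* )=0$, $p_c(s)\to-\infty$ as $s\searrow0$ and $p_c(s)\to\infty$ as $s\nearrow1$. (ii) $k$ is differentiable, $k|_{(0,1)}\in C^2$, and $k',k''>0$ on $(0,1)$. A $TW_H$-solution to the data $c,\tau,F_\infty,s_0,p_0$ is a pair $(s,p)$ with $s,\partial_z s\in L^2(\Omega^H)$, $p\in H^1(\Omega^H)\cap H^2_{\mathrm{loc}}(\Omega^H)$ such that $$c\,\partial_z s=\nabla\cdot(k(s)[\nabla p+ge_z])\ \text{ in }\Omega^H,\qquad c\tau\,\partial_z s=[p-p_c(s)]_+\ \text{ in }\Omega^H,$$ $$s=s_0,\ p=p_0\ \text{ on }\Sigma,\qquad p\equiv p^*\ \text{ on }\Sigma^H\text{ for some constant }p^*\in\mathbb{R},\qquad \int_{\Sigma^H}k(s)[\partial_z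 p+g]=F_\infty;$$ the constant $p^*$ is part of the solution. The first equation, the lateral condition and the flux condition are understood in the weak form $\int_{\Omega^H}c\,\partial_z s\,\phi+\int_{\Omega^H}k(s)[\nabla p+ge_z]\cdot\nabla\phi=F_\infty\,\phi^*$ for all $\phi\in H^1(\Omega^H)$ with trace $0$ on $\Sigma$ and constant trace $\phi^*\in\mathbb{R}$ on $\Sigma^H$. The corresponding limit solution $(s,p)$ for given $c$ is a limit of $(s_H,p_H)$ as $H\to\infty$ (along a subsequence), locally in $L^2(\Omega)$. It has the regularity $s\in C^0_b(\Omega)$ (bounded continuous), $\partial_z s\in L^2(\Omega)$, $p\in H^2_{\mathrm{loc}}(\Omega)\cap H^1_{\mathrm{loc}}(\Omega\cup\Sigma)$, satisfies $(s,p)=(s_0,p_0)$ on $\Sigma$, and solves $c\,\partial_z s=\nabla\cdot(k(s)[\nabla p+ge_z])$, $c\tau\,\partial_z s=[p-p_c(s)]_+$ in $\Omega$. In $F_c$, the flux $k(s_0)\partial_z p$ on $\Sigma$ is understood in the sense of normal traces. *)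

theory Defs
  imports "HOL-Analysis.Analysis"
begin

section \<open>Lebesgue and Sobolev spaces\<close>

text \<open>Functions are total; only their values on the stated domain matter, and all notions of this
  section depend only on the almost-everywhere class of the function on that domain.\<close>

definition L2_on :: "'a::euclidean_space set \<Rightarrow> ('a \<Rightarrow> 'b::euclidean_space) \<Rightarrow> bool" where
  "L2_on U f \<longleftrightarrow> f \<in> borel_measurable (lebesgue_on U) \<and>
     integrable (lebesgue_on U) (\<lambda>x. (norm (f x))\<^sup>2)"

definition L2_loc :: "'a::euclidean_space set \<Rightarrow> ('a \<Rightarrow> 'b::euclidean_space) \<Rightarrow> bool" where
  "L2_loc W f \<longleftrightarrow> (\<forall>K. compact K \<and> K \<subseteq> W \<longrightarrow> L2_on K f)"

definition L2_converges ::
  "'a::euclidean_space set \<Rightarrow> (nat \<Rightarrow> 'a \<Rightarrow> 'b::euclidean_space) \<Rightarrow> ('a \<Rightarrow> 'b) \<Rightarrow> bool" where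
  "L2_converges U f l \<longleftrightarrow> L2_on U l \<and> (\<forall>\<^sub>F n in sequentially. L2_on U (f n)) \<and>
     (\<lambda>n. LINT x|lebesgue_on U. (norm (f n x - l x))\<^sup>2) \<longlonglongrightarrow> 0"

definition L1_loc :: "'a::euclidean_space set \<Rightarrow> ('a \<Rightarrow> 'b::euclidean_space) \<Rightarrow> bool" where
  "L1_loc U f \<longleftrightarrow> (\<forall>K. compact K \<and> K \<subseteq> U \<longrightarrow> f absolutely_integrable_on K)"

definition C1_with_gradient :: "('a::euclidean_space \<Rightarrow> real) \<Rightarrow> ('a \<Rightarrow> 'a) \<Rightarrow> bool" where
  "C1_with_gradient \<phi> D \<longleftrightarrow> (\<forall>x. GDERIV \<phi> x :> D x) \<and> continuous_on UNIV D"

definition compactly_supported_in :: "'a::euclidean_space set \<Rightarrow> ('a \<Rightarrow> real) \<Rightarrow> bool" where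
  "compactly_supported_in U \<phi> \<longleftrightarrow> (\<exists>K. compact K \<and> K \<subseteq> U \<and> (\<forall>x. x \<notin> K \<longrightarrow> \<phi> x = 0))"

text \<open>Weak derivatives and divergences are tested with compactly supported \<open>C\<^sup>1\<close> functions, which by
  mollification is the same as testing with smooth ones.\<close>

definition has_weak_deriv ::
  "'a::euclidean_space set \<Rightarrow> 'a \<Rightarrow> ('a \<Rightarrow> real) \<Rightarrow> ('a \<Rightarrow> real) \<Rightarrow> bool" where
  "has_weak_deriv U b f f' \<longleftrightarrow> L1_loc U f \<and> L1_loc U f' \<and>
     (\<forall>\<phi> D. C1_with_gradient \<phi> D \<and> compactly_supported_in U \<phi> \<longrightarrow>
        (LINT x|lebesgue_on U. f x * (D x \<bullet> b)) = - (LINT x|lebesgue_on U. f' x * \<phi> x))"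

text \<open>A representative of the weak derivative, which is unique almost everywhere.\<close>

definition weak_deriv :: "'a::euclidean_space set \<Rightarrow> 'a \<Rightarrow> ('a \<Rightarrow> real) \<Rightarrow> 'a \<Rightarrow> real" where
  "weak_deriv U b f = (SOME f'. has_weak_deriv U b f f')"

definition weakly_differentiable :: "'a::euclidean_space set \<Rightarrow> ('a \<Rightarrow> real) \<Rightarrow> bool" where
  "weakly_differentiable U f \<longleftrightarrow> (\<forall>b\<in>Basis. \<exists>f'. has_weak_deriv U b f f')"

definition weak_gradient :: "'a::euclidean_space set \<Rightarrow> ('a \<Rightarrow> real) \<Rightarrow> 'a \<Rightarrow> 'a" where
  "weak_gradient U f x = (\<Sum>b\<in>Basis. weak_deriv U b f x *\<^sub>R b)"

definition in_H1 :: "'a::euclidean_space set \<Rightarrow> ('a \<Rightarrow> real) \<Rightarrow> bool" where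
  "in_H1 U f \<longleftrightarrow> weakly_differentiable U f \<and> L2_on U f \<and> L2_on U (weak_gradient U f)"

text \<open>\<open>in_H1_loc U W f\<close>: \<open>f\<close> is of class \<open>H\<^sup>1\<close> on the open set \<open>U\<close>, locally near the points of \<open>W\<close>.
  Here \<open>W\<close> is \<open>U\<close> itself or \<open>U\<close> together with a part of its boundary (of measure zero).\<close>

definition in_H1_loc :: "'a::euclidean_space set \<Rightarrow> 'a set \<Rightarrow> ('a \<Rightarrow> real) \<Rightarrow> bool" where
  "in_H1_loc U W f \<longleftrightarrow>
     weakly_differentiable U f \<and> L2_loc W f \<and> L2_loc W (weak_gradient U f)"

definition in_H2_loc :: "'a::euclidean_space set \<Rightarrow> ('a \<Rightarrow> real) \<Rightarrow> bool" where
  "in_H2_loc U f \<longleftrightarrow> in_H1_loc U U f \<and> (\<forall>b\<in>Basis. in_H1_loc U U (weak_deriv U b f))"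

definition has_weak_divergence ::
  "'a::euclidean_space set \<Rightarrow> ('a \<Rightarrow> 'a) \<Rightarrow> ('a \<Rightarrow> real) \<Rightarrow> bool" where
  "has_weak_divergence U q d \<longleftrightarrow> L1_loc U q \<and> L1_loc U d \<and>
     (\<forall>\<phi> D. C1_with_gradient \<phi> D \<and> compactly_supported_in U \<phi> \<longrightarrow>
        (LINT x|lebesgue_on U. q x \<bullet> D x) = - (LINT x|lebesgue_on U. d x * \<phi> x))"


section \<open>Domains, traces and normal traces\<close>

abbreviation e_z :: "real \<times> real" where "e_z \<equiv> (0, 1)"

definition Omega :: "real \<Rightarrow> (real \<times> real) set" where
  "Omega L = {0<..<L} \<times> {0<..}"

definition Sigma0 :: "real \<Rightarrow> (real \<times> real) set" where
  "Sigma0 L = {0<..<L} \<times> {0}"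

definition Omega_H :: "real \<Rightarrow> real \<Rightarrow> (real \<times> real) set" where
  "Omega_H L H = {0<..<L} \<times> {0<..<H}"

text \<open>\<open>has_trace I T h f \<psi>\<close>: on the rectangle \<open>I \<times> T\<close>, the trace of \<open>f\<close> on the horizontal segment
  \<open>I \<times> {h}\<close>, \<open>h\<close> an end point of \<open>T\<close>, is \<open>\<psi>\<close>. As usual the trace is the continuous extension of
  the restriction of \<open>C\<^sup>1\<close> functions. The norm used is that of \<open>f\<close> and \<open>\<partial>\<^sub>z f\<close> in \<open>L\<^sup>2\<close>, for which
  the restriction to horizontal segments is already continuous: this covers saturations, for which
  only the vertical derivative is available, and agrees with the usual trace on \<open>H\<^sup>1\<close>.\<close>

definition has_trace ::
  "real set \<Rightarrow> real set \<Rightarrow> real \<Rightarrow> (real \<times> real \<Rightarrow> real) \<Rightarrow> (real \<Rightarrow> real) \<Rightarrow> bool" where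
  "has_trace I T h f \<psi> \<longleftrightarrow>
     (\<exists>f' \<phi> D. has_weak_deriv (I \<times> T) e_z f f' \<and> (\<forall>n. C1_with_gradient (\<phi> n) (D n)) \<and>
        L2_converges (I \<times> T) \<phi> f \<and>
        L2_converges (I \<times> T) (\<lambda>n x. D n x \<bullet> e_z) f' \<and>
        L2_converges I (\<lambda>n y. \<phi> n (y, h)) \<psi>)"

text \<open>Functions in \<open>H\<^sup>1(\<Omega>)\<close> with bounded support (up to null sets) and trace \<open>\<psi>\<close> on \<open>\<Sigma>\<close>. They are
  unconstrained on the lateral boundary, so that testing with them encodes the no-flux condition.\<close>

definition test_with_trace :: "real \<Rightarrow> (real \<Rightarrow> real) \<Rightarrow> (real \<times> real \<Rightarrow> real) \<Rightarrow> bool" where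
  "test_with_trace L \<psi> \<phi> \<longleftrightarrow> in_H1 (Omega L) \<phi> \<and>
     (\<exists>R. AE x in lebesgue_on (Omega L). snd x > R \<longrightarrow> \<phi> x = 0) \<and>
     (\<forall>R>0. has_trace {0<..<L} {0<..<R} 0 \<phi> \<psi>)"

text \<open>The pairing \<open>\<langle>q \<cdot> e\<^sub>z, \<psi>\<rangle>\<close> on \<open>\<Sigma>\<close> of the vertical normal trace of a field \<open>q\<close> on \<open>\<Omega>\<close> (with
  vanishing normal trace on the lateral boundary) with \<open>\<psi>\<close>, given by the Gauss formula. The sign is
  due to the outer normal \<open>-e\<^sub>z\<close> of \<open>\<Omega>\<close> on \<open>\<Sigma>\<close>.\<close>

definition normal_trace_pairing ::
  "real \<Rightarrow> (real \<times> real \<Rightarrow> real \<times> real) \<Rightarrow> (real \<Rightarrow> real) \<Rightarrow> real" where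
  "normal_trace_pairing L q \<psi> =
     (THE Q. \<exists>d. has_weak_divergence (Omega L) q d \<and>
        (\<forall>\<phi>. test_with_trace L \<psi> \<phi> \<longrightarrow>
           (LINT x|lebesgue_on (Omega L). q x \<bullet> weak_gradient (Omega L) \<phi> x + d x * \<phi> x) = - Q))"


section \<open>The travelling wave problem\<close>

definition coefficient_functions ::
  "(real \<Rightarrow> real) \<Rightarrow> (real \<Rightarrow> real) \<Rightarrow> real \<Rightarrow> bool" where
  "coefficient_functions k pc s_star \<longleftrightarrow>
     (\<forall>s\<in>{0<..<1}. pc differentiable (at s)) \<and>
     (\<exists>\<rho>>0. \<forall>s\<in>{0<..<1}. deriv pc s \<ge> \<rho>) \<and>
     pc s_star = 0 \<and>
     filterlim pc at_bot (at_right 0) \<and> filterlim pc at_top (at_left 1) \<and>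
     (\<forall>s\<in>{0..1}. k s \<ge> 0) \<and> k differentiable_on {0..1} \<and>
     (\<forall>s\<in>{0<..<1}. deriv k differentiable (at s)) \<and>
     continuous_on {0<..<1} (deriv (deriv k)) \<and>
     (\<forall>s\<in>{0<..<1}. deriv k s > 0 \<and> deriv (deriv k) s > 0)"

text \<open>The extension of \<open>p\<^sub>c\<close> to all saturations by its limits at \<open>0\<close> and \<open>1\<close>.\<close>

definition pc_ext :: "(real \<Rightarrow> real) \<Rightarrow> real \<Rightarrow> ereal" where
  "pc_ext pc s = (if s \<le> 0 then - \<infinity> else if s \<ge> 1 then \<infinity> else ereal (pc s))"

definition flux_field ::
  "real \<Rightarrow> (real \<Rightarrow> real) \<Rightarrow> (real \<times> real) set \<Rightarrow> (real \<times> real \<Rightarrow> real) \<Rightarrow> (real \<times> real \<Rightarrow> real)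
     \<Rightarrow> real \<times> real \<Rightarrow> real \<times> real" where
  "flux_field g k U s p x = k (s x) *\<^sub>R (weak_gradient U p x + g *\<^sub>R e_z)"

definition capillary_eq ::
  "(real \<Rightarrow> real) \<Rightarrow> (real \<times> real) set \<Rightarrow> real \<Rightarrow> real \<Rightarrow> (real \<times> real \<Rightarrow> real)
     \<Rightarrow> (real \<times> real \<Rightarrow> real) \<Rightarrow> bool" where
  "capillary_eq pc U c \<tau> s p \<longleftrightarrow>
     (AE x in lebesgue_on U.
        ereal (c * \<tau> * weak_deriv U e_z s x) = max 0 (ereal (p x) - pc_ext pc (s x)))"

text \<open>Data on \<open>\<Sigma>\<close> and \<open>\<Sigma>\<^sup>H\<close> are written as functions of \<open>y\<close> in \<open>(0,L)\<close>.\<close>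

definition TW_H_solution ::
  "real \<Rightarrow> real \<Rightarrow> (real \<Rightarrow> real) \<Rightarrow> (real \<Rightarrow> real) \<Rightarrow> real \<Rightarrow> real \<Rightarrow> real \<Rightarrow> real
     \<Rightarrow> (real \<Rightarrow> real) \<Rightarrow> (real \<Rightarrow> real) \<Rightarrow> (real \<times> real \<Rightarrow> real) \<Rightarrow> (real \<times> real \<Rightarrow> real) \<Rightarrow> bool" where
  "TW_H_solution g L k pc H c \<tau> F_inf s0 p0 s p \<longleftrightarrow>
     (let U = Omega_H L H; I = {0<..<L}; T = {0<..<H} in
       (AE x in lebesgue_on U. s x \<in> {0..1}) \<and>
       L2_on U s \<and> (\<exists>s'. has_weak_deriv U e_z s s') \<and> L2_on U (weak_deriv U e_z s) \<and>
       in_H1 U p \<and> in_H2_loc U p \<and>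
       (\<forall>\<phi> \<phi>_star. in_H1 U \<phi> \<and> has_trace I T 0 \<phi> (\<lambda>_. 0) \<and> has_trace I T H \<phi> (\<lambda>_. \<phi>_star) \<longrightarrow>
          (LINT x|lebesgue_on U. c * weak_deriv U e_z s x * \<phi> x)
          + (LINT x|lebesgue_on U. flux_field g k U s p x \<bullet> weak_gradient U \<phi> x)
          = F_inf * \<phi>_star) \<and>
       capillary_eq pc U c \<tau> s p \<and>
       has_trace I T 0 s s0 \<and> has_trace I T 0 p p0 \<and>
       (\<exists>p_star. has_trace I T H p (\<lambda>_. p_star)))"

text \<open>\<open>limit_solution \<dots> sH pH s p\<close>: \<open>(s, p)\<close> is a limit solution belonging to the sequence
  \<open>(sH n, pH n)\<close>, on domains of height tending to infinity. Since \<open>p\<close> is only assumed to be \<open>H\<^sup>1\<close> locally in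
  \<open>\<Omega> \<union> \<Sigma>\<close>, the boundary values are expressed on rectangles away from the lateral boundary.\<close>

definition limit_solution ::
  "real \<Rightarrow> real \<Rightarrow> (real \<Rightarrow> real) \<Rightarrow> (real \<Rightarrow> real) \<Rightarrow> real \<Rightarrow> real
     \<Rightarrow> (real \<Rightarrow> real) \<Rightarrow> (real \<Rightarrow> real)
     \<Rightarrow> (nat \<Rightarrow> real \<times> real \<Rightarrow> real) \<Rightarrow> (nat \<Rightarrow> real \<times> real \<Rightarrow> real)
     \<Rightarrow> (real \<times> real \<Rightarrow> real) \<Rightarrow> (real \<times> real \<Rightarrow> real) \<Rightarrow> bool" where
  "limit_solution g L k pc c \<tau> s0 p0 sH pH s p \<longleftrightarrow>
     (let U = Omega L in
       (\<exists>r::nat \<Rightarrow> nat. strict_mono r \<and>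
          (\<forall>K. compact K \<and> K \<subseteq> U \<longrightarrow>
             L2_converges K (\<lambda>n. sH (r n)) s \<and> L2_converges K (\<lambda>n. pH (r n)) p)) \<and>
       continuous_on U s \<and> bounded (s ` U) \<and> (\<forall>x\<in>U. s x \<in> {0..1}) \<and>
       (\<exists>s'. has_weak_deriv U e_z s s') \<and> L2_on U (weak_deriv U e_z s) \<and>
       in_H2_loc U p \<and> in_H1_loc U (U \<union> Sigma0 L) p \<and>
       (\<forall>a b R. 0 < a \<and> a < b \<and> b < L \<and> 0 < R \<longrightarrow>
          has_trace {a<..<b} {0<..<R} 0 s s0 \<and> has_trace {a<..<b} {0<..<R} 0 p p0) \<and>
       (\<forall>\<phi>. test_with_trace L (\<lambda>_. 0) \<phi> \<longrightarrow>
          (LINT x|lebesgue_on U. c * weak_deriv U e_z s x * \<phi> x)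
          + (LINT x|lebesgue_on U. flux_field g k U s p x \<bullet> weak_gradient U \<phi> x) = 0) \<and>
       capillary_eq pc U c \<tau> s p)"

text \<open>The flux \<open>\<integral>\<^sub>\<Sigma> (k(s\<^sub>0)[\<partial>\<^sub>z p + g] - c s\<^sub>0)\<close>. The term \<open>k(s\<^sub>0)[\<partial>\<^sub>z p + g]\<close> is the vertical normal
  trace of the field \<open>k(s)[\<nabla>p + g e\<^sub>z]\<close>, which has divergence \<open>c \<partial>\<^sub>z s\<close> in \<open>L\<^sup>2\<close>.\<close>

definition bottom_flux ::
  "real \<Rightarrow> real \<Rightarrow> (real \<Rightarrow> real) \<Rightarrow> real \<Rightarrow> (real \<Rightarrow> real)
     \<Rightarrow> (real \<times> real \<Rightarrow> real) \<Rightarrow> (real \<times> real \<Rightarrow> real) \<Rightarrow> real" where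
  "bottom_flux g L k c s0 s p =
     normal_trace_pairing L (flux_field g k (Omega L) s p) (\<lambda>_. 1)
     - c * (LINT y|lebesgue_on {0<..<L}. s0 y)"

end

theory Submission
  imports Defs
begin

text \<open>The theorem is an application of the intermediate value theorem to
  \<open>c \<mapsto> F\<^sub>c - (g k(s_star) - c s_star) L\<close>: this function is positive at \<open>c\<^sub>1\<close> and negative at \<open>c\<^sub>2\<close>. Strict
  convexity of \<open>k\<close> makes the tangent at \<open>s_star\<close> less steep than the chord from \<open>s_star\<close> to \<open>1\<close>, that is \<open>c\<^sub>1 < c\<^sub>2\<close>.

  Both signs rest on conservation. By the weak equation, the horizontal integral of the flux density
  \<open>k(s) (\<partial>\<^sub>z p + g) - c s\<close> does not depend on the height, so that \<open>F\<^sub>c\<close> is its average with respect to weights in \<open>z\<close>;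
  the weights used have the shape of a plateau (\<open>bottom_flux_average\<close>).

  At \<open>c\<^sub>1\<close>: for the truncated problem the conserved flux is its value \<open>F\<^sub>\<infinity> - c \<integral> s\<close> at the top, and \<open>s \<le> 1\<close>. Averages of
  the flux density pass to the limit, because \<open>k(s\<^sub>H)\<close> converges strongly and the bounded gradients converge weakly. Hence
  \<open>F\<^sub>c \<ge> F\<^sub>\<infinity> - c L\<close> for every \<open>c\<close> (\<open>bottom_flux_lower_bound\<close>), and the lower bound on \<open>F\<^sub>\<infinity>\<close> says precisely that this suffices at \<open>c\<^sub>1\<close>.

  At \<open>c\<^sub>2\<close>: the capillary equation forces \<open>\<partial>\<^sub>z s \<ge> 0\<close>, so that \<open>s\<close> increases with the height, and stops the growth before \<open>s\<close> reaches \<open>1\<close>, since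
  \<open>p\<close> is bounded above. Therefore \<open>s_star \<le> s \<le> sb < 1\<close>, and \<open>s\<close> is not constant because \<open>p\<^sub>0 > p\<^sub>c(s\<^sub>0)\<close>. As \<open>s\<close> has a limit as the height grows,
  \<open>k(s)\<close> is nearly independent of \<open>z\<close> far above the bottom, so that \<open>k(s) \<partial>\<^sub>z p\<close> is nearly the derivative of a function
  that is bounded above; its average over a long interval is at most a small number. What remains is the average of \<open>g k(s) - c\<^sub>2 s\<close>, and
  as \<open>g k\<close> lies strictly below its chord with slope \<open>c\<^sub>2\<close> between \<open>s_star\<close> and \<open>1\<close>, it is smaller than \<open>(g k(s_star) - c\<^sub>2 s_star) L\<close> by a definite amount
  (\<open>bottom_flux_upper_bound\<close>).

  The analytic tools are the fundamental lemma of the calculus of variations, which gives uniqueness of weak derivatives and makes the normal trace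
  pairing well defined, and the Gauss formula on rectangles for functions with traces.\<close>

section \<open>Integrals and square integrable functions\<close>

lemma
  fixes f :: "'a::euclidean_space \<Rightarrow> 'b::euclidean_space"
  assumes "S \<subseteq> T" "S \<in> sets lebesgue" "T \<in> sets lebesgue" "\<And>x. x \<in> T - S \<Longrightarrow> f x = 0"
  shows integral_lebesgue_on_support:
      "integral\<^sup>L (lebesgue_on T) f = integral\<^sup>L (lebesgue_on S) f"
    and integrable_lebesgue_on_support:
      "integrable (lebesgue_on T) f \<longleftrightarrow> integrable (lebesgue_on S) f"
proof -
  have "(\<lambda>x. indicat_real T x *\<^sub>R f x) = (\<lambda>x. indicat_real S x *\<^sub>R f x)"
    using assms(1,4) by (force simp: indicator_def)
  then show "integral\<^sup>L (lebesgue_on T) f = integral\<^sup>L (lebesgue_on S) f"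
    "integrable (lebesgue_on T) f \<longleftrightarrow> integrable (lebesgue_on S) f"
    using assms(2,3)
    by (simp_all add: Bochner_Integration.integral_restrict_space Bochner_Integration.integrable_restrict_space)
qed

lemma AE_lebesgue_on_subset:
  assumes "AE x in lebesgue_on T. P x" "S \<subseteq> T" "S \<in> sets lebesgue" "T \<in> sets lebesgue"
  shows "AE x in lebesgue_on S. P x"
proof -
  have "AE x in lebesgue. x \<in> T \<longrightarrow> P x"
    using assms by (simp add: AE_restrict_space_iff)
  then have "AE x in lebesgue. x \<in> S \<longrightarrow> P x"
    using assms(2) by (auto elim: eventually_mono)
  then show ?thesis
    using assms by (simp add: AE_restrict_space_iff)
qed

lemma measurable_lebesgue_on_subset:
  assumes "f \<in> borel_measurable (lebesgue_on T)" "S \<subseteq> T"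
  shows "f \<in> borel_measurable (lebesgue_on S)"
  using measurable_restrict_mono[OF assms] .

lemma integrable_lebesgue_on_subset:
  fixes f :: "'a::euclidean_space \<Rightarrow> 'b::euclidean_space"
  assumes "integrable (lebesgue_on T) f" "S \<subseteq> T" "S \<in> sets lebesgue" "T \<in> sets lebesgue"
  shows "integrable (lebesgue_on S) f"
proof -
  have "set_integrable lebesgue T f"
    using assms by (simp add: integrable_restrict_space set_integrable_def)
  then have "set_integrable lebesgue S f"
    by (rule set_integrable_subset) (use assms in auto)
  then show ?thesis
    using assms by (simp add: integrable_restrict_space set_integrable_def)
qed

lemma integrable_lebesgue_on_bounded:
  fixes f :: "'a::euclidean_space \<Rightarrow> 'b::euclidean_space"
  assumes "f \<in> borel_measurable (lebesgue_on S)" "S \<in> lmeasurable"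
    "AE x in lebesgue_on S. norm (f x) \<le> C"
  shows "integrable (lebesgue_on S) f"
proof -
  interpret finite_measure "lebesgue_on S"
    using assms(2) by (rule finite_measure_lebesgue_on)
  show ?thesis using integrable_const_bound[OF assms(3,1)] .
qed

lemma integrable_bounded_mult:
  fixes f g :: "'a \<Rightarrow> real"
  assumes "integrable M f" "g \<in> borel_measurable M" "AE x in M. \<bar>g x\<bar> \<le> C"
  shows "integrable M (\<lambda>x. f x * g x)"
proof (rule Bochner_Integration.integrable_bound[where f = "\<lambda>x. C * f x"])
  show "AE x in M. norm (f x * g x) \<le> norm (C * f x)"
    using assms(3)
  proof eventually_elim
    case (elim x)
    have "\<bar>g x\<bar> * \<bar>f x\<bar> \<le> \<bar>C\<bar> * \<bar>f x\<bar>"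
      using elim by (intro mult_right_mono) auto
    then show ?case by (simp add: abs_mult mult.commute)
  qed
qed (use assms in auto)

lemma L2_on_subset:
  assumes "L2_on T f" "S \<subseteq> T" "S \<in> sets lebesgue" "T \<in> sets lebesgue"
  shows "L2_on S f"
  using assms unfolding L2_on_def
  by (auto intro: measurable_lebesgue_on_subset integrable_lebesgue_on_subset)

lemma L2_on_bounded:
  fixes f :: "'a::euclidean_space \<Rightarrow> 'b::euclidean_space"
  assumes "f \<in> borel_measurable (lebesgue_on S)" "S \<in> lmeasurable"
    "AE x in lebesgue_on S. norm (f x) \<le> C"
  shows "L2_on S f"
  unfolding L2_on_def
proof
  show "integrable (lebesgue_on S) (\<lambda>x. (norm (f x))\<^sup>2)"
  proof (rule integrable_lebesgue_on_bounded[where C = "C\<^sup>2"])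
    show "AE x in lebesgue_on S. norm ((norm (f x))\<^sup>2) \<le> C\<^sup>2"
      using assms(3) by eventually_elim (auto intro: power_mono)
  qed (use assms in auto)
qed (use assms in auto)

lemma L2_on_mult_integrable:
  fixes f g :: "'a::euclidean_space \<Rightarrow> real"
  assumes "L2_on U f" "L2_on U g"
  shows "integrable (lebesgue_on U) (\<lambda>x. f x * g x)"
proof (rule Bochner_Integration.integrable_bound[where f = "\<lambda>x. (norm (f x))\<^sup>2 + (norm (g x))\<^sup>2"])
  show "AE x in lebesgue_on U. norm (f x * g x) \<le> norm ((norm (f x))\<^sup>2 + (norm (g x))\<^sup>2)"
  proof (rule AE_I2)
    fix x
    have "0 \<le> \<bar>f x\<bar> * \<bar>g x\<bar>" "2 * (\<bar>f x\<bar> * \<bar>g x\<bar>) \<le> (f x)\<^sup>2 + (g x)\<^sup>2"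
      using sum_squares_bound[of "\<bar>f x\<bar>" "\<bar>g x\<bar>"] by (simp_all add: mult.assoc)
    then have "\<bar>f x\<bar> * \<bar>g x\<bar> \<le> (f x)\<^sup>2 + (g x)\<^sup>2"
      by linarith
    then show "norm (f x * g x) \<le> norm ((norm (f x))\<^sup>2 + (norm (g x))\<^sup>2)"
      by (simp add: abs_mult)
  qed
qed (use assms in \<open>auto simp: L2_on_def\<close>)

lemma L2_on_integrable:
  fixes f :: "'a::euclidean_space \<Rightarrow> real"
  assumes "L2_on U f" "U \<in> lmeasurable"
  shows "integrable (lebesgue_on U) f"
proof -
  have "L2_on U (\<lambda>x. 1::real)"
    by (rule L2_on_bounded[where C = 1]) (use assms in auto)
  from L2_on_mult_integrable[OF assms(1) this] show ?thesis by simp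
qed

lemma L2_on_cmult:
  fixes f :: "'a::euclidean_space \<Rightarrow> real"
  assumes "L2_on U f"
  shows "L2_on U (\<lambda>x. a * f x)"
  using assms by (auto simp: L2_on_def power_mult_distrib abs_mult)

lemma L2_on_diff:
  fixes f g :: "'a::euclidean_space \<Rightarrow> 'b::euclidean_space"
  assumes "L2_on U f" "L2_on U g"
  shows "L2_on U (\<lambda>x. f x - g x)"
  unfolding L2_on_def
proof
  have "integrable (lebesgue_on U) (\<lambda>x. 2 * (norm (f x))\<^sup>2 + 2 * (norm (g x))\<^sup>2)"
    using assms by (auto simp: L2_on_def)
  then show "integrable (lebesgue_on U) (\<lambda>x. (norm (f x - g x))\<^sup>2)"
  proof (rule Bochner_Integration.integrable_bound)
    show "AE x in lebesgue_on U. norm ((norm (f x - g x))\<^sup>2) \<le> norm (2 * (norm (f x))\<^sup>2 + 2 * (norm (g x))\<^sup>2)"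
    proof (rule AE_I2)
      fix x
      have "0 \<le> (norm (f x + g x))\<^sup>2" by simp
      then have "(norm (f x - g x))\<^sup>2 \<le> 2 * (norm (f x))\<^sup>2 + 2 * (norm (g x))\<^sup>2"
        unfolding power2_norm_eq_inner by (simp add: algebra_simps inner_commute)
      then show "norm ((norm (f x - g x))\<^sup>2) \<le> norm (2 * (norm (f x))\<^sup>2 + 2 * (norm (g x))\<^sup>2)" by simp
    qed
  qed (use assms in \<open>auto simp: L2_on_def\<close>)
qed (use assms in \<open>auto simp: L2_on_def\<close>)

text \<open>Convergence in \<open>L\<^sup>2\<close> implies weak convergence; the error term is controlled by
  \<open>2 |a b| \<le> a\<^sup>2 / e + e b\<^sup>2\<close> with a small parameter \<open>e\<close>.\<close>

lemma L2_converges_imp_weak: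
  fixes f :: "nat \<Rightarrow> 'a::euclidean_space \<Rightarrow> real"
  assumes "L2_converges U f l" "L2_on U g"
  shows "(\<lambda>n. LINT x|lebesgue_on U. f n x * g x) \<longlonglongrightarrow> (LINT x|lebesgue_on U. l x * g x)"
proof (rule LIMSEQ_I)
  fix r :: real assume r: "r > 0"
  let ?B = "LINT x|lebesgue_on U. (g x)\<^sup>2"
  define e where "e = r / (?B + 1)"
  have B: "?B \<ge> 0" by simp
  have B1: "?B + 1 > 0" using B by linarith
  have e: "e > 0" "e * ?B < r"
  proof -
    show "e > 0" using r B1 by (simp add: e_def)
    have "e * ?B < e * (?B + 1)" using \<open>e > 0\<close> by simp
    also have "\<dots> = r" using B1 by (simp add: e_def)
    finally show "e * ?B < r" .
  qed
  have l: "L2_on U l" and ev: "\<forall>\<^sub>F n in sequentially. L2_on U (f n)"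
    and lim: "(\<lambda>n. LINT x|lebesgue_on U. (norm (f n x - l x))\<^sup>2) \<longlonglongrightarrow> 0"
    using assms(1) by (auto simp: L2_converges_def)
  have "\<forall>\<^sub>F n in sequentially. (LINT x|lebesgue_on U. (norm (f n x - l x))\<^sup>2) < e * r"
    using order_tendstoD(2)[OF lim] e r by simp
  then have "\<forall>\<^sub>F n in sequentially. norm ((LINT x|lebesgue_on U. f n x * g x) - (LINT x|lebesgue_on U. l x * g x)) < r"
    using ev
  proof eventually_elim
    case (elim n)
    have d: "L2_on U (\<lambda>x. f n x - l x)" using L2_on_diff[OF elim(2) l] .
    have i1: "integrable (lebesgue_on U) (\<lambda>x. (f n x - l x)\<^sup>2)"
      and i2: "integrable (lebesgue_on U) (\<lambda>x. (g x)\<^sup>2)"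
      using d assms(2) by (auto simp: L2_on_def)
    have "\<bar>LINT x|lebesgue_on U. (f n x - l x) * g x\<bar> \<le> (LINT x|lebesgue_on U. \<bar>(f n x - l x) * g x\<bar>)"
      by (rule integral_abs_bound)
    also have "\<dots> \<le> (LINT x|lebesgue_on U. (1/(2*e)) * (f n x - l x)\<^sup>2 + (e/2) * (g x)\<^sup>2)"
    proof (rule integral_mono)
      show "integrable (lebesgue_on U) (\<lambda>x. \<bar>(f n x - l x) * g x\<bar>)"
        using L2_on_mult_integrable[OF d assms(2)] by auto
      show "integrable (lebesgue_on U) (\<lambda>x. (1/(2*e)) * (f n x - l x)\<^sup>2 + (e/2) * (g x)\<^sup>2)"
        using i1 i2 by auto
      fix x
      let ?a = "\<bar>f n x - l x\<bar>" and ?b = "\<bar>g x\<bar>"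
      have "0 \<le> (?a - e * ?b)\<^sup>2" by simp
      then have "2 * e * (?a * ?b) \<le> ?a\<^sup>2 + e\<^sup>2 * ?b\<^sup>2"
        by (simp add: power2_diff power_mult_distrib algebra_simps)
      then show "\<bar>(f n x - l x) * g x\<bar> \<le> (1/(2*e)) * (f n x - l x)\<^sup>2 + (e/2) * (g x)\<^sup>2"
        using e unfolding abs_mult by (simp add: field_simps power2_eq_square)
    qed
    also have "\<dots> = (1/(2*e)) * (LINT x|lebesgue_on U. (f n x - l x)\<^sup>2) + (e/2) * ?B"
      using i1 i2 by simp
    also have "\<dots> < (1/(2*e)) * (e * r) + r / 2"
      using elim(1) e by (intro add_strict_mono mult_strict_left_mono) auto
    also have "\<dots> = r" using e by simp
    finally have "\<bar>LINT x|lebesgue_on U. (f n x - l x) * g x\<bar> < r" .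
    moreover have "(LINT x|lebesgue_on U. (f n x - l x) * g x)
        = (LINT x|lebesgue_on U. f n x * g x) - (LINT x|lebesgue_on U. l x * g x)"
      using L2_on_mult_integrable[OF elim(2) assms(2)] L2_on_mult_integrable[OF l assms(2)]
      by (simp add: left_diff_distrib)
    ultimately show ?case by simp
  qed
  then show "\<exists>no. \<forall>n\<ge>no. norm ((LINT x|lebesgue_on U. f n x * g x) - (LINT x|lebesgue_on U. l x * g x)) < r"
    by (simp add: eventually_sequentially)
qed

lemma L2_converges_diff:
  fixes f :: "nat \<Rightarrow> 'a::euclidean_space \<Rightarrow> real"
  assumes "L2_converges U f l" "L2_converges U g m"
  shows "L2_converges U (\<lambda>n x. f n x - g n x) (\<lambda>x. l x - m x)"
  unfolding L2_converges_def
proof (intro conjI)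
  have l: "L2_on U l" and evf: "\<forall>\<^sub>F n in sequentially. L2_on U (f n)"
    and limf: "(\<lambda>n. LINT x|lebesgue_on U. (norm (f n x - l x))\<^sup>2) \<longlonglongrightarrow> 0"
    using assms(1) by (auto simp: L2_converges_def)
  have m: "L2_on U m" and evg: "\<forall>\<^sub>F n in sequentially. L2_on U (g n)"
    and limg: "(\<lambda>n. LINT x|lebesgue_on U. (norm (g n x - m x))\<^sup>2) \<longlonglongrightarrow> 0"
    using assms(2) by (auto simp: L2_converges_def)
  show "L2_on U (\<lambda>x. l x - m x)" using l m by (rule L2_on_diff)
  show "\<forall>\<^sub>F n in sequentially. L2_on U (\<lambda>x. f n x - g n x)"
    using evf evg by eventually_elim (rule L2_on_diff)
  show "(\<lambda>n. LINT x|lebesgue_on U. (norm (f n x - g n x - (l x - m x)))\<^sup>2) \<longlonglongrightarrow> 0"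
  proof (rule tendsto_sandwich[OF _ _ tendsto_const])
    show "(\<lambda>n. 2 * (LINT x|lebesgue_on U. (norm (f n x - l x))\<^sup>2) + 2 * (LINT x|lebesgue_on U. (norm (g n x - m x))\<^sup>2)) \<longlonglongrightarrow> 0"
      using tendsto_add[OF tendsto_mult_left[OF limf, of 2] tendsto_mult_left[OF limg, of 2]] by simp
    show "\<forall>\<^sub>F n in sequentially. (LINT x|lebesgue_on U. (norm (f n x - g n x - (l x - m x)))\<^sup>2)
       \<le> 2 * (LINT x|lebesgue_on U. (norm (f n x - l x))\<^sup>2) + 2 * (LINT x|lebesgue_on U. (norm (g n x - m x))\<^sup>2)"
      using evf evg
    proof eventually_elim
      case (elim n)
      have i1: "integrable (lebesgue_on U) (\<lambda>x. (norm (f n x - l x))\<^sup>2)"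
        using L2_on_diff[OF elim(1) l] by (simp add: L2_on_def)
      have i2: "integrable (lebesgue_on U) (\<lambda>x. (norm (g n x - m x))\<^sup>2)"
        using L2_on_diff[OF elim(2) m] by (simp add: L2_on_def)
      have i3: "integrable (lebesgue_on U) (\<lambda>x. (norm (f n x - g n x - (l x - m x)))\<^sup>2)"
        using L2_on_diff[OF L2_on_diff[OF elim] L2_on_diff[OF l m]] by (simp add: L2_on_def)
      have "(LINT x|lebesgue_on U. (norm (f n x - g n x - (l x - m x)))\<^sup>2)
        \<le> (LINT x|lebesgue_on U. 2 * (norm (f n x - l x))\<^sup>2 + 2 * (norm (g n x - m x))\<^sup>2)"
      proof (rule integral_mono[OF i3])
        show "integrable (lebesgue_on U) (\<lambda>x. 2 * (norm (f n x - l x))\<^sup>2 + 2 * (norm (g n x - m x))\<^sup>2)"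
          using i1 i2 by auto
        fix x
        have "0 \<le> ((f n x - l x) + (g n x - m x))\<^sup>2" by simp
        then show "(norm (f n x - g n x - (l x - m x)))\<^sup>2 \<le> 2 * (norm (f n x - l x))\<^sup>2 + 2 * (norm (g n x - m x))\<^sup>2"
          by (simp add: power2_eq_square algebra_simps)
      qed
      also have "\<dots> = 2 * (LINT x|lebesgue_on U. (norm (f n x - l x))\<^sup>2) + 2 * (LINT x|lebesgue_on U. (norm (g n x - m x))\<^sup>2)"
        using i1 i2 by simp
      finally show ?case .
    qed
  qed simp
qed

lemma L2_converges_const:
  fixes f :: "'a::euclidean_space \<Rightarrow> 'b::euclidean_space"
  shows "L2_on U f \<Longrightarrow> L2_converges U (\<lambda>n. f) f"
  by (simp add: L2_converges_def)

lemma L1_loc_integrable: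
  fixes f :: "'a::euclidean_space \<Rightarrow> 'b::euclidean_space"
  assumes "L1_loc U f" "compact K" "K \<subseteq> U"
  shows "integrable (lebesgue_on K) f"
  using assms lmeasurable_compact[of K]
  by (auto simp: L1_loc_def intro: absolutely_integrable_imp_integrable)

lemma L1_locI:
  fixes f :: "'a::euclidean_space \<Rightarrow> 'b::euclidean_space"
  assumes "\<And>K. compact K \<Longrightarrow> K \<subseteq> U \<Longrightarrow> integrable (lebesgue_on K) f"
  shows "L1_loc U f"
  unfolding L1_loc_def set_integrable_def
proof (intro allI impI)
  fix K assume K: "compact K \<and> K \<subseteq> U"
  then have "K \<in> sets lebesgue" using lmeasurable_compact by blast
  then show "integrable lebesgue (\<lambda>x. indicat_real K x *\<^sub>R f x)"
    using assms[of K] K by (simp add: integrable_restrict_space)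
qed

lemma open_compact_exhaustion:
  fixes U :: "'a::euclidean_space set"
  assumes "open U"
  obtains C where "\<And>n. compact (C n)" "\<And>n. C n \<subseteq> U" "\<And>n. C n \<in> sets lebesgue"
    "\<And>x. x \<in> U \<Longrightarrow> \<forall>\<^sub>F n in sequentially. x \<in> C n"
proof -
  obtain C where C: "\<And>n. compact (C n)" "\<And>n. C n \<subseteq> U" "\<And>n. C n \<subseteq> interior (C (Suc n))" "\<Union>(range C) = U"
    using open_Union_compact_subsets[OF assms] by metis
  have inc: "C n \<subseteq> C m" if "n \<le> m" for n m
    using lift_Suc_mono_le[of C, OF _ that] C(3) interior_subset by blast
  show ?thesis
  proof (rule that[OF C(1,2)])
    show "C n \<in> sets lebesgue" for n using C(1) lmeasurable_compact by blast
    fix x assume "x \<in> U"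
    then obtain n where "x \<in> C n" using C(4) by auto
    then show "\<forall>\<^sub>F n in sequentially. x \<in> C n" using inc by (intro eventually_sequentiallyI[of n]) blast
  qed
qed

lemma L1_loc_const: "L1_loc U (\<lambda>_. a :: real)"
  by (rule L1_locI) (auto intro!: integrable_lebesgue_on_bounded[where C = "\<bar>a\<bar>"] lmeasurable_compact)

lemma L1_loc_measurable:
  fixes f :: "'a::euclidean_space \<Rightarrow> 'b::euclidean_space"
  assumes "L1_loc U f" "open U"
  shows "f \<in> borel_measurable (lebesgue_on U)"
proof -
  obtain C where C: "\<And>n. compact (C n)" "\<And>n. C n \<subseteq> U" "\<And>n. C n \<in> sets lebesgue"
    and ex: "\<And>x. x \<in> U \<Longrightarrow> \<forall>\<^sub>F n in sequentially. x \<in> C n"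
    using open_compact_exhaustion[OF assms(2)] by metis
  have "(\<lambda>x. indicator U x *\<^sub>R f x) \<in> borel_measurable lebesgue"
  proof (rule borel_measurable_LIMSEQ_metric)
    show "(\<lambda>x. indicator (C n) x *\<^sub>R f x) \<in> borel_measurable lebesgue" for n
    proof -
      have "integrable (lebesgue_on (C n)) f" using L1_loc_integrable[OF assms(1)] C by auto
      then have "integrable lebesgue (\<lambda>x. indicator (C n) x *\<^sub>R f x)"
        using C(3) by (simp add: integrable_restrict_space)
      then show ?thesis by auto
    qed
    show "(\<lambda>n. indicator (C n) x *\<^sub>R f x) \<longlonglongrightarrow> indicator U x *\<^sub>R f x" for x
    proof (cases "x \<in> U")
      case True
      have "\<forall>\<^sub>F m in sequentially. indicator (C m) x *\<^sub>R f x = indicator U x *\<^sub>R f x"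
        using ex[OF True] by eventually_elim (simp add: True)
      then show ?thesis by (rule tendsto_eventually)
    next
      case False
      then have "indicator (C m) x *\<^sub>R f x = indicator U x *\<^sub>R f x" for m
        using C(2)[of m] by (auto simp: indicator_def)
      then show ?thesis by (simp only: tendsto_const)
    qed
  qed
  then show ?thesis
    using assms(2) by (simp add: borel_measurable_restrict_space_iff)
qed

lemma L1_loc_mult_integrable:
  fixes f \<phi> :: "'a::euclidean_space \<Rightarrow> real"
  assumes "L1_loc U f" "compact K" "K \<subseteq> U" "open U" "continuous_on K \<phi>" "\<And>x. x \<notin> K \<Longrightarrow> \<phi> x = 0"
  shows "integrable (lebesgue_on U) (\<lambda>x. f x * \<phi> x)"
proof -
  have K: "K \<in> sets lebesgue" using assms(2) lmeasurable_compact by auto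
  obtain C where C: "\<And>x. x \<in> K \<Longrightarrow> \<bar>\<phi> x\<bar> \<le> C"
    using compact_imp_bounded[OF compact_continuous_image[OF assms(5,2)]] by (auto simp: bounded_iff)
  have "integrable (lebesgue_on K) (\<lambda>x. f x * \<phi> x)"
    by (rule integrable_bounded_mult[where C = C])
      (use C assms K L1_loc_integrable[of U f K] continuous_imp_measurable_on_sets_lebesgue in \<open>auto intro!: AE_I2\<close>)
  then show ?thesis
    using integrable_lebesgue_on_support[of K U "\<lambda>x. f x * \<phi> x"] assms K by auto
qed

lemma L1_loc_subset: "L1_loc U f \<Longrightarrow> V \<subseteq> U \<Longrightarrow> L1_loc V f"
  unfolding L1_loc_def by blast

lemma L1_loc_diff:
  fixes f g :: "'a::euclidean_space \<Rightarrow> 'b::euclidean_space"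
  assumes "L1_loc U f" "L1_loc U g"
  shows "L1_loc U (\<lambda>x. f x - g x)"
  using assms by (intro L1_locI) (auto dest: L1_loc_integrable)

lemma L2_on_imp_L1_loc:
  fixes f :: "'a::euclidean_space \<Rightarrow> real"
  assumes "L2_on U f" "U \<in> sets lebesgue"
  shows "L1_loc U f"
  using assms lmeasurable_compact
  by (intro L1_locI) (auto intro!: L2_on_integrable L2_on_subset[OF assms(1)])

section \<open>Test functions and the fundamental lemma of the calculus of variations\<close>

lemma C1_const: "C1_with_gradient (\<lambda>_. a) (\<lambda>_. 0)"
  by (simp add: C1_with_gradient_def GDERIV_const)

lemma C1_add:
  assumes "C1_with_gradient \<phi> D" "C1_with_gradient \<psi> E"
  shows "C1_with_gradient (\<lambda>x. \<phi> x + \<psi> x) (\<lambda>x. D x + E x)"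
  using assms by (auto simp: C1_with_gradient_def intro!: GDERIV_add continuous_intros)

lemma C1_continuous: "C1_with_gradient \<phi> D \<Longrightarrow> continuous_on S \<phi>"
  unfolding C1_with_gradient_def gderiv_def
  by (meson continuous_at_imp_continuous_on has_derivative_continuous)

lemma C1_gradient_continuous: "C1_with_gradient \<phi> D \<Longrightarrow> continuous_on S D"
  unfolding C1_with_gradient_def using continuous_on_subset by blast

lemma C1_mult:
  assumes "C1_with_gradient \<phi> D" "C1_with_gradient \<psi> E"
  shows "C1_with_gradient (\<lambda>x. \<phi> x * \<psi> x) (\<lambda>x. \<phi> x *\<^sub>R E x + \<psi> x *\<^sub>R D x)"
  using assms C1_continuous[OF assms(1)] C1_continuous[OF assms(2)]
  by (auto simp: C1_with_gradient_def intro!: GDERIV_mult continuous_intros)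

lemma C1_cmult:
  assumes "C1_with_gradient \<phi> D"
  shows "C1_with_gradient (\<lambda>x. a * \<phi> x) (\<lambda>x. a *\<^sub>R D x)"
  using C1_mult[OF C1_const[of a] assms] by simp

lemma C1_diff:
  assumes "C1_with_gradient \<phi> D" "C1_with_gradient \<psi> E"
  shows "C1_with_gradient (\<lambda>x. \<phi> x - \<psi> x) (\<lambda>x. D x - E x)"
  using C1_add[OF assms(1) C1_cmult[OF assms(2), of "-1"]] by simp

lemma C1_sum:
  assumes "finite I" "\<And>i. i \<in> I \<Longrightarrow> C1_with_gradient (\<phi> i) (D i)"
  shows "C1_with_gradient (\<lambda>x. \<Sum>i\<in>I. \<phi> i x) (\<lambda>x. \<Sum>i\<in>I. D i x)"
  using assms by (induction I rule: finite_induct) (auto intro: C1_const C1_add)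

lemma C1_compose:
  assumes "C1_with_gradient \<phi> D" "\<And>t. (h has_real_derivative h' t) (at t)" "continuous_on UNIV h'"
  shows "C1_with_gradient (\<lambda>x. h (\<phi> x)) (\<lambda>x. h' (\<phi> x) *\<^sub>R D x)"
proof -
  have "continuous_on UNIV (\<lambda>x. h' (\<phi> x))"
    using continuous_on_compose2[OF assms(3) C1_continuous[OF assms(1)]] by simp
  moreover have "GDERIV (\<lambda>x. h (\<phi> x)) x :> h' (\<phi> x) *\<^sub>R D x" for x
    using assms(1,2) by (intro GDERIV_DERIV_compose) (auto simp: C1_with_gradient_def)
  ultimately show ?thesis
    using assms(1) by (auto simp: C1_with_gradient_def intro!: continuous_intros)
qed

lemma C1_bounded_linear:
  fixes f :: "'a::euclidean_space \<Rightarrow> real"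
  assumes "bounded_linear f"
  shows "C1_with_gradient f (\<lambda>_. \<Sum>b\<in>Basis. f b *\<^sub>R b)"
proof -
  have key: "f h = h \<bullet> (\<Sum>b\<in>Basis. f b *\<^sub>R b)" for h
  proof -
    have "f h = f (\<Sum>b\<in>Basis. (h \<bullet> b) *\<^sub>R b)" by (simp add: euclidean_representation)
    also have "\<dots> = (\<Sum>b\<in>Basis. (h \<bullet> b) * f b)"
      using bounded_linear.linear[OF assms] by (simp add: linear_sum linear_scale)
    finally show ?thesis by (simp add: inner_sum_right mult.commute)
  qed
  have "(\<lambda>h. h \<bullet> (\<Sum>b\<in>Basis. f b *\<^sub>R b)) = f" by (rule ext) (rule key[symmetric])
  then have "GDERIV f x :> (\<Sum>b\<in>Basis. f b *\<^sub>R b)" for x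
    unfolding gderiv_def by (simp only: bounded_linear_imp_has_derivative[OF assms])
  then show ?thesis by (simp add: C1_with_gradient_def)
qed

lemma C1_real_polynomial_function:
  fixes f :: "'a::euclidean_space \<Rightarrow> real"
  assumes "real_polynomial_function f"
  shows "\<exists>D. C1_with_gradient f D"
  using assms
  by (induction rule: real_polynomial_function.induct)
    (blast intro: C1_bounded_linear C1_const C1_add C1_mult)+

lemma C1_gradient_zero_outside:
  fixes \<phi> :: "'a::euclidean_space \<Rightarrow> real"
  assumes "C1_with_gradient \<phi> D" "open V" "x \<in> V" "\<And>y. y \<in> V \<Longrightarrow> \<phi> y = a"
  shows "D x = 0"
proof -
  have "(\<phi> has_derivative (\<lambda>h. h \<bullet> D x)) (at x)"
    using assms(1) by (auto simp: C1_with_gradient_def gderiv_def)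
  moreover have "(\<phi> has_derivative (\<lambda>h. 0)) (at x)"
  proof (rule has_derivative_transform_within_open[OF _ assms(2,3)])
    show "((\<lambda>_. a) has_derivative (\<lambda>h. 0)) (at x)" by simp
  qed (use assms(4) in auto)
  ultimately have "(\<lambda>h. h \<bullet> D x) = (\<lambda>h. 0)"
    by (rule has_derivative_unique)
  then have "D x \<bullet> D x = 0" by meson
  then show ?thesis by simp
qed

lemma pos_part_square_derivative:
  "((\<lambda>t. (max 0 t)\<^sup>2) has_real_derivative 2 * max 0 t) (at (t::real))"
proof (cases "t = 0")
  case True
  have "((\<lambda>h. (max 0 h)\<^sup>2 / h) \<longlongrightarrow> 0) (at (0::real))"
  proof (rule tendsto_sandwich[of "\<lambda>h. - \<bar>h\<bar>" _ _ "\<lambda>h. \<bar>h\<bar>"])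
    show "\<forall>\<^sub>F h in at (0::real). - \<bar>h\<bar> \<le> (max 0 h)\<^sup>2 / h"
      by (rule always_eventually) (auto simp: max_def power2_eq_square)
    show "\<forall>\<^sub>F h in at (0::real). (max 0 h)\<^sup>2 / h \<le> \<bar>h\<bar>"
      by (rule always_eventually) (auto simp: max_def power2_eq_square)
  qed (auto intro!: tendsto_eq_intros)
  then show ?thesis using True by (simp add: DERIV_def)
next
  case False
  show ?thesis
  proof (cases "t > 0")
    case True
    have "((\<lambda>t. t\<^sup>2) has_real_derivative 2 * t) (at t)"
      by (auto intro!: derivative_eq_intros)
    then have "((\<lambda>t. (max 0 t)\<^sup>2) has_real_derivative 2 * t) (at t)"
      by (rule has_field_derivative_transform_within_open[of _ _ _ "{0<..}"]) (use True in auto)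
    then show ?thesis using True by simp
  next
    case False
    have "((\<lambda>t::real. 0::real) has_real_derivative 0) (at t)" by simp
    then have "((\<lambda>t. (max 0 t)\<^sup>2) has_real_derivative 0) (at t)"
      by (rule has_field_derivative_transform_within_open[of _ _ _ "{..<0}"]) (use False \<open>t \<noteq> 0\<close> in auto)
    then show ?thesis using False by simp
  qed
qed

text \<open>A function that is positive exactly on a ball; it is \<open>C\<^sup>1\<close> in any Euclidean space because only the square of the norm enters.\<close>

lemma C1_ball_bump:
  fixes a :: "'a::euclidean_space"
  shows "C1_with_gradient (\<lambda>x. (max 0 (r\<^sup>2 - (norm (x - a))\<^sup>2))\<^sup>2)
    (\<lambda>x. (2 * max 0 (r\<^sup>2 - (norm (x - a))\<^sup>2)) *\<^sub>R ((-2) *\<^sub>R (x - a)))"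
proof -
  have "C1_with_gradient (\<lambda>x. r\<^sup>2 - (norm (x - a))\<^sup>2) (\<lambda>x. (-2) *\<^sub>R (x - a))"
    unfolding C1_with_gradient_def gderiv_def power2_norm_eq_inner
    by (auto intro!: derivative_eq_intros continuous_intros simp: inner_commute algebra_simps)
  from C1_compose[OF this pos_part_square_derivative] show ?thesis
    by (simp add: continuous_intros)
qed

text \<open>Finitely many such bumps whose balls cover a compact set give a cutoff function.\<close>

lemma exists_C1_positive_on_compact:
  fixes K U :: "'a::euclidean_space set"
  assumes "compact K" "open U" "K \<subseteq> U"
  obtains B D S where "C1_with_gradient B D" "compact S" "S \<subseteq> U" "\<And>x. x \<notin> S \<Longrightarrow> B x = 0"
    "\<And>x. x \<in> K \<Longrightarrow> B x > 0"
proof -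
  have "\<exists>r>0. cball x r \<subseteq> U" if "x \<in> K" for x
    using assms(2,3) that open_contains_cball by blast
  then obtain r where r: "\<And>x. x \<in> K \<Longrightarrow> r x > 0 \<and> cball x (r x) \<subseteq> U" by metis
  have "K \<subseteq> (\<Union>x\<in>K. ball x (r x))" using r by force
  then obtain F where F: "F \<subseteq> K" "finite F" "K \<subseteq> (\<Union>x\<in>F. ball x (r x))"
    using compactE_image[OF assms(1), of K "\<lambda>x. ball x (r x)"] by auto
  let ?b = "\<lambda>a x. (max 0 ((r a)\<^sup>2 - (norm (x - a))\<^sup>2))\<^sup>2"
  show ?thesis
  proof
    show "C1_with_gradient (\<lambda>x. \<Sum>a\<in>F. ?b a x)
        (\<lambda>x. \<Sum>a\<in>F. (2 * max 0 ((r a)\<^sup>2 - (norm (x - a))\<^sup>2)) *\<^sub>R ((-2) *\<^sub>R (x - a)))"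
      by (rule C1_sum[OF F(2) C1_ball_bump])
    show "compact (\<Union>a\<in>F. cball a (r a))" using F(2) by auto
    show "(\<Union>a\<in>F. cball a (r a)) \<subseteq> U" using F(1) r by blast
    show "(\<Sum>a\<in>F. ?b a x) = 0" if "x \<notin> (\<Union>a\<in>F. cball a (r a))" for x
    proof (rule sum.neutral, rule ballI)
      fix a assume a: "a \<in> F"
      then have "r a < norm (x - a)" "0 < r a"
        using that r F(1) by (auto simp: dist_norm norm_minus_commute)
      then have "(r a)\<^sup>2 \<le> (norm (x - a))\<^sup>2" by (intro power_mono) auto
      then show "?b a x = 0" by simp
    qed
    show "(\<Sum>a\<in>F. ?b a x) > 0" if x: "x \<in> K" for x
    proof -
      obtain a where a: "a \<in> F" "x \<in> ball a (r a)" using F(3) x by blast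
      have "norm (x - a) < r a" using a by (simp add: dist_norm norm_minus_commute)
      then have "(norm (x - a))\<^sup>2 < (r a)\<^sup>2" by (intro power_strict_mono) auto
      then have "?b a x > 0" by simp
      then show ?thesis using a F(2) by (intro sum_pos2[of F a]) auto
    qed
  qed
qed

text \<open>Composed with a function \<open>B\<close>, the profiles \<open>t \<mapsto> n t\<^sup>2 / (1 + n t\<^sup>2)\<close> are \<open>C\<^sup>1\<close> approximations of the indicator of the set
  where \<open>B\<close> is not zero.\<close>

lemma
  fixes n :: nat
  defines "h \<equiv> \<lambda>t::real. real n * t\<^sup>2 / (1 + real n * t\<^sup>2)"
  shows cutoff_profile_derivative: "(h has_real_derivative 2 * real n * t / (1 + real n * t\<^sup>2)\<^sup>2) (at t)"
    and cutoff_profile_bounds: "0 \<le> h t" "h t \<le> 1"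
proof -
  have pos: "1 + real n * t\<^sup>2 > 0" by (simp add: add_pos_nonneg)
  show "(h has_real_derivative 2 * real n * t / (1 + real n * t\<^sup>2)\<^sup>2) (at t)"
    unfolding h_def using pos
    by (auto intro!: derivative_eq_intros simp: power2_eq_square field_simps)
  show "0 \<le> h t" "h t \<le> 1" using pos by (auto simp: h_def)
qed

lemma cutoff_profile_tendsto:
  assumes "t \<noteq> 0"
  shows "(\<lambda>n. real n * t\<^sup>2 / (1 + real n * t\<^sup>2)) \<longlonglongrightarrow> 1"
proof -
  have "(\<lambda>n. 1 - inverse (1 + real n * t\<^sup>2)) \<longlonglongrightarrow> 1 - 0"
  proof (intro tendsto_intros tendsto_inverse_0_at_top)
    show "filterlim (\<lambda>n. 1 + real n * t\<^sup>2) at_top sequentially"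
      using assms by (intro filterlim_tendsto_add_at_top[OF tendsto_const]
          filterlim_at_top_mult_tendsto_pos[OF tendsto_const] filterlim_real_sequentially) auto
  qed
  moreover have "1 - inverse (1 + real n * t\<^sup>2) = real n * t\<^sup>2 / (1 + real n * t\<^sup>2)" for n
  proof -
    have "1 + real n * t\<^sup>2 > 0" by (simp add: add_pos_nonneg)
    then show ?thesis by (simp add: field_simps)
  qed
  ultimately show ?thesis by simp
qed

text \<open>A bounded measurable function is an almost everywhere limit of continuous functions. These
  are truncated, replaced by polynomials close to them on a compact neighbourhood, and
  multiplied with cutoff functions.\<close>

lemma C1_approximation:
  fixes g :: "'a::euclidean_space \<Rightarrow> real"
  assumes g: "g \<in> borel_measurable lebesgue" and K: "compact K" "open U" "K \<subseteq> U"
    and g0: "\<And>x. x \<notin> K \<Longrightarrow> g x = 0" and bd: "\<And>x. l \<le> g x" "\<And>x. g x \<le> u" and lu: "l \<le> 0" "0 \<le> u"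
  obtains \<phi> D S where "\<And>n. C1_with_gradient (\<phi> n) (D n)" "compact S" "S \<subseteq> U"
    "\<And>n x. x \<notin> S \<Longrightarrow> \<phi> n x = 0" "\<And>n x. l \<le> \<phi> n x" "\<And>n x. \<phi> n x \<le> u + 2"
    "AE x in lebesgue. (\<lambda>n. \<phi> n x) \<longlonglongrightarrow> g x"
proof -
  obtain B E S where B: "C1_with_gradient B E" "compact S" "S \<subseteq> U" "\<And>x. x \<notin> S \<Longrightarrow> B x = 0"
    "\<And>x. x \<in> K \<Longrightarrow> B x > 0" using exists_C1_positive_on_compact[OF K] by blast
  have "g measurable_on UNIV" using lebesgue_measurable_imp_measurable_on_real[OF g] by simp
  then obtain N G where N: "negligible N" and G: "\<And>n. continuous_on UNIV (G n)"
    and lim: "\<And>x. x \<notin> N \<Longrightarrow> (\<lambda>n. G n x) \<longlonglongrightarrow> g x"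
    by (auto simp: measurable_on_def)
  let ?C = "\<lambda>n x. max l (min u (G n x))"
  have limC: "(\<lambda>n. ?C n x) \<longlonglongrightarrow> g x" if "x \<notin> N" for x
  proof -
    have "(\<lambda>n. ?C n x) \<longlonglongrightarrow> max l (min u (g x))"
      by (intro tendsto_intros lim that)
    then show ?thesis using bd[of x] by simp
  qed
  have "\<exists>P. real_polynomial_function P \<and> (\<forall>x\<in>S. \<bar>?C n x + 1 / Suc n - P x\<bar> < 1 / Suc n)" for n
  proof -
    have "continuous_on S (\<lambda>x. ?C n x + 1 / Suc n)"
      by (intro continuous_intros continuous_on_subset[OF G]) auto
    moreover have "0 < 1 / real (Suc n)" by simp
    ultimately obtain Q where "real_polynomial_function Q" "\<And>x. x \<in> S \<Longrightarrow> \<bar>?C n x + 1 / Suc n - Q x\<bar> < 1 / Suc n"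
      using Stone_Weierstrass_real_polynomial_function[OF B(2)] by blast
    then show ?thesis by blast
  qed
  then have "\<exists>P. \<forall>n. real_polynomial_function (P n) \<and> (\<forall>x\<in>S. \<bar>?C n x + 1 / Suc n - P n x\<bar> < 1 / Suc n)"
    by (intro choice allI)
  then obtain P where P: "\<And>n. real_polynomial_function (P n)"
    "\<And>n x. x \<in> S \<Longrightarrow> \<bar>?C n x + 1 / Suc n - P n x\<bar> < 1 / Suc n" by blast
  obtain PD where PD: "\<And>n. C1_with_gradient (P n) (PD n)"
    using C1_real_polynomial_function[OF P(1)] by metis
  let ?h = "\<lambda>n x. real n * (B x)\<^sup>2 / (1 + real n * (B x)\<^sup>2)"
  let ?hD = "\<lambda>n x. (2 * real n * B x / (1 + real n * (B x)\<^sup>2)\<^sup>2) *\<^sub>R E x"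
  have h: "C1_with_gradient (?h n) (?hD n)" for n
  proof (rule C1_compose[OF B(1) cutoff_profile_derivative])
    have "1 + real n * t\<^sup>2 > 0" for t :: real
      by (simp add: add_pos_nonneg)
    then have "1 + real n * t\<^sup>2 \<noteq> 0" for t :: real
      by (metis less_irrefl)
    then show "continuous_on UNIV (\<lambda>t. 2 * real n * t / (1 + real n * t\<^sup>2)\<^sup>2)"
      by (auto intro!: continuous_intros)
  qed
  have Pb: "?C n x \<le> P n x" "P n x \<le> ?C n x + 2 / Suc n" if "x \<in> S" for n x
    using P(2)[OF that, of n] by (auto simp: abs_less_iff add_divide_distrib)
  have two: "2 / real (Suc n) \<le> 2" for n by (simp add: field_simps)
  show ?thesis
  proof
    show "C1_with_gradient (\<lambda>x. P n x * ?h n x) (\<lambda>x. P n x *\<^sub>R ?hD n x + ?h n x *\<^sub>R PD n x)" for n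
      by (rule C1_mult[OF PD h])
    show "compact S" "S \<subseteq> U" by fact+
    show z: "P n x * ?h n x = 0" if "x \<notin> S" for n x using B(4)[OF that] by simp
    show "l \<le> P n x * ?h n x" for n x
    proof (cases "x \<in> S")
      case True
      have "l \<le> P n x" using Pb(1)[OF True, of n] by linarith
      have "l \<le> l * ?h n x"
        using cutoff_profile_bounds[of n "B x"] lu(1) mult_left_mono_neg[of "?h n x" 1 l] by linarith
      also have "\<dots> \<le> P n x * ?h n x"
        using cutoff_profile_bounds[of n "B x"] \<open>l \<le> P n x\<close> by (intro mult_right_mono) auto
      finally show ?thesis .
    next
      case False
      show ?thesis unfolding z[OF False] by (rule lu)
    qed
    show "P n x * ?h n x \<le> u + 2" for n x
    proof (cases "x \<in> S")
      case True
      have "P n x \<le> u + 2" using Pb(2)[OF True, of n] two[of n] lu by linarith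
      then have "P n x * ?h n x \<le> (u + 2) * ?h n x"
        using cutoff_profile_bounds[of n "B x"] by (intro mult_right_mono) auto
      also have "\<dots> \<le> u + 2"
        using cutoff_profile_bounds[of n "B x"] lu(2) by (intro mult_left_le) auto
      finally show ?thesis .
    next
      case False
      show ?thesis unfolding z[OF False] using lu by simp
    qed
    have *: "(\<lambda>n. P n x * ?h n x) \<longlonglongrightarrow> g x" if "x \<notin> N" for x
    proof (cases "x \<in> S")
      case True
      have "(\<lambda>n. P n x) \<longlonglongrightarrow> g x"
      proof (rule tendsto_sandwich[OF _ _ limC[OF that]])
        have "(\<lambda>n. 2 * inverse (real (Suc n))) \<longlonglongrightarrow> 2 * 0"
          by (intro tendsto_intros LIMSEQ_inverse_real_of_nat)
        then show "(\<lambda>n. ?C n x + 2 / Suc n) \<longlonglongrightarrow> g x"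
          using tendsto_add[OF limC[OF that]] unfolding divide_inverse by fastforce
      qed (use Pb[OF True] in auto)
      moreover have "(\<lambda>n. P n x * ?h n x) \<longlonglongrightarrow> g x * (if B x = 0 then 0 else 1)"
      proof (cases "B x = 0")
        case False
        then show ?thesis using tendsto_mult[OF calculation cutoff_profile_tendsto[OF False]] by simp
      qed simp
      moreover have "B x = 0 \<Longrightarrow> g x = 0" using B(5)[of x] g0[of x] by force
      ultimately show ?thesis by (auto split: if_splits)
    next
      case False
      then have "x \<notin> K" using B(4,5) by force
      then have "g x = 0" by (rule g0)
      then show ?thesis unfolding z[OF False] by simp
    qed
    show "AE x in lebesgue. (\<lambda>n. P n x * ?h n x) \<longlonglongrightarrow> g x"
      by (rule AE_I'[of N]) (use N * in \<open>auto simp: negligible_iff_null_sets\<close>)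
  qed
qed

lemma integral_lebesgue_on_if:
  fixes f :: "'a::euclidean_space \<Rightarrow> 'b::euclidean_space"
  assumes "S \<in> sets lebesgue"
  shows "integral\<^sup>L (lebesgue_on S) f = integral\<^sup>L lebesgue (\<lambda>x. if x \<in> S then f x else 0)"
  by (rule Lebesgue_Measure.integral_restrict_UNIV[OF assms, symmetric])

text \<open>The fundamental lemma of the calculus of variations for inequalities: on a compact \<open>K\<close> the
  test functions approximate the indicator of \<open>{x \<in> K. f x < 0}\<close>, over which \<open>f\<close> then has a nonnegative
  integral.\<close>

lemma AE_nonneg_if_tested_nonneg:
  fixes f :: "'a::euclidean_space \<Rightarrow> real"
  assumes U: "open U" and f: "L1_loc U f"
    and test: "\<And>\<phi> D. C1_with_gradient \<phi> D \<Longrightarrow> compactly_supported_in U \<phi> \<Longrightarrow> (\<And>x. \<phi> x \<ge> 0) \<Longrightarrow>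
      (LINT x|lebesgue_on U. f x * \<phi> x) \<ge> 0"
  shows "AE x in lebesgue_on U. f x \<ge> 0"
proof -
  have comp: "AE x in lebesgue. x \<in> K \<longrightarrow> f x \<ge> 0" if K: "compact K" "K \<subseteq> U" for K
  proof -
    have Ks: "K \<in> sets lebesgue" using K(1) lmeasurable_compact by blast
    have fK: "integrable (lebesgue_on K) f" using L1_loc_integrable[OF f K] .
    define E where "E = {x \<in> K. f x < 0}"
    have "E \<in> sets (lebesgue_on K)"
    proof -
      have "{x \<in> space (lebesgue_on K). f x < 0} \<in> sets (lebesgue_on K)"
        using borel_measurable_integrable[OF fK] by measurable
      then show ?thesis by (simp add: E_def)
    qed
    then have Es: "E \<in> sets lebesgue" using Ks by (auto simp: sets_restrict_space_iff)
    have "indicat_real E \<in> borel_measurable lebesgue" using Es by simp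
    from C1_approximation[OF this K(1) U K(2), of 0 1]
    obtain \<phi> D S where p: "\<And>n. C1_with_gradient (\<phi> n) (D n)" "compact S" "S \<subseteq> U"
      "\<And>n x. x \<notin> S \<Longrightarrow> \<phi> n x = 0" "\<And>n x. 0 \<le> \<phi> n x" "\<And>n x. \<phi> n x \<le> 1 + 2"
      and lim: "AE x in lebesgue. (\<lambda>n. \<phi> n x) \<longlonglongrightarrow> indicat_real E x"
      by (auto simp: E_def indicator_def)
    have Ss: "S \<in> sets lebesgue" using p(2) lmeasurable_compact by blast
    have Us: "U \<in> sets lebesgue" using U by simp
    let ?f = "\<lambda>x. if x \<in> U then f x else 0"
    let ?fS = "\<lambda>x. if x \<in> S then f x else 0"
    have fS: "integrable lebesgue ?fS"
      using L1_loc_integrable[OF f p(2,3)] Ss by (simp add: Lebesgue_Measure.integrable_restrict_UNIV)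
    have "(\<lambda>n. LINT x|lebesgue. ?fS x * \<phi> n x) \<longlonglongrightarrow> (LINT x|lebesgue. ?fS x * indicat_real E x)"
    proof (rule integral_dominated_convergence[where w = "\<lambda>x. 3 * \<bar>?fS x\<bar>"])
      show "AE x in lebesgue. (\<lambda>n. ?fS x * \<phi> n x) \<longlonglongrightarrow> ?fS x * indicat_real E x"
        using lim by eventually_elim (intro tendsto_intros)
      show "AE x in lebesgue. norm (?fS x * \<phi> n x) \<le> 3 * \<bar>?fS x\<bar>" for n
      proof (rule AE_I2)
        fix x
        have "\<bar>\<phi> n x\<bar> * \<bar>?fS x\<bar> \<le> 3 * \<bar>?fS x\<bar>"
          using p(5,6)[of n x] by (intro mult_right_mono) auto
        then show "norm (?fS x * \<phi> n x) \<le> 3 * \<bar>?fS x\<bar>" by (simp only: real_norm_def abs_mult mult.commute)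
      qed
      have "\<phi> n \<in> borel_measurable lebesgue" for n
        using continuous_imp_measurable_on_sets_lebesgue[OF C1_continuous[OF p(1)], of UNIV]
        by (simp add: lebesgue_on_UNIV_eq)
      then show "(\<lambda>x. ?fS x * \<phi> n x) \<in> borel_measurable lebesgue" for n
        using borel_measurable_integrable[OF fS] by measurable
      show "(\<lambda>x. ?fS x * indicat_real E x) \<in> borel_measurable lebesgue"
        using borel_measurable_integrable[OF fS] Es by measurable
      show "integrable lebesgue (\<lambda>x. 3 * \<bar>?fS x\<bar>)" using fS by auto
    qed
    moreover have "0 \<le> (LINT x|lebesgue. ?fS x * \<phi> n x)" for n
    proof -
      have "compactly_supported_in U (\<phi> n)" using p by (auto simp: compactly_supported_in_def)
      from test[OF p(1) this p(5)] have "0 \<le> (LINT x|lebesgue_on U. f x * \<phi> n x)" .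
      also have "\<dots> = (LINT x|lebesgue_on S. f x * \<phi> n x)"
        by (rule integral_lebesgue_on_support) (use p Ss Us in auto)
      also have "\<dots> = (LINT x|lebesgue. ?fS x * \<phi> n x)"
        unfolding integral_lebesgue_on_if[OF Ss] by (intro Bochner_Integration.integral_cong) auto
      finally show ?thesis .
    qed
    ultimately have "0 \<le> (LINT x|lebesgue. ?fS x * indicat_real E x)"
      by (meson LIMSEQ_le_const)
    also have "\<dots> = (LINT x|lebesgue. - (if x \<in> E then \<bar>f x\<bar> else 0))"
    proof (rule integral_cong_AE)
      show "(\<lambda>x. ?fS x * indicat_real E x) \<in> borel_measurable lebesgue"
        using borel_measurable_integrable[OF fS] Es by measurable
      show "AE x in lebesgue. ?fS x * indicat_real E x = - (if x \<in> E then \<bar>f x\<bar> else 0)"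
        using lim
      proof eventually_elim
        case (elim x)
        show ?case
        proof (cases "x \<in> S")
          case False
          then have "indicat_real E x = 0" using p(4) LIMSEQ_unique[OF elim] by simp
          then show ?thesis using False by (auto simp: indicator_def split: if_splits)
        qed (auto simp: E_def indicator_def)
      qed
      have "(\<lambda>x. if x \<in> K then f x else 0) \<in> borel_measurable lebesgue"
        using borel_measurable_integrable[OF fK[unfolded Lebesgue_Measure.integrable_restrict_UNIV[OF Ks, symmetric]]] .
      then have "(\<lambda>x. - (indicat_real E x * \<bar>if x \<in> K then f x else 0\<bar>)) \<in> borel_measurable lebesgue"
        using Es by measurable
      also have "(\<lambda>x. - (indicat_real E x * \<bar>if x \<in> K then f x else 0\<bar>)) = (\<lambda>x. - (if x \<in> E then \<bar>f x\<bar> else 0))"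
        by (auto simp: E_def indicator_def)
      finally show "(\<lambda>x. - (if x \<in> E then \<bar>f x\<bar> else 0)) \<in> borel_measurable lebesgue" .
    qed
    finally have le: "(LINT x|lebesgue. (if x \<in> E then \<bar>f x\<bar> else 0)) \<le> 0" by simp
    have iE: "integrable lebesgue (\<lambda>x. if x \<in> E then \<bar>f x\<bar> else 0)"
      unfolding Lebesgue_Measure.integrable_restrict_UNIV[OF Es]
      using integrable_lebesgue_on_subset[OF fK _ Es Ks] by (auto simp: E_def)
    have "(LINT x|lebesgue. (if x \<in> E then \<bar>f x\<bar> else 0)) \<ge> 0" by (intro integral_nonneg_AE) auto
    with le have "(LINT x|lebesgue. (if x \<in> E then \<bar>f x\<bar> else 0)) = 0" by (rule antisym)
    then have "AE x in lebesgue. (if x \<in> E then \<bar>f x\<bar> else 0) = 0"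
      using integral_nonneg_eq_0_iff_AE[OF iE] by auto
    then show ?thesis by eventually_elim (auto simp: E_def split: if_splits)
  qed
  obtain C where C: "\<And>n. compact (C n)" "\<And>n. C n \<subseteq> U" "\<And>n. C n \<in> sets lebesgue"
    and ex: "\<And>x. x \<in> U \<Longrightarrow> \<forall>\<^sub>F n in sequentially. x \<in> C n"
    using open_compact_exhaustion[OF U] by metis
  have "AE x in lebesgue. \<forall>n. x \<in> C n \<longrightarrow> f x \<ge> 0"
    unfolding AE_all_countable using comp[OF C(1,2)] by (rule allI)
  then have "AE x in lebesgue. x \<in> U \<longrightarrow> f x \<ge> 0"
  proof eventually_elim
    case (elim x)
    show ?case using elim ex[of x] by (auto simp: eventually_sequentially)
  qed
  then show ?thesis using U by (simp add: AE_restrict_space_iff)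
qed

lemma AE_zero_if_tested_zero:
  fixes f :: "'a::euclidean_space \<Rightarrow> real"
  assumes "open U" "L1_loc U f"
    "\<And>\<phi> D. C1_with_gradient \<phi> D \<Longrightarrow> compactly_supported_in U \<phi> \<Longrightarrow> (LINT x|lebesgue_on U. f x * \<phi> x) = 0"
  shows "AE x in lebesgue_on U. f x = 0"
proof -
  have "AE x in lebesgue_on U. f x \<ge> 0"
    by (rule AE_nonneg_if_tested_nonneg[OF assms(1,2)]) (use assms(3) in auto)
  moreover have "AE x in lebesgue_on U. 0 - f x \<ge> 0"
    by (rule AE_nonneg_if_tested_nonneg[OF assms(1) L1_loc_diff[OF L1_loc_const assms(2)]]) (use assms(3) in auto)
  ultimately show ?thesis by eventually_elim auto
qed

section \<open>Weak derivatives\<close>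

lemma C1_gradient_zero_off_compact:
  fixes \<phi> :: "'a::euclidean_space \<Rightarrow> real"
  assumes "C1_with_gradient \<phi> D" "compact K" "\<And>y. y \<notin> K \<Longrightarrow> \<phi> y = 0" "x \<notin> K"
  shows "D x = 0"
proof (rule C1_gradient_zero_outside[OF assms(1)])
  show "open (- K)" using compact_imp_closed[OF assms(2)] by (simp add: open_Compl)
qed (use assms in auto)

lemma C1_compact_support_gradient_bounded:
  fixes \<phi> :: "'a::euclidean_space \<Rightarrow> real"
  assumes "C1_with_gradient \<phi> D" "compact K" "\<And>x. x \<notin> K \<Longrightarrow> \<phi> x = 0"
  obtains C where "C \<ge> 0" "\<And>x. norm (D x) \<le> C" "\<And>x. \<bar>\<phi> x\<bar> \<le> C" "\<And>x. x \<notin> K \<Longrightarrow> D x = 0"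
proof -
  have z: "D x = 0" if "x \<notin> K" for x
    using C1_gradient_zero_off_compact[OF assms that] .
  obtain C where C: "\<And>x. x \<in> K \<Longrightarrow> norm (D x) \<le> C"
    using compact_imp_bounded[OF compact_continuous_image[OF C1_gradient_continuous[OF assms(1)] assms(2)]]
    by (auto simp: bounded_iff)
  obtain C' where C': "\<And>x. x \<in> K \<Longrightarrow> norm (\<phi> x) \<le> C'"
    using compact_imp_bounded[OF compact_continuous_image[OF C1_continuous[OF assms(1)] assms(2)]]
    by (auto simp: bounded_iff)
  show ?thesis
  proof (rule that[of "\<bar>C\<bar> + \<bar>C'\<bar>"])
    show "norm (D x) \<le> \<bar>C\<bar> + \<bar>C'\<bar>" for x
      using C[of x] z[of x] by (cases "x \<in> K") auto
    show "\<bar>\<phi> x\<bar> \<le> \<bar>C\<bar> + \<bar>C'\<bar>" for x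
      using C'[of x] assms(3)[of x] by (cases "x \<in> K") auto
  qed (use z in auto)
qed

text \<open>The integral of \<open>\<phi> (x + h b)\<close> does not depend on \<open>h\<close>, and the derivative with respect to \<open>h\<close> may
  be taken under the integral.\<close>

lemma integral_gradient_compact_support_zero:
  fixes \<phi> :: "'a::euclidean_space \<Rightarrow> real"
  assumes \<phi>: "C1_with_gradient \<phi> D" and K: "compact K" "\<And>x. x \<notin> K \<Longrightarrow> \<phi> x = 0"
  shows "(LINT x|lebesgue. D x \<bullet> b) = 0"
proof -
  obtain C where C: "C \<ge> 0" "\<And>x. norm (D x) \<le> C" "\<And>x. \<bar>\<phi> x\<bar> \<le> C" "\<And>x. x \<notin> K \<Longrightarrow> D x = 0"
    using C1_compact_support_gradient_bounded[OF assms] by blast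
  have m\<phi>: "\<phi> \<in> borel_measurable borel"
    using C1_continuous[OF \<phi>, of UNIV] by (rule borel_measurable_continuous_onI)
  have mD: "D \<in> borel_measurable borel"
    using C1_gradient_continuous[OF \<phi>, of UNIV] by (rule borel_measurable_continuous_onI)
  obtain R where R: "\<And>x. x \<in> K \<Longrightarrow> norm x \<le> R" using compact_imp_bounded[OF K(1)] by (auto simp: bounded_iff)
  let ?q = "\<lambda>n x. (\<phi> (x + inverse (real (Suc n)) *\<^sub>R b) - \<phi> x) * real (Suc n)"
  have lip: "\<bar>\<phi> (x + v) - \<phi> x\<bar> \<le> C * norm v" for x v
  proof -
    have "norm (\<phi> (x + v) - \<phi> x) \<le> C * norm (x + v - x)"
    proof (rule differentiable_bound[of UNIV])
      show "(\<phi> has_derivative (\<lambda>h. h \<bullet> D y)) (at y within UNIV)" for y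
        using \<phi> by (auto simp: C1_with_gradient_def gderiv_def)
      show "onorm (\<lambda>h. h \<bullet> D y) \<le> C" for y
      proof (rule onorm_le)
        fix h show "norm (h \<bullet> D y) \<le> C * norm h"
          using Cauchy_Schwarz_ineq2[of h "D y"] mult_right_mono[OF C(2)[of y], of "norm h"]
          by (simp add: mult.commute)
      qed
    qed auto
    then show ?thesis by simp
  qed
  let ?w = "\<lambda>x. C * norm b * indicat_real (cball 0 (R + norm b)) x"
  have "(\<lambda>n. LINT x|lborel. ?q n x) \<longlonglongrightarrow> (LINT x|lborel. D x \<bullet> b)"
  proof (rule integral_dominated_convergence[where w = ?w])
    show "integrable lborel ?w"
      by (intro integrable_mult_right integrable_real_indicator emeasure_compact_finite) auto
    show "AE x in lborel. (\<lambda>n. ?q n x) \<longlonglongrightarrow> D x \<bullet> b"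
    proof (rule AE_I2)
      fix x
      have "((\<lambda>t. x + t *\<^sub>R b) has_derivative (\<lambda>t. t *\<^sub>R b)) (at (0::real))"
        by (auto intro!: derivative_eq_intros)
      moreover have "(\<phi> has_derivative (\<lambda>h. h \<bullet> D x)) (at (x + 0 *\<^sub>R b))"
        using \<phi> by (simp add: C1_with_gradient_def gderiv_def)
      ultimately have "((\<lambda>t. \<phi> (x + t *\<^sub>R b)) has_derivative (\<lambda>t. (t *\<^sub>R b) \<bullet> D x)) (at 0)"
        by (rule has_derivative_compose)
      then have "((\<lambda>t. \<phi> (x + t *\<^sub>R b)) has_real_derivative (b \<bullet> D x)) (at 0)"
        by (rule has_derivative_imp_has_field_derivative) simp
      then have "((\<lambda>h. (\<phi> (x + h *\<^sub>R b) - \<phi> x) / h) \<longlongrightarrow> b \<bullet> D x) (at 0)"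
        by (simp add: DERIV_def)
      then have "(\<lambda>n. (\<phi> (x + inverse (real (Suc n)) *\<^sub>R b) - \<phi> x) / inverse (real (Suc n))) \<longlonglongrightarrow> b \<bullet> D x"
        by (rule filterlim_compose)
          (use LIMSEQ_inverse_real_of_nat in \<open>simp add: filterlim_at del: of_nat_Suc\<close>)
      then show "(\<lambda>n. ?q n x) \<longlonglongrightarrow> D x \<bullet> b" by (simp add: divide_inverse inner_commute)
    qed
    show "AE x in lborel. norm (?q n x) \<le> ?w x" for n
    proof (rule AE_I2)
      fix x
      let ?v = "inverse (real (Suc n)) *\<^sub>R b"
      have "inverse (real (Suc n)) * norm b \<le> 1 * norm b"
        by (intro mult_right_mono) (simp_all add: inverse_le_1_iff)
      then have v: "norm ?v \<le> norm b" by simp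
      show "norm (?q n x) \<le> ?w x"
      proof (cases "x \<in> cball 0 (R + norm b)")
        case True
        have "norm (?q n x) = \<bar>\<phi> (x + ?v) - \<phi> x\<bar> * real (Suc n)"
          by (simp only: real_norm_def abs_mult abs_of_nat)
        also have "\<dots> \<le> C * norm ?v * real (Suc n)"
          by (intro mult_right_mono lip) simp
        also have "\<dots> = C * norm b" by (simp del: of_nat_Suc)
        finally show ?thesis using True by simp
      next
        case False
        then have far: "R + norm b < norm x" by simp
        then have "x \<notin> K" using R[of x] norm_ge_zero[of b] by linarith
        moreover have "x + ?v \<notin> K"
        proof
          assume "x + ?v \<in> K"
          then have "norm (x + ?v) \<le> R" by (rule R)
          moreover have "norm x \<le> norm (x + ?v) + norm ?v"
            using norm_triangle_ineq4[of "x + ?v" ?v] by simp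
          ultimately show False using far v by linarith
        qed
        ultimately show ?thesis using K(2) False by simp
      qed
    qed
  qed (use m\<phi> mD in measurable)
  moreover have "(LINT x|lborel. ?q n x) = 0" for n
  proof -
    let ?v = "inverse (real (Suc n)) *\<^sub>R b"
    have i\<phi>: "integrable lborel \<phi>"
    proof -
      have "continuous_on K \<phi>" by (rule C1_continuous[OF \<phi>])
      then have "integrable lborel (\<lambda>x. indicator K x *\<^sub>R \<phi> x)"
        by (rule borel_integrable_compact[OF K(1)])
      also have "(\<lambda>x. indicator K x *\<^sub>R \<phi> x) = \<phi>"
        using K(2) by (intro ext) (auto simp: indicator_def)
      finally show ?thesis .
    qed
    have m: "(+) ?v \<in> borel_measurable lborel" by measurable
    have "integrable (distr lborel borel ((+) ?v)) \<phi>"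
      unfolding lborel_distr_plus by (rule i\<phi>)
    then have i': "integrable lborel (\<lambda>x. \<phi> (x + ?v))"
      unfolding integrable_distr_eq[OF m m\<phi>] add.commute[of ?v] .
    have "(LINT x|lborel. \<phi> x) = (LINT x|distr lborel borel ((+) ?v). \<phi> x)"
      unfolding lborel_distr_plus ..
    also have "\<dots> = (LINT x|lborel. \<phi> (x + ?v))"
      unfolding integral_distr[OF m m\<phi>] add.commute[of ?v] ..
    finally have e: "(LINT x|lborel. \<phi> (x + ?v)) = (LINT x|lborel. \<phi> x)" by (rule sym)
    have "(LINT x|lborel. ?q n x) = (LINT x|lborel. \<phi> (x + ?v) - \<phi> x) * real (Suc n)"
      by (rule integral_mult_left_zero)
    also have "(LINT x|lborel. \<phi> (x + ?v) - \<phi> x) = 0"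
      unfolding Bochner_Integration.integral_diff[OF i' i\<phi>] e by simp
    finally show ?thesis by simp
  qed
  ultimately have "(\<lambda>n. 0) \<longlonglongrightarrow> (LINT x|lborel. D x \<bullet> b)" by (simp only:)
  then have "(LINT x|lborel. D x \<bullet> b) = 0" by (simp add: tendsto_const_iff)
  moreover have "(LINT x|lebesgue. D x \<bullet> b) = (LINT x|lborel. D x \<bullet> b)"
  proof (rule integral_completion)
    show "(\<lambda>x. D x \<bullet> b) \<in> borel_measurable lborel" using mD by measurable
  qed
  ultimately show ?thesis by simp
qed

lemma has_weak_deriv_C1:
  fixes \<phi> :: "'a::euclidean_space \<Rightarrow> real"
  assumes \<phi>: "C1_with_gradient \<phi> D" and U: "open U"
  shows "has_weak_deriv U b \<phi> (\<lambda>x. D x \<bullet> b)"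
  unfolding has_weak_deriv_def
proof (intro conjI allI impI)
  have cD: "continuous_on S (\<lambda>x. D x \<bullet> b)" for S
    by (intro continuous_intros C1_gradient_continuous[OF \<phi>])
  have L1: "L1_loc U f" if cf: "\<And>S. continuous_on S f" for f :: "'a \<Rightarrow> real"
  proof (rule L1_locI)
    fix K :: "'a set" assume K: "compact K" "K \<subseteq> U"
    then have Ks: "K \<in> sets lebesgue" using lmeasurable_compact by blast
    obtain C where "\<And>x. x \<in> K \<Longrightarrow> norm (f x) \<le> C"
      using compact_imp_bounded[OF compact_continuous_image[OF cf K(1)]] by (auto simp: bounded_iff)
    then show "integrable (lebesgue_on K) f"
      using continuous_imp_measurable_on_sets_lebesgue[OF cf Ks] lmeasurable_compact[OF K(1)]
      by (intro integrable_lebesgue_on_bounded[where C = C]) (auto intro: AE_I2)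
  qed
  show "L1_loc U \<phi>" "L1_loc U (\<lambda>x. D x \<bullet> b)"
    using L1 cD C1_continuous[OF \<phi>] by blast+
  fix \<psi> E assume "C1_with_gradient \<psi> E \<and> compactly_supported_in U \<psi>"
  then obtain K where \<psi>: "C1_with_gradient \<psi> E" and K: "compact K" "K \<subseteq> U" "\<And>x. x \<notin> K \<Longrightarrow> \<psi> x = 0"
    by (auto simp: compactly_supported_in_def)
  have Ez: "E x = 0" if "x \<notin> K" for x
    using C1_gradient_zero_off_compact[OF \<psi> K(1,3) that] .
  have i1: "integrable (lebesgue_on U) (\<lambda>x. \<phi> x * (E x \<bullet> b))"
    by (rule L1_loc_mult_integrable[OF \<open>L1_loc U \<phi>\<close> K(1,2) U])
      (use Ez C1_gradient_continuous[OF \<psi>] in \<open>auto intro!: continuous_intros\<close>)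
  have i2: "integrable (lebesgue_on U) (\<lambda>x. (D x \<bullet> b) * \<psi> x)"
    by (rule L1_loc_mult_integrable[OF \<open>L1_loc U (\<lambda>x. D x \<bullet> b)\<close> K(1,2) U])
      (use K(3) C1_continuous[OF \<psi>] in auto)
  have "0 = (LINT x|lebesgue. (\<phi> x *\<^sub>R E x + \<psi> x *\<^sub>R D x) \<bullet> b)"
    by (rule integral_gradient_compact_support_zero[symmetric, OF C1_mult[OF \<phi> \<psi>] K(1)]) (use K in auto)
  also have "\<dots> = (LINT x|lebesgue_on U. (\<phi> x *\<^sub>R E x + \<psi> x *\<^sub>R D x) \<bullet> b)"
    using integral_lebesgue_on_support[of U UNIV "\<lambda>x. (\<phi> x *\<^sub>R E x + \<psi> x *\<^sub>R D x) \<bullet> b"] U Ez K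
    by (force simp: lebesgue_on_UNIV_eq)
  also have "\<dots> = (LINT x|lebesgue_on U. \<phi> x * (E x \<bullet> b) + (D x \<bullet> b) * \<psi> x)"
    by (simp add: inner_add_left mult.commute)
  also have "\<dots> = (LINT x|lebesgue_on U. \<phi> x * (E x \<bullet> b)) + (LINT x|lebesgue_on U. (D x \<bullet> b) * \<psi> x)"
    using i1 i2 by simp
  finally show "(LINT x|lebesgue_on U. \<phi> x * (E x \<bullet> b)) = - (LINT x|lebesgue_on U. (D x \<bullet> b) * \<psi> x)"
    by simp
qed

lemma weak_deriv_test_integrable:
  fixes f :: "'a::euclidean_space \<Rightarrow> real"
  assumes "has_weak_deriv U b f f'" "open U" "C1_with_gradient \<phi> D" "compactly_supported_in U \<phi>"
  shows "integrable (lebesgue_on U) (\<lambda>x. f x * (D x \<bullet> b))"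
    and "integrable (lebesgue_on U) (\<lambda>x. f' x * \<phi> x)"
proof -
  obtain K where K: "compact K" "K \<subseteq> U" "\<And>x. x \<notin> K \<Longrightarrow> \<phi> x = 0"
    using assms(4) by (auto simp: compactly_supported_in_def)
  have Dz: "D x = 0" if "x \<notin> K" for x
    using C1_gradient_zero_off_compact[OF assms(3) K(1,3) that] .
  show "integrable (lebesgue_on U) (\<lambda>x. f x * (D x \<bullet> b))"
    by (rule L1_loc_mult_integrable[OF _ K(1,2) assms(2)])
      (use Dz C1_gradient_continuous[OF assms(3)] assms(1) in \<open>auto intro!: continuous_intros simp: has_weak_deriv_def\<close>)
  show "integrable (lebesgue_on U) (\<lambda>x. f' x * \<phi> x)"
    by (rule L1_loc_mult_integrable[OF _ K(1,2) assms(2)])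
      (use K(3) C1_continuous[OF assms(3)] assms(1) in \<open>auto simp: has_weak_deriv_def\<close>)
qed

lemma has_weak_deriv_unique:
  fixes f :: "'a::euclidean_space \<Rightarrow> real"
  assumes U: "open U" and f1: "has_weak_deriv U b f f1" and f2: "has_weak_deriv U b f f2"
  shows "AE x in lebesgue_on U. f1 x = f2 x"
proof -
  have "AE x in lebesgue_on U. f1 x - f2 x = 0"
  proof (rule AE_zero_if_tested_zero[OF U])
    show "L1_loc U (\<lambda>x. f1 x - f2 x)" using f1 f2 by (auto simp: has_weak_deriv_def intro: L1_loc_diff)
    fix \<phi> D assume t: "C1_with_gradient \<phi> D" "compactly_supported_in U \<phi>"
    have "(LINT x|lebesgue_on U. f x * (D x \<bullet> b)) = - (LINT x|lebesgue_on U. f1 x * \<phi> x)"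
      "(LINT x|lebesgue_on U. f x * (D x \<bullet> b)) = - (LINT x|lebesgue_on U. f2 x * \<phi> x)"
      using f1 f2 t unfolding has_weak_deriv_def by blast+
    then have "(LINT x|lebesgue_on U. f1 x * \<phi> x) = (LINT x|lebesgue_on U. f2 x * \<phi> x)" by simp
    then show "(LINT x|lebesgue_on U. (f1 x - f2 x) * \<phi> x) = 0"
      using weak_deriv_test_integrable(2)[OF f1 U t] weak_deriv_test_integrable(2)[OF f2 U t]
      by (simp add: left_diff_distrib)
  qed
  then show ?thesis by eventually_elim simp
qed

lemma has_weak_deriv_weak_deriv:
  assumes "\<exists>f'. has_weak_deriv U b f f'"
  shows "has_weak_deriv U b f (weak_deriv U b f)"
  unfolding weak_deriv_def using assms by (rule someI_ex)

lemma weak_deriv_AE_eq: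
  fixes f :: "'a::euclidean_space \<Rightarrow> real"
  assumes "open U" "has_weak_deriv U b f f'"
  shows "AE x in lebesgue_on U. weak_deriv U b f x = f' x"
  using has_weak_deriv_unique[OF assms(1) has_weak_deriv_weak_deriv assms(2)] assms(2) by blast

lemma has_weak_deriv_subset:
  fixes f :: "'a::euclidean_space \<Rightarrow> real"
  assumes f: "has_weak_deriv U b f f'" and V: "V \<subseteq> U" "open V" "open U"
  shows "has_weak_deriv V b f f'"
  unfolding has_weak_deriv_def
proof (intro conjI allI impI)
  show "L1_loc V f" "L1_loc V f'" using f V by (auto simp: has_weak_deriv_def intro: L1_loc_subset)
  fix \<phi> D assume t: "C1_with_gradient \<phi> D \<and> compactly_supported_in V \<phi>"
  then obtain K where K: "compact K" "K \<subseteq> V" "\<And>x. x \<notin> K \<Longrightarrow> \<phi> x = 0"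
    by (auto simp: compactly_supported_in_def)
  have Dz: "D x = 0" if "x \<notin> K" for x
    using C1_gradient_zero_off_compact[OF conjunct1[OF t] K(1,3) that] .
  have "(LINT x|lebesgue_on U. f x * (D x \<bullet> b)) = (LINT x|lebesgue_on V. f x * (D x \<bullet> b))"
  proof (rule integral_lebesgue_on_support)
    fix x assume "x \<in> U - V"
    then have "D x = 0" using Dz K(2) by blast
    then show "f x * (D x \<bullet> b) = 0" by simp
  qed (use V in auto)
  moreover have "(LINT x|lebesgue_on U. f' x * \<phi> x) = (LINT x|lebesgue_on V. f' x * \<phi> x)"
    by (rule integral_lebesgue_on_support) (use V K(2,3) in auto)
  moreover have "compactly_supported_in U \<phi>" using K V by (auto simp: compactly_supported_in_def)
  ultimately show "(LINT x|lebesgue_on V. f x * (D x \<bullet> b)) = - (LINT x|lebesgue_on V. f' x * \<phi> x)"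
    using f t unfolding has_weak_deriv_def by metis
qed

lemma has_weak_deriv_diff:
  fixes f g :: "'a::euclidean_space \<Rightarrow> real"
  assumes U: "open U" and f: "has_weak_deriv U b f f'" and g: "has_weak_deriv U b g g'"
  shows "has_weak_deriv U b (\<lambda>x. f x - g x) (\<lambda>x. f' x - g' x)"
  unfolding has_weak_deriv_def
proof (intro conjI allI impI)
  show "L1_loc U (\<lambda>x. f x - g x)" "L1_loc U (\<lambda>x. f' x - g' x)"
    using f g by (auto simp: has_weak_deriv_def intro: L1_loc_diff)
  fix \<phi> D assume t: "C1_with_gradient \<phi> D \<and> compactly_supported_in U \<phi>"
  have "(LINT x|lebesgue_on U. f x * (D x \<bullet> b)) = - (LINT x|lebesgue_on U. f' x * \<phi> x)"
    "(LINT x|lebesgue_on U. g x * (D x \<bullet> b)) = - (LINT x|lebesgue_on U. g' x * \<phi> x)"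
    using f g t unfolding has_weak_deriv_def by blast+
  then show "(LINT x|lebesgue_on U. (f x - g x) * (D x \<bullet> b)) = - (LINT x|lebesgue_on U. (f' x - g' x) * \<phi> x)"
    using weak_deriv_test_integrable[OF f U conjunct1[OF t] conjunct2[OF t]]
      weak_deriv_test_integrable[OF g U conjunct1[OF t] conjunct2[OF t]]
    by (simp add: left_diff_distrib)
qed

lemma has_weak_deriv_uminus:
  fixes f :: "'a::euclidean_space \<Rightarrow> real"
  assumes U: "open U" and f: "has_weak_deriv U b f f'"
  shows "has_weak_deriv U b (\<lambda>x. - f x) (\<lambda>x. - f' x)"
  using has_weak_deriv_diff[OF U has_weak_deriv_C1[OF C1_const[of 0] U] f] by simp

lemma has_weak_deriv_AE_zero:
  fixes f :: "'a::euclidean_space \<Rightarrow> real"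
  assumes U: "open U" and f: "L1_loc U f" "AE x in lebesgue_on U. f x = 0"
  shows "has_weak_deriv U b f (\<lambda>_. 0)"
  unfolding has_weak_deriv_def
proof (intro conjI allI impI)
  show "L1_loc U (\<lambda>_. 0::real)" by (rule L1_loc_const)
  fix \<phi> D
  have "(LINT x|lebesgue_on U. f x * (D x \<bullet> b)) = 0"
    by (rule integral_eq_zero_AE) (use f(2) in auto)
  then show "(LINT x|lebesgue_on U. f x * (D x \<bullet> b)) = - (LINT x|lebesgue_on U. 0 * \<phi> x)" by simp
qed (rule f)

lemma weak_gradient_inner_Basis:
  assumes "b \<in> Basis"
  shows "weak_gradient U f x \<bullet> b = weak_deriv U b f x"
  using assms by (simp add: weak_gradient_def)

lemma AE_Basis:
  fixes P :: "'a \<Rightarrow> 'b::euclidean_space \<Rightarrow> bool"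
  assumes "\<And>b. b \<in> Basis \<Longrightarrow> AE x in M. P x b"
  shows "AE x in M. \<forall>b\<in>Basis. P x b"
  by (intro AE_finite_allI[OF finite_Basis] assms)

lemma weak_gradient_AE_eq:
  fixes f :: "'a::euclidean_space \<Rightarrow> real"
  assumes "open U" "\<And>b. b \<in> Basis \<Longrightarrow> has_weak_deriv U b f (\<lambda>x. D x \<bullet> b)"
  shows "AE x in lebesgue_on U. weak_gradient U f x = D x"
proof -
  have "AE x in lebesgue_on U. \<forall>b\<in>Basis. weak_deriv U b f x = D x \<bullet> b"
  proof (rule AE_Basis)
    fix b :: 'a assume "b \<in> Basis"
    then show "AE x in lebesgue_on U. weak_deriv U b f x = D x \<bullet> b"
      by (intro weak_deriv_AE_eq assms)
  qed
  then show ?thesis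
  proof eventually_elim
    case (elim x)
    show ?case
    proof (rule euclidean_eqI)
      fix b :: 'a assume "b \<in> Basis"
      then show "weak_gradient U f x \<bullet> b = D x \<bullet> b"
        using elim by (simp add: weak_gradient_inner_Basis)
    qed
  qed
qed

lemma weak_gradient_C1:
  fixes \<phi> :: "'a::euclidean_space \<Rightarrow> real"
  assumes "open U" "C1_with_gradient \<phi> D"
  shows "AE x in lebesgue_on U. weak_gradient U \<phi> x = D x"
  using weak_gradient_AE_eq[OF assms(1) has_weak_deriv_C1[OF assms(2,1)]] .

lemma weakly_differentiable_weak_deriv:
  assumes "weakly_differentiable U f" "b \<in> Basis"
  shows "has_weak_deriv U b f (weak_deriv U b f)"
  using assms by (intro has_weak_deriv_weak_deriv) (auto simp: weakly_differentiable_def)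

lemma weak_gradient_diff:
  fixes f g :: "'a::euclidean_space \<Rightarrow> real"
  assumes U: "open U" and fg: "weakly_differentiable U f" "weakly_differentiable U g"
  shows "AE x in lebesgue_on U. weak_gradient U (\<lambda>x. f x - g x) x = weak_gradient U f x - weak_gradient U g x"
proof (rule weak_gradient_AE_eq[OF U])
  fix b :: 'a assume "b \<in> Basis"
  then show "has_weak_deriv U b (\<lambda>x. f x - g x) (\<lambda>x. (weak_gradient U f x - weak_gradient U g x) \<bullet> b)"
    using has_weak_deriv_diff[OF U] weakly_differentiable_weak_deriv[OF fg(1)] weakly_differentiable_weak_deriv[OF fg(2)]
    by (simp add: inner_diff_left weak_gradient_inner_Basis)
qed

lemma weak_gradient_measurable:
  fixes f :: "'a::euclidean_space \<Rightarrow> real"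
  assumes "open U" "weakly_differentiable U f"
  shows "weak_gradient U f \<in> borel_measurable (lebesgue_on U)"
  unfolding weak_gradient_def
proof (intro borel_measurable_sum borel_measurable_scaleR borel_measurable_const)
  fix b :: 'a assume "b \<in> Basis"
  then show "weak_deriv U b f \<in> borel_measurable (lebesgue_on U)"
    using weakly_differentiable_weak_deriv[OF assms(2)] L1_loc_measurable[OF _ assms(1)]
    by (auto simp: has_weak_deriv_def)
qed

lemma L2_on_cong_AE:
  fixes f g :: "'a::euclidean_space \<Rightarrow> 'b::euclidean_space"
  assumes "L2_on U f" "AE x in lebesgue_on U. g x = f x" "g \<in> borel_measurable (lebesgue_on U)"
  shows "L2_on U g"
proof -
  have "integrable (lebesgue_on U) (\<lambda>x. (norm (g x))\<^sup>2) \<longleftrightarrow> integrable (lebesgue_on U) (\<lambda>x. (norm (f x))\<^sup>2)"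
    by (rule integrable_cong_AE)
      (use assms in \<open>auto simp: L2_on_def elim!: eventually_mono\<close>)
  then show ?thesis using assms by (auto simp: L2_on_def)
qed

lemma L2_on_continuous_bounded_set:
  fixes f :: "'a::euclidean_space \<Rightarrow> 'b::euclidean_space"
  assumes "continuous_on UNIV f" "bounded B" "B \<in> sets lebesgue"
  shows "L2_on B f"
proof -
  obtain C where "\<And>x. x \<in> closure B \<Longrightarrow> norm (f x) \<le> C"
    using compact_imp_bounded[OF compact_continuous_image[of "closure B" f]] assms
    by (auto simp: bounded_iff compact_closure intro: continuous_on_subset)
  then show ?thesis
    using assms closure_subset[of B]
    by (intro L2_on_bounded[where C = C])
      (auto intro!: continuous_imp_measurable_on_sets_lebesgue AE_I2 bounded_set_imp_lmeasurable intro: continuous_on_subset)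
qed

lemma L2_on_support:
  fixes f :: "'a::euclidean_space \<Rightarrow> 'b::euclidean_space"
  assumes "L2_on B f" "B \<subseteq> U" "B \<in> sets lebesgue" "U \<in> sets lebesgue" "\<And>x. x \<in> U - B \<Longrightarrow> f x = 0"
  shows "L2_on U f"
proof -
  have i: "integrable (lebesgue_on U) (\<lambda>x. (norm (f x))\<^sup>2)"
    using integrable_lebesgue_on_support[of B U "\<lambda>x. (norm (f x))\<^sup>2"] assms by (auto simp: L2_on_def)
  have "(\<lambda>x. if x \<in> B then f x else 0) \<in> borel_measurable lebesgue"
    using assms(1,3) by (simp add: L2_on_def borel_measurable_if)
  then have "(\<lambda>x. if x \<in> B then f x else 0) \<in> borel_measurable (lebesgue_on U)"
    using assms(4) by (simp add: measurable_restrict_space1)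
  also have "?this \<longleftrightarrow> f \<in> borel_measurable (lebesgue_on U)"
    using assms(5) by (intro measurable_lebesgue_cong) auto
  finally show ?thesis using i by (simp add: L2_on_def)
qed

lemma in_H1_C1:
  fixes \<phi> :: "'a::euclidean_space \<Rightarrow> real"
  assumes U: "open U" and \<phi>: "C1_with_gradient \<phi> D"
    and B: "bounded B" "B \<subseteq> U" "B \<in> sets lebesgue" "\<And>x. x \<in> U - B \<Longrightarrow> \<phi> x = 0" "\<And>x. x \<in> U - B \<Longrightarrow> D x = 0"
  shows "in_H1 U \<phi>"
  unfolding in_H1_def
proof (intro conjI)
  show wd: "weakly_differentiable U \<phi>"
    using has_weak_deriv_C1[OF \<phi> U] by (auto simp: weakly_differentiable_def)
  have "L2_on B \<phi>" "L2_on B D"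
    using \<phi> B by (auto intro!: L2_on_continuous_bounded_set C1_continuous C1_gradient_continuous)
  then have "L2_on U \<phi>" "L2_on U D"
    using B U by (auto intro: L2_on_support)
  then show "L2_on U \<phi>" "L2_on U (weak_gradient U \<phi>)"
    using L2_on_cong_AE[OF _ weak_gradient_C1[OF U \<phi>] weak_gradient_measurable[OF U wd]] by auto
qed

lemma in_H1_diff:
  fixes f g :: "'a::euclidean_space \<Rightarrow> real"
  assumes U: "open U" and fg: "in_H1 U f" "in_H1 U g"
  shows "in_H1 U (\<lambda>x. f x - g x)"
proof -
  have wd: "weakly_differentiable U f" "weakly_differentiable U g" using fg by (auto simp: in_H1_def)
  have wd': "weakly_differentiable U (\<lambda>x. f x - g x)"
    using has_weak_deriv_diff[OF U] wd unfolding weakly_differentiable_def by blast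
  have "L2_on U (\<lambda>x. weak_gradient U f x - weak_gradient U g x)"
    using fg by (auto simp: in_H1_def intro: L2_on_diff)
  then have "L2_on U (weak_gradient U (\<lambda>x. f x - g x))"
    using weak_gradient_diff[OF U wd] weak_gradient_measurable[OF U wd'] by (rule L2_on_cong_AE)
  then show ?thesis using fg wd' by (auto simp: in_H1_def intro: L2_on_diff)
qed

section \<open>Traces and the Gauss formula on rectangles\<close>

lemma lebesgue_on_interior_cbox:
  fixes f :: "'a::euclidean_space \<Rightarrow> real"
  assumes "continuous_on (cbox a b) f"
  shows "(LINT x|lebesgue_on (box a b). f x) = integral (cbox a b) f"
proof -
  have "integrable (lebesgue_on (cbox a b)) f"
  proof -
    obtain C where "\<And>x. x \<in> cbox a b \<Longrightarrow> norm (f x) \<le> C"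
      using compact_imp_bounded[OF compact_continuous_image[OF assms compact_cbox]] by (auto simp: bounded_iff)
    then show ?thesis
      by (intro integrable_lebesgue_on_bounded[where C = C] continuous_imp_measurable_on_sets_lebesgue assms) (auto intro: AE_I2)
  qed
  then have "integrable (lebesgue_on (box a b)) f"
    by (rule integrable_lebesgue_on_subset[OF _ box_subset_cbox]) auto
  then have "(LINT x|lebesgue_on (box a b). f x) = integral (box a b) f"
    by (intro lebesgue_integral_eq_integral) auto
  then show ?thesis by (simp add: integral_open_interval)
qed

lemma rectangle_eq_box: "{a<..<b::real} \<times> {c<..<d::real} = box (a, c) (b, d)"
  by (auto simp: box_def Basis_prod_def)

lemma box_real_interval: "box a b = {a<..<b::real}"
  by (auto simp: box_def)

text \<open>Fubini's theorem and the fundamental theorem of calculus on vertical lines.\<close>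

lemma integral_vertical_derivative_rectangle:
  fixes F G :: "real \<times> real \<Rightarrow> real"
  assumes cd: "c \<le> d"
    and F: "continuous_on (cbox (a, c) (b, d)) F" and G: "continuous_on (cbox (a, c) (b, d)) G"
    and deriv: "\<And>y z. y \<in> {a..b} \<Longrightarrow> z \<in> {c..d} \<Longrightarrow> ((\<lambda>z. F (y, z)) has_real_derivative G (y, z)) (at z)"
  shows "(LINT x|lebesgue_on ({a<..<b} \<times> {c<..<d}). G x) = (LINT y|lebesgue_on {a<..<b}. F (y, d) - F (y, c))"
proof -
  have "integral (cbox (a, c) (b, d)) G = integral (cbox a b) (\<lambda>y. integral (cbox c d) (\<lambda>z. G (y, z)))"
    by (rule integral_prod_continuous[OF G])
  also have "\<dots> = integral (cbox a b) (\<lambda>y. F (y, d) - F (y, c))"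
  proof (rule Henstock_Kurzweil_Integration.integral_cong)
    fix y assume "y \<in> cbox a b"
    then have "((\<lambda>z. G (y, z)) has_integral (F (y, d) - F (y, c))) {c..d}"
      using deriv cd by (intro fundamental_theorem_of_calculus)
        (auto simp: has_real_derivative_iff_has_vector_derivative[symmetric] intro: DERIV_subset)
    then show "integral (cbox c d) (\<lambda>z. G (y, z)) = F (y, d) - F (y, c)"
      by (simp add: integral_unique)
  qed
  also have "\<dots> = (LINT y|lebesgue_on {a<..<b}. F (y, d) - F (y, c))"
  proof -
    have "continuous_on (cbox a b) (\<lambda>y. F (y, d) - F (y, c))"
      by (intro continuous_intros continuous_on_compose2[OF F]) (use cd in \<open>auto simp: cbox_Pair_eq\<close>)
    from lebesgue_on_interior_cbox[OF this] show ?thesis by (simp add: box_real_interval)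
  qed
  finally show ?thesis
    using lebesgue_on_interior_cbox[OF G] by (simp add: rectangle_eq_box)
qed

lemma C1_vertical_derivative:
  fixes \<phi> :: "real \<times> real \<Rightarrow> real"
  assumes "C1_with_gradient \<phi> D"
  shows "((\<lambda>z. \<phi> (y, z)) has_real_derivative D (y, z) \<bullet> e_z) (at z)"
proof -
  have "((\<lambda>z. (y, z)) has_derivative (\<lambda>h. h *\<^sub>R e_z)) (at z)"
    by (auto intro!: derivative_eq_intros)
  moreover have "(\<phi> has_derivative (\<lambda>h. h \<bullet> D (y, z))) (at (y, z))"
    using assms by (simp add: C1_with_gradient_def gderiv_def)
  ultimately have "((\<lambda>z. \<phi> (y, z)) has_derivative (\<lambda>h. (h *\<^sub>R e_z) \<bullet> D (y, z))) (at z)"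
    by (rule has_derivative_compose)
  then show ?thesis
    by (rule has_derivative_imp_has_field_derivative) (simp add: inner_prod_def)
qed

lemma C1_fst:
  assumes "\<And>t. (u has_real_derivative u' t) (at t)" "continuous_on UNIV u'"
  shows "C1_with_gradient (\<lambda>x::real \<times> real. u (fst x)) (\<lambda>x. (u' (fst x), 0))"
proof -
  have "C1_with_gradient fst (\<lambda>x::real \<times> real. (1, 0))"
    unfolding C1_with_gradient_def gderiv_def
    by (auto intro!: derivative_eq_intros continuous_intros simp: inner_Pair_0)
  from C1_compose[OF this assms] show ?thesis by simp
qed

lemma C1_snd:
  assumes "\<And>t. (u has_real_derivative u' t) (at t)" "continuous_on UNIV u'"
  shows "C1_with_gradient (\<lambda>x::real \<times> real. u (snd x)) (\<lambda>x. (0, u' (snd x)))"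
proof -
  have "C1_with_gradient snd (\<lambda>x::real \<times> real. (0, 1))"
    unfolding C1_with_gradient_def gderiv_def
    by (auto intro!: derivative_eq_intros continuous_intros simp: inner_Pair_0)
  from C1_compose[OF this assms] show ?thesis by simp
qed

lemma rectangle_measurable: "({a<..<b} \<times> {c<..<d} :: (real \<times> real) set) \<in> lmeasurable"
  unfolding rectangle_eq_box by (rule lmeasurable_box)

lemma open_rectangle: "open ({a<..<b} \<times> {c<..<d} :: (real \<times> real) set)"
  by (intro open_Times) auto

lemma integrable_continuous_rectangle:
  fixes f :: "real \<times> real \<Rightarrow> real"
  assumes "continuous_on UNIV f"
  shows "L2_on ({a<..<b} \<times> {c<..<d}) f" "integrable (lebesgue_on ({a<..<b} \<times> {c<..<d})) f"
proof -
  show L2: "L2_on ({a<..<b} \<times> {c<..<d}) f"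
    by (rule L2_on_continuous_bounded_set) (use assms rectangle_measurable in \<open>auto intro: bounded_Times\<close>)
  show "integrable (lebesgue_on ({a<..<b} \<times> {c<..<d})) f"
    by (rule L2_on_integrable[OF L2 rectangle_measurable])
qed

lemma Gauss_rectangle_C1:
  fixes \<phi> :: "real \<times> real \<Rightarrow> real" and a b R :: real
  assumes \<phi>: "C1_with_gradient \<phi> D" and w: "continuous_on UNIV w"
    and \<eta>: "\<And>t. (\<eta> has_real_derivative \<eta>' t) (at t)" "continuous_on UNIV \<eta>'" and R: "0 \<le> R"
  defines "V \<equiv> {a<..<b} \<times> {0<..<R}"
  shows "(LINT x|lebesgue_on V. (D x \<bullet> e_z) * (w (fst x) * \<eta> (snd x)))
      + (LINT x|lebesgue_on V. \<phi> x * (w (fst x) * \<eta>' (snd x)))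
    = (LINT y|lebesgue_on {a<..<b}. w y * (\<phi> (y, R) * \<eta> R - \<phi> (y, 0) * \<eta> 0))"
proof -
  have c\<eta>: "continuous_on UNIV \<eta>" using \<eta>(1) by (meson DERIV_continuous continuous_at_imp_continuous_on)
  have c: "continuous_on UNIV (\<lambda>x::real \<times> real. w (fst x))" "continuous_on UNIV (\<lambda>x::real \<times> real. \<eta> (snd x))"
    "continuous_on UNIV (\<lambda>x::real \<times> real. \<eta>' (snd x))" "continuous_on UNIV \<phi>" "continuous_on UNIV D"
    by (rule C1_continuous[OF \<phi>] C1_gradient_continuous[OF \<phi>]
      | rule continuous_on_compose2[OF w] continuous_on_compose2[OF c\<eta>] continuous_on_compose2[OF \<eta>(2)],
        auto intro!: continuous_intros)+
  let ?G1 = "\<lambda>x. (D x \<bullet> e_z) * (w (fst x) * \<eta> (snd x))" and ?G2 = "\<lambda>x. \<phi> x * (w (fst x) * \<eta>' (snd x))"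
  let ?F = "\<lambda>x. \<phi> x * (w (fst x) * \<eta> (snd x))"
  have c1: "continuous_on UNIV ?G1" and c2: "continuous_on UNIV ?G2" and cF: "continuous_on UNIV ?F"
    by (intro continuous_intros c)+
  have "(LINT x|lebesgue_on V. ?G1 x) + (LINT x|lebesgue_on V. ?G2 x) = (LINT x|lebesgue_on V. ?G1 x + ?G2 x)"
    using integrable_continuous_rectangle(2)[OF c1] integrable_continuous_rectangle(2)[OF c2] by (simp add: V_def)
  also have "\<dots> = (LINT y|lebesgue_on {a<..<b}. ?F (y, R) - ?F (y, 0))"
    unfolding V_def
  proof (rule integral_vertical_derivative_rectangle[OF R])
    show "continuous_on (cbox (a, 0) (b, R)) ?F" using cF continuous_on_subset by blast
    show "continuous_on (cbox (a, 0) (b, R)) (\<lambda>x. ?G1 x + ?G2 x)"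
      using continuous_on_add[OF c1 c2] continuous_on_subset by blast
    fix y z
    show "((\<lambda>z. ?F (y, z)) has_real_derivative ?G1 (y, z) + ?G2 (y, z)) (at z)"
      by (auto intro!: derivative_eq_intros C1_vertical_derivative[OF \<phi>] \<eta>(1))
  qed
  finally show ?thesis by (simp add: algebra_simps)
qed

text \<open>The Gauss formula for functions with a trace, obtained from the approximating \<open>C\<^sup>1\<close> functions.\<close>

lemma
  fixes f :: "real \<times> real \<Rightarrow> real" and a b R :: real
  assumes tr: "has_trace {a<..<b} {0<..<R} h f \<psi>" and f': "has_weak_deriv ({a<..<b} \<times> {0<..<R}) e_z f f'"
    and w: "continuous_on UNIV w"
    and \<eta>: "\<And>t. (\<eta> has_real_derivative \<eta>' t) (at t)" "continuous_on UNIV \<eta>'" "\<eta> R = 0" and R: "0 \<le> R"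
  defines "V \<equiv> {a<..<b} \<times> {0<..<R}"
  shows Gauss_rectangle_trace: "h = 0 \<Longrightarrow> (LINT x|lebesgue_on V. f' x * (w (fst x) * \<eta> (snd x)))
      + (LINT x|lebesgue_on V. f x * (w (fst x) * \<eta>' (snd x)))
      = - \<eta> 0 * (LINT y|lebesgue_on {a<..<b}. \<psi> y * w y)"
    and Gauss_rectangle_no_trace: "\<eta> 0 = 0 \<Longrightarrow> (LINT x|lebesgue_on V. f' x * (w (fst x) * \<eta> (snd x)))
      + (LINT x|lebesgue_on V. f x * (w (fst x) * \<eta>' (snd x))) = 0"
proof -
  obtain f1 \<phi> D where f1: "has_weak_deriv V e_z f f1" and \<phi>: "\<And>n. C1_with_gradient (\<phi> n) (D n)"
    and l1: "L2_converges V \<phi> f" and l2: "L2_converges V (\<lambda>n x. D n x \<bullet> e_z) f1"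
    and l3: "L2_converges {a<..<b} (\<lambda>n y. \<phi> n (y, h)) \<psi>"
    using tr unfolding has_trace_def V_def by auto
  have c\<eta>: "continuous_on UNIV \<eta>" using \<eta>(1) by (meson DERIV_continuous continuous_at_imp_continuous_on)
  have c: "continuous_on UNIV (\<lambda>x::real \<times> real. w (fst x) * \<eta> (snd x))"
    "continuous_on UNIV (\<lambda>x::real \<times> real. w (fst x) * \<eta>' (snd x))"
    by (intro continuous_intros continuous_on_compose2[OF w] continuous_on_compose2[OF c\<eta>]
        continuous_on_compose2[OF \<eta>(2)]; simp)+
  have lim: "(\<lambda>n. (LINT x|lebesgue_on V. (D n x \<bullet> e_z) * (w (fst x) * \<eta> (snd x)))
      + (LINT x|lebesgue_on V. \<phi> n x * (w (fst x) * \<eta>' (snd x)))) \<longlonglongrightarrow>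
    (LINT x|lebesgue_on V. f1 x * (w (fst x) * \<eta> (snd x))) + (LINT x|lebesgue_on V. f x * (w (fst x) * \<eta>' (snd x)))"
    unfolding V_def
    by (intro tendsto_add L2_converges_imp_weak[OF l2[unfolded V_def]] L2_converges_imp_weak[OF l1[unfolded V_def]]
        integrable_continuous_rectangle(1) c)
  have eqn: "(LINT x|lebesgue_on V. (D n x \<bullet> e_z) * (w (fst x) * \<eta> (snd x)))
      + (LINT x|lebesgue_on V. \<phi> n x * (w (fst x) * \<eta>' (snd x)))
      = - \<eta> 0 * (LINT y|lebesgue_on {a<..<b}. \<phi> n (y, 0) * w y)" for n
  proof -
    have "(LINT y|lebesgue_on {a<..<b}. w y * (\<phi> n (y, R) * \<eta> R - \<phi> n (y, 0) * \<eta> 0))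
      = (LINT y|lebesgue_on {a<..<b}. - \<eta> 0 * (\<phi> n (y, 0) * w y))"
      using \<eta>(3) by (intro Bochner_Integration.integral_cong) auto
    then show ?thesis
      using Gauss_rectangle_C1[OF \<phi>[of n] w \<eta>(1,2) R, of a b] by (simp add: V_def)
  qed
  have f1f': "(LINT x|lebesgue_on V. f1 x * (w (fst x) * \<eta> (snd x))) = (LINT x|lebesgue_on V. f' x * (w (fst x) * \<eta> (snd x)))"
  proof (rule integral_cong_AE)
    have V: "open V" unfolding V_def by (rule open_rectangle)
    have m: "(\<lambda>x. w (fst x) * \<eta> (snd x)) \<in> borel_measurable (lebesgue_on V)"
      using c(1) V by (intro continuous_imp_measurable_on_sets_lebesgue) (auto intro: continuous_on_subset)
    show "(\<lambda>x. f1 x * (w (fst x) * \<eta> (snd x))) \<in> borel_measurable (lebesgue_on V)"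
      using f1 L1_loc_measurable[OF _ V] m by (auto simp: has_weak_deriv_def intro!: borel_measurable_times)
    show "(\<lambda>x. f' x * (w (fst x) * \<eta> (snd x))) \<in> borel_measurable (lebesgue_on V)"
      using f' L1_loc_measurable[OF _ V] m by (auto simp: has_weak_deriv_def V_def intro!: borel_measurable_times)
    have "AE x in lebesgue_on V. f1 x = f' x"
      using has_weak_deriv_unique[OF V f1] f' by (simp add: V_def)
    then show "AE x in lebesgue_on V. f1 x * (w (fst x) * \<eta> (snd x)) = f' x * (w (fst x) * \<eta> (snd x))"
      by eventually_elim simp
  qed
  show "(LINT x|lebesgue_on V. f' x * (w (fst x) * \<eta> (snd x)))
      + (LINT x|lebesgue_on V. f x * (w (fst x) * \<eta>' (snd x)))
      = - \<eta> 0 * (LINT y|lebesgue_on {a<..<b}. \<psi> y * w y)" if h: "h = 0"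
  proof -
    have "L2_on {a<..<b} w" by (rule L2_on_continuous_bounded_set[OF w]) auto
    then have "(\<lambda>n. - \<eta> 0 * (LINT y|lebesgue_on {a<..<b}. \<phi> n (y, 0) * w y))
        \<longlonglongrightarrow> - \<eta> 0 * (LINT y|lebesgue_on {a<..<b}. \<psi> y * w y)"
      using l3 h by (intro tendsto_mult_left L2_converges_imp_weak) auto
    then show ?thesis using LIMSEQ_unique lim[unfolded eqn f1f'] by blast
  qed
  show "(LINT x|lebesgue_on V. f' x * (w (fst x) * \<eta> (snd x)))
      + (LINT x|lebesgue_on V. f x * (w (fst x) * \<eta>' (snd x))) = 0" if "\<eta> 0 = 0"
  proof -
    have "(\<lambda>n. 0) \<longlonglongrightarrow> (LINT x|lebesgue_on V. f' x * (w (fst x) * \<eta> (snd x)))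
      + (LINT x|lebesgue_on V. f x * (w (fst x) * \<eta>' (snd x)))"
      using lim[unfolded eqn f1f'] that by simp
    then show ?thesis by (simp add: tendsto_const_iff)
  qed
qed

lemma has_trace_C1:
  fixes \<phi> :: "real \<times> real \<Rightarrow> real"
  assumes "C1_with_gradient \<phi> D"
  shows "has_trace {a<..<b} {c<..<d} h \<phi> (\<lambda>y. \<phi> (y, h))"
  unfolding has_trace_def
proof (intro exI conjI allI)
  show "has_weak_deriv ({a<..<b} \<times> {c<..<d}) e_z \<phi> (\<lambda>x. D x \<bullet> e_z)"
    by (rule has_weak_deriv_C1[OF assms open_rectangle])
  show "C1_with_gradient \<phi> D" by fact
  show "L2_converges ({a<..<b} \<times> {c<..<d}) (\<lambda>n. \<phi>) \<phi>"
    "L2_converges ({a<..<b} \<times> {c<..<d}) (\<lambda>n x. D x \<bullet> e_z) (\<lambda>x. D x \<bullet> e_z)"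
    using C1_continuous[OF assms] C1_gradient_continuous[OF assms]
    by (auto intro!: L2_converges_const integrable_continuous_rectangle(1) continuous_intros)
  show "L2_converges {a<..<b} (\<lambda>n y. \<phi> (y, h)) (\<lambda>y. \<phi> (y, h))"
    by (auto intro!: L2_converges_const L2_on_continuous_bounded_set continuous_intros
        continuous_on_compose2[OF C1_continuous[OF assms, of UNIV]])
qed

lemma has_trace_diff:
  fixes f g :: "real \<times> real \<Rightarrow> real"
  assumes "has_trace {a<..<b} {c<..<d} h f \<psi>" "has_trace {a<..<b} {c<..<d} h g \<omega>"
  shows "has_trace {a<..<b} {c<..<d} h (\<lambda>x. f x - g x) (\<lambda>y. \<psi> y - \<omega> y)"
proof -
  let ?V = "{a<..<b} \<times> {c<..<d}"
  obtain f' \<phi> D where f: "has_weak_deriv ?V e_z f f'" "\<And>n. C1_with_gradient (\<phi> n) (D n)"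
    "L2_converges ?V \<phi> f" "L2_converges ?V (\<lambda>n x. D n x \<bullet> e_z) f'"
    "L2_converges {a<..<b} (\<lambda>n y. \<phi> n (y, h)) \<psi>"
    using assms(1) unfolding has_trace_def by auto
  obtain g' \<phi>2 D2 where g: "has_weak_deriv ?V e_z g g'" "\<And>n. C1_with_gradient (\<phi>2 n) (D2 n)"
    "L2_converges ?V \<phi>2 g" "L2_converges ?V (\<lambda>n x. D2 n x \<bullet> e_z) g'"
    "L2_converges {a<..<b} (\<lambda>n y. \<phi>2 n (y, h)) \<omega>"
    using assms(2) unfolding has_trace_def by auto
  have "L2_converges ?V (\<lambda>n x. (D n x - D2 n x) \<bullet> e_z) (\<lambda>x. f' x - g' x)"
    using L2_converges_diff[OF f(4) g(4)] unfolding inner_diff_left .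
  then show ?thesis
    unfolding has_trace_def
    using has_weak_deriv_diff[OF open_rectangle f(1) g(1)] L2_converges_diff[OF f(3) g(3)]
      L2_converges_diff[OF f(5) g(5)]
    by (intro exI[of _ "\<lambda>x. f' x - g' x"] exI[of _ "\<lambda>n x. \<phi> n x - \<phi>2 n x"]
        exI[of _ "\<lambda>n x. D n x - D2 n x"] conjI allI C1_diff f(2) g(2))
qed

lemma has_trace_uminus:
  fixes f :: "real \<times> real \<Rightarrow> real"
  assumes "has_trace {a<..<b} {c<..<d} h f \<psi>"
  shows "has_trace {a<..<b} {c<..<d} h (\<lambda>x. - f x) (\<lambda>y. - \<psi> y)"
  using has_trace_diff[OF has_trace_C1[OF C1_const[of 0]] assms] by simp

section \<open>Ramps and plateau weights\<close>

text \<open>A \<open>C\<^sup>1\<close> step from \<open>0\<close> on \<open>(-\<infinity>, 0]\<close> to \<open>1\<close> on \<open>[1, \<infinity>)\<close>. As a quadratic spline it is a combination of squares of positive parts, which makes its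
  smoothness immediate and its derivative and its antiderivative explicit.\<close>

definition ramp :: "real \<Rightarrow> real" where
  "ramp t = 2 * (max 0 t)\<^sup>2 - 4 * (max 0 (t - 1/2))\<^sup>2 + 2 * (max 0 (t - 1))\<^sup>2"

definition ramp_deriv :: "real \<Rightarrow> real" where
  "ramp_deriv t = 4 * max 0 t - 8 * max 0 (t - 1/2) + 4 * max 0 (t - 1)"

definition ramp_integral :: "real \<Rightarrow> real" where
  "ramp_integral t = 2/3 * (max 0 t) ^ 3 - 4/3 * (max 0 (t - 1/2)) ^ 3 + 2/3 * (max 0 (t - 1)) ^ 3"

lemma pos_part_cube_derivative:
  "((\<lambda>t. (max 0 t) ^ 3) has_real_derivative 3 * (max 0 t)\<^sup>2) (at (t::real))"
proof -
  have "((\<lambda>t. t * (max 0 t)\<^sup>2) has_real_derivative 3 * (max 0 t)\<^sup>2) (at t)"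
  proof -
    have "((\<lambda>t. t * (max 0 t)\<^sup>2) has_real_derivative 1 * (max 0 t)\<^sup>2 + 2 * max 0 t * t) (at t)"
      by (rule DERIV_mult[OF DERIV_ident pos_part_square_derivative])
    also have "1 * (max 0 t)\<^sup>2 + 2 * max 0 t * t = 3 * (max 0 t)\<^sup>2"
      by (auto simp: max_def power2_eq_square)
    finally show ?thesis .
  qed
  moreover have "(\<lambda>t::real. t * (max 0 t)\<^sup>2) = (\<lambda>t. (max 0 t) ^ 3)"
    by (auto simp: max_def power2_eq_square power3_eq_cube)
  ultimately show ?thesis by simp
qed

lemma DERIV_shift_arg:
  assumes "\<And>t. (f has_real_derivative f' t) (at t)"
  shows "((\<lambda>t. f (t - a)) has_real_derivative f' (t - a)) (at (t::real))"
proof -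
  have "((\<lambda>t. t - a) has_real_derivative 1) (at t)" by (auto intro!: derivative_eq_intros)
  from DERIV_chain2[OF assms this] show ?thesis by simp
qed

lemma ramp_has_derivative: "(ramp has_real_derivative ramp_deriv t) (at t)"
proof -
  have "(ramp has_real_derivative 2 * (2 * max 0 t) - 4 * (2 * max 0 (t - 1/2)) + 2 * (2 * max 0 (t - 1))) (at t)"
    unfolding ramp_def[abs_def]
    by (intro DERIV_add DERIV_diff DERIV_cmult DERIV_shift_arg[OF pos_part_square_derivative] pos_part_square_derivative)
  then show ?thesis by (simp add: ramp_deriv_def)
qed

lemma ramp_integral_has_derivative: "(ramp_integral has_real_derivative ramp t) (at t)"
proof -
  have "(ramp_integral has_real_derivative 2/3 * (3 * (max 0 t)\<^sup>2) - 4/3 * (3 * (max 0 (t - 1/2))\<^sup>2)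
      + 2/3 * (3 * (max 0 (t - 1))\<^sup>2)) (at t)"
    unfolding ramp_integral_def[abs_def]
    by (intro DERIV_add DERIV_diff DERIV_cmult DERIV_shift_arg[OF pos_part_cube_derivative] pos_part_cube_derivative)
  then show ?thesis by (simp add: ramp_def)
qed

lemma continuous_on_ramp_deriv: "continuous_on UNIV ramp_deriv"
  unfolding ramp_deriv_def[abs_def] by (intro continuous_intros)

lemma continuous_on_ramp: "continuous_on UNIV ramp"
  unfolding ramp_def[abs_def] by (intro continuous_intros)

lemma ramp_deriv_bounds: "0 \<le> ramp_deriv t" "ramp_deriv t \<le> 2"
  by (auto simp: ramp_deriv_def max_def)

lemma ramp_deriv_pos: "0 < t \<Longrightarrow> t < 1 \<Longrightarrow> 0 < ramp_deriv t"
  by (auto simp: ramp_deriv_def max_def)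

lemma ramp_deriv_zero: "t \<le> 0 \<or> 1 \<le> t \<Longrightarrow> ramp_deriv t = 0"
  by (auto simp: ramp_deriv_def max_def)

lemma ramp_zero: "t \<le> 0 \<Longrightarrow> ramp t = 0"
  by (auto simp: ramp_def max_def)

lemma ramp_one: "1 \<le> t \<Longrightarrow> ramp t = 1"
  by (auto simp: ramp_def max_def power2_eq_square algebra_simps)

lemma ramp_mono: "s \<le> t \<Longrightarrow> ramp s \<le> ramp t"
  using DERIV_nonneg_imp_nondecreasing[of s t ramp] ramp_has_derivative ramp_deriv_bounds(1) by blast

lemma ramp_bounds: "0 \<le> ramp t" "ramp t \<le> 1"
  using ramp_mono[of "min t 0" t] ramp_zero[of "min t 0"] ramp_mono[of t "max t 1"] ramp_one[of "max t 1"] by auto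

lemma ramp_integral_zero: "t \<le> 0 \<Longrightarrow> ramp_integral t = 0"
  by (auto simp: ramp_integral_def max_def)

lemma ramp_integral_linear: "1 \<le> t \<Longrightarrow> ramp_integral t = t - 1/2"
  by (auto simp: ramp_integral_def max_def power3_eq_cube field_simps)

text \<open>For large \<open>R\<close>, the weight \<open>plateau Z R\<close> is equal to \<open>1\<close> between two layers of unit height, in which it rises and falls; its total mass is \<open>R\<close>.
  Its derivative lives in these layers only and is bounded there independently of \<open>R\<close>.\<close>

definition plateau :: "real \<Rightarrow> real \<Rightarrow> real \<Rightarrow> real" where
  "plateau Z R z = ramp (z - Z) - ramp (z - (Z + R))"

definition plateau_deriv :: "real \<Rightarrow> real \<Rightarrow> real \<Rightarrow> real" where
  "plateau_deriv Z R z = ramp_deriv (z - Z) - ramp_deriv (z - (Z + R))"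

definition plateau_integral :: "real \<Rightarrow> real \<Rightarrow> real \<Rightarrow> real" where
  "plateau_integral Z R z = ramp_integral (z - Z) - ramp_integral (z - (Z + R))"

lemma plateau_has_derivative: "(plateau Z R has_real_derivative plateau_deriv Z R z) (at z)"
  unfolding plateau_def[abs_def] plateau_deriv_def
  by (intro DERIV_diff DERIV_shift_arg[OF ramp_has_derivative])

lemma plateau_integral_has_derivative: "(plateau_integral Z R has_real_derivative plateau Z R z) (at z)"
  unfolding plateau_integral_def[abs_def] plateau_def
  by (intro DERIV_diff DERIV_shift_arg[OF ramp_integral_has_derivative])

lemma continuous_on_plateau: "continuous_on UNIV (plateau Z R)"
  unfolding plateau_def[abs_def] by (intro continuous_intros continuous_on_compose2[OF continuous_on_ramp]) auto

lemma continuous_on_plateau_deriv: "continuous_on UNIV (plateau_deriv Z R)"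
  unfolding plateau_deriv_def[abs_def] by (intro continuous_intros continuous_on_compose2[OF continuous_on_ramp_deriv]) auto

context
  fixes Z R :: real
  assumes R: "0 \<le> R"
begin

lemma plateau_bounds: "0 \<le> plateau Z R z" "plateau Z R z \<le> 1"
  using ramp_mono[of "z - (Z + R)" "z - Z"] ramp_bounds[of "z - Z"] ramp_bounds[of "z - (Z + R)"] R
  by (auto simp: plateau_def)

lemma plateau_zero: "z \<le> Z \<or> Z + R + 1 \<le> z \<Longrightarrow> plateau Z R z = 0"
  using R by (auto simp: plateau_def ramp_zero ramp_one)

lemma plateau_integral_zero: "z \<le> Z \<Longrightarrow> plateau_integral Z R z = 0"
  using R by (auto simp: plateau_integral_def ramp_integral_zero)

lemma plateau_integral_eq: "Z + R + 1 \<le> z \<Longrightarrow> plateau_integral Z R z = R"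
  using R by (auto simp: plateau_integral_def ramp_integral_linear)

lemma plateau_integral_mono: "s \<le> t \<Longrightarrow> plateau_integral Z R s \<le> plateau_integral Z R t"
  using DERIV_nonneg_imp_nondecreasing[of s t "plateau_integral Z R"] plateau_integral_has_derivative plateau_bounds(1)
  by blast

lemma plateau_integral_bounds: "0 \<le> plateau_integral Z R z" "plateau_integral Z R z \<le> R"
  using plateau_integral_mono[of "min z Z" z] plateau_integral_zero[of "min z Z"]
    plateau_integral_mono[of z "max z (Z + R + 1)"] plateau_integral_eq[of "max z (Z + R + 1)"] by auto

end

section \<open>Monotonicity and order of traces\<close>

lemma AE_open_obtains:
  fixes W :: "'a::euclidean_space set"
  assumes "AE x in lebesgue_on U. P x" "open W" "W \<noteq> {}" "W \<subseteq> U" "U \<in> sets lebesgue"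
  obtains x where "x \<in> W" "P x"
proof (rule ccontr)
  assume "\<not> thesis"
  then have "\<forall>x\<in>W. \<not> P x" using that by blast
  moreover have "AE x in lebesgue. x \<in> U \<longrightarrow> P x" using assms(1,5) by (simp add: AE_restrict_space_iff)
  ultimately have "AE x in lebesgue. x \<notin> W" using assms(4) by (auto elim!: eventually_mono)
  then have "W \<in> null_sets lebesgue" using assms(2) AE_iff_null_sets[of W lebesgue] by simp
  then have "negligible W" by (simp add: negligible_iff_null_sets)
  then show False using open_not_negligible[OF assms(2,3)] by blast
qed

lemma bump_has_derivative:
  "((\<lambda>y. (max 0 (r\<^sup>2 - (y - a)\<^sup>2))\<^sup>2) has_real_derivative - 4 * max 0 (r\<^sup>2 - (y - a)\<^sup>2) * (y - a)) (at (y::real))"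
proof -
  have "((\<lambda>y. r\<^sup>2 - (y - a)\<^sup>2) has_real_derivative - 2 * (y - a)) (at y)"
    by (auto intro!: derivative_eq_intros)
  from DERIV_chain2[OF pos_part_square_derivative this] show ?thesis by (simp add: algebra_simps)
qed

text \<open>Testing with a product of a horizontal bump and a difference of two translated ramps compares weighted averages
  of \<open>f\<close> near the two points; the weights have equal mass because the vertical derivative of the
  test function has integral zero.\<close>

lemma mono_if_weak_deriv_nonneg:
  fixes f :: "real \<times> real \<Rightarrow> real" and a b c d :: real
  defines "V \<equiv> {a<..<b} \<times> {c<..<d}"
  assumes cf: "continuous_on V f" and f': "has_weak_deriv V e_z f f'" and nn: "AE x in lebesgue_on V. f' x \<ge> 0"
    and y: "y \<in> {a<..<b}" and z: "c < z1" "z1 \<le> z2" "z2 < d"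
  shows "f (y, z1) \<le> f (y, z2)"
proof (rule ccontr)
  assume "\<not> f (y, z1) \<le> f (y, z2)"
  then have gt: "f (y, z2) < f (y, z1)" by simp
  define m where "m = (f (y, z1) + f (y, z2)) / 2"
  have m: "f (y, z2) < m" "m < f (y, z1)" using gt by (auto simp: m_def)
  have V: "open V" unfolding V_def by (rule open_rectangle)
  have in1: "(y, z1) \<in> V" and in2: "(y, z2) \<in> V" using y z by (auto simp: V_def)
  have o1: "open (V \<inter> f -` {m<..})" by (rule continuous_open_preimage[OF cf V open_greaterThan])
  have "(y, z1) \<in> V \<inter> f -` {m<..}" using in1 m by simp
  with o1 obtain e1 where e1: "e1 > 0" "ball (y, z1) e1 \<subseteq> V \<inter> f -` {m<..}"
    unfolding open_contains_ball by blast
  have o2: "open (V \<inter> f -` {..<m})" by (rule continuous_open_preimage[OF cf V open_lessThan])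
  have "(y, z2) \<in> V \<inter> f -` {..<m}" using in2 m by simp
  with o2 obtain e2 where e2: "e2 > 0" "ball (y, z2) e2 \<subseteq> V \<inter> f -` {..<m}"
    unfolding open_contains_ball by blast
  have e: "e1 > 0" "\<And>x. x \<in> ball (y, z1) e1 \<Longrightarrow> x \<in> V \<and> m < f x"
    "e2 > 0" "\<And>x. x \<in> ball (y, z2) e2 \<Longrightarrow> x \<in> V \<and> f x < m"
    using e1 e2 by blast+
  define r where "r = min e1 e2 / 3"
  have r: "r > 0" "2 * r < e1" "2 * r < e2" using e by (auto simp: r_def)
  have near: "(y', z') \<in> ball (y, z0) e" if "\<bar>y' - y\<bar> \<le> r" "\<bar>z' - z0\<bar> \<le> r" "2 * r < e" for y' z' z0 e
  proof -
    have "dist (y, z0) (y', z') \<le> dist y y' + dist z0 z'"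
      by (simp add: dist_Pair_Pair sqrt_sum_squares_le_sum)
    then show ?thesis using that by (simp add: dist_real_def abs_minus_commute)
  qed
  let ?u = "\<lambda>y'. (max 0 (r\<^sup>2 - (y' - y)\<^sup>2))\<^sup>2"
  let ?v = "\<lambda>z'. ramp ((z' - z1) / r) - ramp ((z' - z2) / r)"
  let ?v' = "\<lambda>z'. (ramp_deriv ((z' - z1) / r) - ramp_deriv ((z' - z2) / r)) / r"
  define \<phi> where "\<phi> = (\<lambda>x. ?u (fst x) * ?v (snd x))"
  define D where "D = (\<lambda>x. ?u (fst x) *\<^sub>R (0, ?v' (snd x)) + ?v (snd x) *\<^sub>R (- 4 * max 0 (r\<^sup>2 - (fst x - y)\<^sup>2) * (fst x - y), 0))"
  have dv: "(?v has_real_derivative ?v' t) (at t)" for t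
    using r(1) by (auto intro!: derivative_eq_intros DERIV_chain2[OF ramp_has_derivative] simp: field_simps)
  have C1: "C1_with_gradient \<phi> D"
    unfolding \<phi>_def D_def
  proof (rule C1_mult[OF C1_fst C1_snd])
    show "continuous_on UNIV (\<lambda>t. - 4 * max 0 (r\<^sup>2 - (t - y)\<^sup>2) * (t - y))" by (intro continuous_intros)
    show "continuous_on UNIV ?v'"
      using r(1) by (intro continuous_intros continuous_on_compose2[OF continuous_on_ramp_deriv]) auto
  qed (rule bump_has_derivative dv)+
  have u0: "?u y' = 0" if "\<not> \<bar>y' - y\<bar> < r" for y'
  proof -
    have "r\<^sup>2 \<le> \<bar>y' - y\<bar>\<^sup>2" using that r(1) by (intro power_mono) auto
    then show ?thesis by simp
  qed
  have u1: "?u y' > 0" if "\<bar>y' - y\<bar> < r" for y'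
  proof -
    have "\<bar>y' - y\<bar>\<^sup>2 < r\<^sup>2" using that r(1) by (intro power_strict_mono) auto
    then show ?thesis by simp
  qed
  define K where "K = {y - r..y + r} \<times> {z1..z2 + r}"
  have K: "compact K" unfolding K_def by (intro compact_Times) auto
  have KV: "K \<subseteq> V"
  proof -
    have "(y - r, z2) \<in> V" "(y + r, z2) \<in> V" "(y, z2 + r) \<in> V"
      using near[of "y - r" z2 z2 e2] near[of "y + r" z2 z2 e2] near[of y "z2 + r" z2 e2] r
      by (auto intro!: conjunct1[OF e(4)])
    then show ?thesis using z by (auto simp: V_def K_def)
  qed
  have \<phi>0: "\<phi> x = 0" if xK: "x \<notin> K" for x
  proof (cases "\<bar>fst x - y\<bar> < r")
    case False
    show ?thesis by (simp only: \<phi>_def u0[OF False] mult_zero_left)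
  next
    case True
    then have "snd x < z1 \<or> z2 + r < snd x" using xK by (cases x) (auto simp: K_def)
    then have "?v (snd x) = 0"
    proof
      assume "snd x < z1"
      then have "(snd x - z1) / r \<le> 0" "(snd x - z2) / r \<le> 0"
        using r(1) z by (auto intro!: divide_nonpos_pos)
      then show ?thesis by (simp only: ramp_zero diff_self)
    next
      assume "z2 + r < snd x"
      then have "1 \<le> (snd x - z1) / r" "1 \<le> (snd x - z2) / r"
        using r(1) z by (simp_all add: le_divide_eq)
      then show ?thesis by (simp only: ramp_one diff_self)
    qed
    then show ?thesis by (simp only: \<phi>_def mult_zero_right)
  qed
  have supp: "compactly_supported_in V \<phi>"
    using K KV \<phi>0 unfolding compactly_supported_in_def by blast
  have \<phi>nn: "\<phi> x \<ge> 0" for x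
    unfolding \<phi>_def using z r(1) by (intro mult_nonneg_nonneg) (auto intro!: ramp_mono divide_right_mono)
  have Dz: "D x \<bullet> e_z = ?u (fst x) * ?v' (snd x)" for x by (simp add: D_def inner_add_left)
  have le0: "(LINT x|lebesgue_on V. f x * (D x \<bullet> e_z)) \<le> 0"
  proof -
    have "(LINT x|lebesgue_on V. f x * (D x \<bullet> e_z)) = - (LINT x|lebesgue_on V. f' x * \<phi> x)"
      using f' C1 supp unfolding has_weak_deriv_def by blast
    moreover have "(LINT x|lebesgue_on V. f' x * \<phi> x) \<ge> 0"
      using nn by (intro integral_nonneg_AE) (auto elim!: eventually_mono intro!: mult_nonneg_nonneg[OF _ \<phi>nn])
    ultimately show ?thesis by linarith
  qed
  have DK: "D x = 0" if "x \<notin> K" for x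
    using C1_gradient_zero_off_compact[OF C1 K \<phi>0 that] .
  have mean0: "(LINT x|lebesgue_on V. D x \<bullet> e_z) = 0"
  proof -
    have "(LINT x|lebesgue_on UNIV. D x \<bullet> e_z) = (LINT x|lebesgue_on V. D x \<bullet> e_z)"
    proof (rule integral_lebesgue_on_support)
      fix x assume "x \<in> UNIV - V"
      then have "x \<notin> K" using KV by blast
      then have "D x = 0" by (rule DK)
      then show "D x \<bullet> e_z = 0" by simp
    qed (use V in auto)
    then show ?thesis
      using integral_gradient_compact_support_zero[OF C1 K \<phi>0] by (simp add: lebesgue_on_UNIV_eq)
  qed
  have i1: "integrable (lebesgue_on V) (\<lambda>x. f x * (D x \<bullet> e_z))"
    by (rule weak_deriv_test_integrable(1)[OF f' V C1 supp])
  have i2: "integrable (lebesgue_on V) (\<lambda>x. D x \<bullet> e_z)"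
    unfolding V_def
    by (rule integrable_continuous_rectangle(2)) (intro continuous_intros C1_gradient_continuous[OF C1])
  have pw: "(f x - m) * (D x \<bullet> e_z) \<ge> 0 \<and>
    (\<bar>fst x - y\<bar> < r \<and> z1 < snd x \<and> snd x < z1 + r \<longrightarrow> (f x - m) * (D x \<bullet> e_z) > 0)" for x
  proof -
    obtain y' z' where x: "x = (y', z')" by (cases x)
    let ?A1 = "?u y' * ramp_deriv ((z' - z1) / r) / r" and ?A2 = "?u y' * ramp_deriv ((z' - z2) / r) / r"
    have eq: "(f x - m) * (D x \<bullet> e_z) = (f x - m) * ?A1 + (m - f x) * ?A2"
      unfolding Dz by (simp add: x diff_divide_distrib algebra_simps)
    have rdz: "ramp_deriv ((z' - z0) / r) = 0" if "\<not> \<bar>z' - z0\<bar> \<le> r" for z0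
      using that r(1) by (intro ramp_deriv_zero) (auto simp: divide_le_0_iff le_divide_eq)
    have t1: "(f x - m) * ?A1 \<ge> 0"
    proof (cases "\<bar>y' - y\<bar> < r \<and> \<bar>z' - z1\<bar> \<le> r")
      case True
      then have "m < f x" using near[of y' z' z1 e1] r e(2)[of x] x by simp
      then show ?thesis using r(1) ramp_deriv_bounds(1) by simp
    next
      case False
      then have "?u y' = 0 \<or> ramp_deriv ((z' - z1) / r) = 0" using u0 rdz by blast
      then have "?A1 = 0" by (elim disjE) (simp_all only: mult_zero_left mult_zero_right div_0)
      then show ?thesis by (simp only: mult_zero_right order_refl)
    qed
    have t2: "(m - f x) * ?A2 \<ge> 0"
    proof (cases "\<bar>y' - y\<bar> < r \<and> \<bar>z' - z2\<bar> \<le> r")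
      case True
      then have "f x < m" using near[of y' z' z2 e2] r e(4)[of x] x by simp
      then show ?thesis using r(1) ramp_deriv_bounds(1) by simp
    next
      case False
      then have "?u y' = 0 \<or> ramp_deriv ((z' - z2) / r) = 0" using u0 rdz by blast
      then have "?A2 = 0" by (elim disjE) (simp_all only: mult_zero_left mult_zero_right div_0)
      then show ?thesis by (simp only: mult_zero_right order_refl)
    qed
    have "(f x - m) * ?A1 > 0" if "\<bar>fst x - y\<bar> < r \<and> z1 < snd x \<and> snd x < z1 + r"
    proof -
      have "m < f x" using near[of y' z' z1 e1] r e(2)[of x] x that by simp
      moreover have "ramp_deriv ((z' - z1) / r) > 0" using that x r(1) by (intro ramp_deriv_pos) auto
      ultimately show ?thesis using u1[of y'] that x r(1) by simp
    qed
    then show ?thesis unfolding eq using t1 t2 by linarith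
  qed
  have i3: "integrable (lebesgue_on V) (\<lambda>x. (f x - m) * (D x \<bullet> e_z))"
    using Bochner_Integration.integrable_diff[OF i1 integrable_mult_right[OF i2, of m]] by (simp only: left_diff_distrib)
  have "(LINT x|lebesgue_on V. (f x - m) * (D x \<bullet> e_z)) = (LINT x|lebesgue_on V. f x * (D x \<bullet> e_z)) - m * (LINT x|lebesgue_on V. D x \<bullet> e_z)"
    unfolding left_diff_distrib
    by (subst Bochner_Integration.integral_diff[OF i1 integrable_mult_right[OF i2]]) (simp only: integral_mult_right_zero)
  then have "(LINT x|lebesgue_on V. (f x - m) * (D x \<bullet> e_z)) \<le> 0" using le0 mean0 by simp
  moreover have "(LINT x|lebesgue_on V. (f x - m) * (D x \<bullet> e_z)) \<ge> 0"
    using pw by (intro integral_nonneg_AE AE_I2) blast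
  ultimately have "(LINT x|lebesgue_on V. (f x - m) * (D x \<bullet> e_z)) = 0" by (rule antisym)
  then have ae: "AE x in lebesgue_on V. (f x - m) * (D x \<bullet> e_z) = 0"
    by (subst (asm) integral_nonneg_eq_0_iff_AE[OF i3]) (use pw in \<open>auto intro!: AE_I2\<close>)
  have sub: "{y - r<..<y + r} \<times> {z1<..<z1 + r} \<subseteq> V" using KV z(2) unfolding K_def by force
  have ne: "{y - r<..<y + r} \<times> {z1<..<z1 + r} \<noteq> {}" using r(1) by simp
  obtain x where "x \<in> {y - r<..<y + r} \<times> {z1<..<z1 + r}" "(f x - m) * (D x \<bullet> e_z) = 0"
    using AE_open_obtains[OF ae open_rectangle ne sub] V by auto
  moreover have "\<bar>fst x - y\<bar> < r \<and> z1 < snd x \<and> snd x < z1 + r"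
    using calculation(1) by auto
  ultimately show False using pw[of x] by linarith
qed

text \<open>In the Gauss formula with a cutoff in a thin layer above the boundary, the term with the weak derivative is small and the other
  one is an average of \<open>f\<close> over the layer.\<close>

lemma trace_le_if_AE_le:
  fixes f :: "real \<times> real \<Rightarrow> real" and a b R :: real
  assumes tr: "has_trace {a<..<b} {0<..<R} 0 f \<psi>" and R: "0 < R"
    and le: "AE x in lebesgue_on ({a<..<b} \<times> {0<..<R}). f x \<le> C"
  shows "AE y in lebesgue_on {a<..<b}. \<psi> y \<le> C"
proof -
  let ?V = "{a<..<b} \<times> {0<..<R}" and ?I = "{a<..<b}"
  obtain f' where f': "has_weak_deriv ?V e_z f f'" and f'2: "L2_on ?V f'" and f2: "L2_on ?V f" and \<psi>2: "L2_on ?I \<psi>"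
    using tr unfolding has_trace_def L2_converges_def by blast
  have if': "integrable (lebesgue_on ?V) f'"
    by (rule L2_on_integrable[OF f'2 rectangle_measurable])
  have "AE y in lebesgue_on ?I. C - \<psi> y \<ge> 0"
  proof (rule AE_nonneg_if_tested_nonneg)
    show "L1_loc ?I (\<lambda>y. C - \<psi> y)"
      by (intro L2_on_imp_L1_loc L2_on_diff[OF _ \<psi>2] L2_on_continuous_bounded_set) auto
    fix w D assume w: "C1_with_gradient w D" "compactly_supported_in ?I w" "\<And>x. w x \<ge> 0"
    have cw: "continuous_on UNIV w" by (rule C1_continuous[OF w(1)])
    obtain M where M: "\<And>y. \<bar>w y\<bar> \<le> M"
      using w(2) C1_compact_support_gradient_bounded[OF w(1)] unfolding compactly_supported_in_def by metis
    \<comment> \<open>Cutoff functions equal to \<open>1\<close> at the bottom and supported in layers of height \<open>R / (n + 1)\<close>.\<close>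
    let ?\<eta> = "\<lambda>n z. 1 - ramp (real (Suc n) * z / R)"
    let ?\<eta>' = "\<lambda>n z. - (real (Suc n) / R) * ramp_deriv (real (Suc n) * z / R)"
    have d\<eta>: "(?\<eta> n has_real_derivative ?\<eta>' n t) (at t)" for n t
      using R by (auto intro!: derivative_eq_intros DERIV_chain2[OF ramp_has_derivative] simp del: of_nat_Suc)
    have c\<eta>: "continuous_on UNIV (?\<eta> n)" and c\<eta>': "continuous_on UNIV (?\<eta>' n)" for n
      using R by (intro continuous_intros continuous_on_compose2[OF continuous_on_ramp]
          continuous_on_compose2[OF continuous_on_ramp_deriv]; simp)+
    have \<eta>R: "?\<eta> n R = 0" and \<eta>0: "?\<eta> n 0 = 1" for n using R by (simp_all add: ramp_one ramp_zero)
    have cw\<eta>: "continuous_on UNIV (\<lambda>x::real \<times> real. w (fst x) * ?\<eta> n (snd x))"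
      and cw\<eta>': "continuous_on UNIV (\<lambda>x::real \<times> real. w (fst x) * ?\<eta>' n (snd x))" for n
      by (intro continuous_intros continuous_on_compose2[OF cw] continuous_on_compose2[OF c\<eta>]
          continuous_on_compose2[OF c\<eta>']; simp)+
    have ge: "(LINT x|lebesgue_on ?V. f' x * (w (fst x) * ?\<eta> n (snd x))) \<le> (LINT y|lebesgue_on ?I. (C - \<psi> y) * w y)" for n
    proof -
      have 1: "(LINT x|lebesgue_on ?V. f' x * (w (fst x) * ?\<eta> n (snd x)))
        + (LINT x|lebesgue_on ?V. f x * (w (fst x) * ?\<eta>' n (snd x))) = - ?\<eta> n 0 * (LINT y|lebesgue_on ?I. \<psi> y * w y)"
        using Gauss_rectangle_trace[OF tr f' cw d\<eta> c\<eta>' \<eta>R] R by simp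
      have 2: "(LINT x|lebesgue_on ?V. (0 \<bullet> e_z) * (w (fst x) * ?\<eta> n (snd x)))
        + (LINT x|lebesgue_on ?V. C * (w (fst x) * ?\<eta>' n (snd x))) = (LINT y|lebesgue_on ?I. w y * (C * ?\<eta> n R - C * ?\<eta> n 0))"
        using Gauss_rectangle_C1[OF C1_const cw d\<eta> c\<eta>'] R by simp
      have "(LINT x|lebesgue_on ?V. C * (w (fst x) * ?\<eta>' n (snd x))) \<le> (LINT x|lebesgue_on ?V. f x * (w (fst x) * ?\<eta>' n (snd x)))"
      proof (rule integral_mono_AE)
        show "integrable (lebesgue_on ?V) (\<lambda>x. C * (w (fst x) * ?\<eta>' n (snd x)))"
          by (intro integrable_mult_right integrable_continuous_rectangle(2) cw\<eta>')
        show "integrable (lebesgue_on ?V) (\<lambda>x. f x * (w (fst x) * ?\<eta>' n (snd x)))"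
          by (intro L2_on_mult_integrable f2 integrable_continuous_rectangle(1) cw\<eta>')
        show "AE x in lebesgue_on ?V. C * (w (fst x) * ?\<eta>' n (snd x)) \<le> f x * (w (fst x) * ?\<eta>' n (snd x))"
          using le
        proof eventually_elim
          case (elim x)
          have "0 \<le> real (Suc n) / R * ramp_deriv (real (Suc n) * snd x / R)"
            using R ramp_deriv_bounds(1) by (intro mult_nonneg_nonneg divide_nonneg_pos) auto
          then have "?\<eta>' n (snd x) \<le> 0" by (simp only: mult_minus_left neg_le_0_iff_le)
          then have "w (fst x) * ?\<eta>' n (snd x) \<le> 0" by (rule mult_nonneg_nonpos[OF w(3)])
          then show ?case using elim by (rule mult_right_mono_neg[rotated])
        qed
      qed
      moreover have "(LINT y|lebesgue_on ?I. w y * (C * ?\<eta> n R - C * ?\<eta> n 0)) = - C * (LINT y|lebesgue_on ?I. w y)"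
        unfolding \<eta>R \<eta>0 by (simp add: mult.commute)
      moreover have "(LINT y|lebesgue_on ?I. (C - \<psi> y) * w y) = C * (LINT y|lebesgue_on ?I. w y) - (LINT y|lebesgue_on ?I. \<psi> y * w y)"
      proof -
        have w2: "L2_on ?I w" by (rule L2_on_continuous_bounded_set[OF cw]) auto
        have "integrable (lebesgue_on ?I) w" by (rule L2_on_integrable[OF w2]) auto
        then show ?thesis using L2_on_mult_integrable[OF \<psi>2 w2] by (simp add: left_diff_distrib)
      qed
      ultimately show ?thesis using 1 2 \<eta>0[of n] by simp
    qed
    have "(\<lambda>n. LINT x|lebesgue_on ?V. f' x * (w (fst x) * ?\<eta> n (snd x))) \<longlonglongrightarrow> (LINT x|lebesgue_on ?V. 0)"
    proof (rule integral_dominated_convergence[where w = "\<lambda>x. M * \<bar>f' x\<bar>"])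
      show "integrable (lebesgue_on ?V) (\<lambda>x. M * \<bar>f' x\<bar>)" using if' by auto
      show "(\<lambda>x. f' x * (w (fst x) * ?\<eta> n (snd x))) \<in> borel_measurable (lebesgue_on ?V)" for n
        by (rule borel_measurable_integrable[OF L2_on_mult_integrable[OF f'2 integrable_continuous_rectangle(1)[OF cw\<eta>]]])
      show "AE x in lebesgue_on ?V. norm (f' x * (w (fst x) * ?\<eta> n (snd x))) \<le> M * \<bar>f' x\<bar>" for n
      proof (rule AE_I2)
        fix x
        have "\<bar>w (fst x)\<bar> * \<bar>?\<eta> n (snd x)\<bar> \<le> M * 1"
          using M[of "fst x"] ramp_bounds[of "real (Suc n) * snd x / R"] by (intro mult_mono) auto
        then have "\<bar>f' x\<bar> * (\<bar>w (fst x)\<bar> * \<bar>?\<eta> n (snd x)\<bar>) \<le> \<bar>f' x\<bar> * M"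
          by (intro mult_left_mono) auto
        then show "norm (f' x * (w (fst x) * ?\<eta> n (snd x))) \<le> M * \<bar>f' x\<bar>"
          by (simp only: real_norm_def abs_mult mult.commute)
      qed
      show "AE x in lebesgue_on ?V. (\<lambda>n. f' x * (w (fst x) * ?\<eta> n (snd x))) \<longlonglongrightarrow> 0"
      proof (rule AE_I2)
        fix x assume "x \<in> space (lebesgue_on ?V)"
        then have z: "snd x > 0" by auto
        obtain N :: nat where N: "real N > R / snd x" using reals_Archimedean2 by blast
        have "f' x * (w (fst x) * ?\<eta> n (snd x)) = 0" if "N \<le> n" for n
        proof -
          have "R / snd x < real (Suc n)" using N that by linarith
          then have "1 \<le> real (Suc n) * snd x / R" using R z by (simp add: field_simps del: of_nat_Suc)
          then show ?thesis by (simp add: ramp_one del: of_nat_Suc)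
        qed
        then show "(\<lambda>n. f' x * (w (fst x) * ?\<eta> n (snd x))) \<longlonglongrightarrow> 0"
          by (intro tendsto_eventually eventually_sequentiallyI[of N]) blast
      qed
    qed simp
    then have "(\<lambda>n. LINT x|lebesgue_on ?V. f' x * (w (fst x) * ?\<eta> n (snd x))) \<longlonglongrightarrow> 0" by simp
    then show "(LINT y|lebesgue_on ?I. (C - \<psi> y) * w y) \<ge> 0"
      by (rule LIMSEQ_le_const2) (use ge in blast)
  qed simp
  then show ?thesis by eventually_elim simp
qed

section \<open>Passage to the limit\<close>

lemma integral_exhaustion:
  fixes f :: "'a::euclidean_space \<Rightarrow> real"
  assumes f: "integrable (lebesgue_on U) f" and U: "U \<in> sets lebesgue"
    and A: "\<And>n. A n \<subseteq> U" "\<And>n. A n \<in> sets lebesgue" "\<And>x. x \<in> U \<Longrightarrow> \<forall>\<^sub>F n in sequentially. x \<in> A n"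
  shows "(\<lambda>n. LINT x|lebesgue_on (A n). f x) \<longlonglongrightarrow> (LINT x|lebesgue_on U. f x)"
proof -
  have fi: "integrable lebesgue (\<lambda>x. if x \<in> U then f x else 0)"
    using f U by (simp add: Lebesgue_Measure.integrable_restrict_UNIV)
  have "(\<lambda>n. LINT x|lebesgue. (if x \<in> A n then f x else 0)) \<longlonglongrightarrow> (LINT x|lebesgue. (if x \<in> U then f x else 0))"
  proof (rule integral_dominated_convergence[where w = "\<lambda>x. \<bar>if x \<in> U then f x else 0\<bar>"])
    show "integrable lebesgue (\<lambda>x. \<bar>if x \<in> U then f x else 0\<bar>)" using fi by (rule integrable_abs)
    show "(\<lambda>x. if x \<in> U then f x else 0) \<in> borel_measurable lebesgue" using fi by auto
    show "(\<lambda>x. if x \<in> A n then f x else 0) \<in> borel_measurable lebesgue" for n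
    proof -
      have "integrable (lebesgue_on (A n)) f" by (rule integrable_lebesgue_on_subset[OF f A(1,2) U])
      then show ?thesis using A(2) by (auto simp: Lebesgue_Measure.integrable_restrict_UNIV[symmetric])
    qed
    show "AE x in lebesgue. (\<lambda>n. if x \<in> A n then f x else 0) \<longlonglongrightarrow> (if x \<in> U then f x else 0)"
    proof (rule AE_I2)
      fix x
      show "(\<lambda>n. if x \<in> A n then f x else 0) \<longlonglongrightarrow> (if x \<in> U then f x else 0)"
      proof (cases "x \<in> U")
        case True
        have "\<forall>\<^sub>F n in sequentially. (if x \<in> A n then f x else 0) = (if x \<in> U then f x else 0)"
          using A(3)[OF True] by eventually_elim (simp add: True)
        then show ?thesis by (rule tendsto_eventually)
      next
        case False
        then have "x \<notin> A n" for n using A(1) by blast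
        then show ?thesis using False by simp
      qed
    qed
    show "AE x in lebesgue. norm (if x \<in> A n then f x else 0) \<le> \<bar>if x \<in> U then f x else 0\<bar>" for n
      using A(1)[of n] by (intro AE_I2) auto
  qed
  then show ?thesis using U A(2) by (simp add: integral_lebesgue_on_if)
qed

lemma abs_integral_le:
  fixes f h :: "'a \<Rightarrow> real"
  assumes "integrable M h" "AE x in M. \<bar>f x\<bar> \<le> h x"
  shows "\<bar>integral\<^sup>L M f\<bar> \<le> integral\<^sup>L M h"
proof (cases "integrable M f")
  case True
  have "\<bar>integral\<^sup>L M f\<bar> \<le> (LINT x|M. \<bar>f x\<bar>)" by (rule integral_abs_bound)
  also have "\<dots> \<le> integral\<^sup>L M h" using True assms by (intro integral_mono_AE) auto
  finally show ?thesis .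
next
  case False
  then have "integral\<^sup>L M f = 0" by (rule not_integrable_integral_eq)
  moreover have "integral\<^sup>L M h \<ge> 0"
    using assms(2) by (intro integral_nonneg_AE) (auto elim!: eventually_mono)
  ultimately show ?thesis by simp
qed

text \<open>A bounded function on an open set of finite measure is first cut off to a compact subset, where it is an almost everywhere limit of
  uniformly bounded test functions. The lower bound is kept, so that nonnegative functions have nonnegative approximations.\<close>

lemma C1_dense_L1:
  fixes f :: "'a::euclidean_space \<Rightarrow> real"
  assumes U: "open U" "U \<in> lmeasurable" and f: "f \<in> borel_measurable (lebesgue_on U)"
    and bd: "\<And>x. x \<in> U \<Longrightarrow> l \<le> f x" "\<And>x. x \<in> U \<Longrightarrow> f x \<le> u" and lu: "l \<le> 0" "0 \<le> u" and e: "e > 0"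
  obtains \<phi> D S where "C1_with_gradient \<phi> D" "compact S" "S \<subseteq> U" "\<And>x. x \<notin> S \<Longrightarrow> \<phi> x = 0"
    "\<And>x. l \<le> \<phi> x" "\<And>x. \<phi> x \<le> u + 2" "(LINT x|lebesgue_on U. \<bar>f x - \<phi> x\<bar>) < e"
proof -
  have Us: "U \<in> sets lebesgue" using U by auto
  obtain C where C: "\<And>n. compact (C n)" "\<And>n. C n \<subseteq> U" and Cs: "\<And>n. C n \<in> sets lebesgue"
    and ex: "\<And>x. x \<in> U \<Longrightarrow> \<forall>\<^sub>F n in sequentially. x \<in> C n"
    using open_compact_exhaustion[OF U(1)] by metis
  have fi: "integrable (lebesgue_on U) f"
  proof (rule integrable_lebesgue_on_bounded[OF f U(2)])
    have "norm (f x) \<le> \<bar>l\<bar> + \<bar>u\<bar>" if "x \<in> U" for x using bd[OF that] by auto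
    then show "AE x in lebesgue_on U. norm (f x) \<le> \<bar>l\<bar> + \<bar>u\<bar>" by (intro AE_I2) auto
  qed
  have "(\<lambda>n. LINT x|lebesgue_on (C n). \<bar>f x\<bar>) \<longlonglongrightarrow> (LINT x|lebesgue_on U. \<bar>f x\<bar>)"
    by (rule integral_exhaustion[OF integrable_abs[OF fi] Us C(2) Cs ex])
  then have "\<forall>\<^sub>F n in sequentially. (LINT x|lebesgue_on U. \<bar>f x\<bar>) - e / 2 < (LINT x|lebesgue_on (C n). \<bar>f x\<bar>)"
    using e by (intro order_tendstoD(1)) auto
  then obtain n where n: "(LINT x|lebesgue_on U. \<bar>f x\<bar>) - e / 2 < (LINT x|lebesgue_on (C n). \<bar>f x\<bar>)"
    by (auto simp: eventually_sequentially)
  define h where "h = (\<lambda>x. if x \<in> C n then f x else 0)"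
  have "integrable (lebesgue_on (C n)) f" by (rule integrable_lebesgue_on_subset[OF fi C(2) Cs Us])
  then have hm: "h \<in> borel_measurable lebesgue"
    unfolding h_def using Cs by (auto simp: Lebesgue_Measure.integrable_restrict_UNIV[symmetric])
  have hb: "l \<le> h x" "h x \<le> u" for x using bd[of x] C(2)[of n] lu by (auto simp: h_def)
  have h0: "h x = 0" if "x \<notin> C n" for x using that by (simp add: h_def)
  obtain \<phi> D S where p: "\<And>m. C1_with_gradient (\<phi> m) (D m)" "compact S" "S \<subseteq> U"
    "\<And>m x. x \<notin> S \<Longrightarrow> \<phi> m x = 0" "\<And>m x. l \<le> \<phi> m x" "\<And>m x. \<phi> m x \<le> u + 2"
    and lim: "AE x in lebesgue. (\<lambda>m. \<phi> m x) \<longlonglongrightarrow> h x"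
    using C1_approximation[OF hm C(1) U(1) C(2) h0 hb lu] by blast
  have hmU: "h \<in> borel_measurable (lebesgue_on U)" using hm by (rule measurable_restrict_space1)
  have pmU: "\<phi> m \<in> borel_measurable (lebesgue_on U)" for m
    by (rule continuous_imp_measurable_on_sets_lebesgue[OF C1_continuous[OF p(1)] Us])
  have cb: "norm \<bar>h x - \<phi> m x\<bar> \<le> \<bar>l\<bar> + \<bar>u\<bar> + 2" for m x
    using hb[of x] p(5,6)[of m x] lu by (simp add: abs_le_iff)
  have ci: "integrable (lebesgue_on U) (\<lambda>x. \<bar>l\<bar> + \<bar>u\<bar> + 2)"
    by (rule integrable_lebesgue_on_bounded[where C = "\<bar>l\<bar> + \<bar>u\<bar> + 2"]) (use U(2) in auto)
  have "(\<lambda>m. LINT x|lebesgue_on U. \<bar>h x - \<phi> m x\<bar>) \<longlonglongrightarrow> (LINT x|lebesgue_on U. 0)"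
  proof (rule integral_dominated_convergence[OF _ _ ci])
    show "AE x in lebesgue_on U. (\<lambda>m. \<bar>h x - \<phi> m x\<bar>) \<longlonglongrightarrow> 0"
    proof -
      have "AE x in lebesgue_on U. (\<lambda>m. \<phi> m x) \<longlonglongrightarrow> h x"
        using lim Us by (auto simp: AE_restrict_space_iff elim: eventually_mono)
      then show ?thesis
      proof eventually_elim
        case (elim x)
        show ?case using tendsto_rabs[OF tendsto_diff[OF tendsto_const[of "h x"] elim]] by simp
      qed
    qed
  qed (use hmU pmU cb in \<open>auto intro!: AE_I2\<close>)
  then have "\<forall>\<^sub>F m in sequentially. (LINT x|lebesgue_on U. \<bar>h x - \<phi> m x\<bar>) < e / 2"
    using e by (intro order_tendstoD(2)) auto
  then obtain m where m: "(LINT x|lebesgue_on U. \<bar>h x - \<phi> m x\<bar>) < e / 2"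
    by (auto simp: eventually_sequentially)
  have hi: "integrable (lebesgue_on U) (\<lambda>x. \<bar>h x - \<phi> m x\<bar>)"
    by (rule Bochner_Integration.integrable_bound[OF ci]) (use hmU pmU cb in \<open>auto intro!: AE_I2\<close>)
  have hi2: "integrable (lebesgue_on U) h"
    by (rule Bochner_Integration.integrable_bound[OF fi hmU]) (auto simp: h_def)
  have fh: "(LINT x|lebesgue_on U. \<bar>f x - h x\<bar>) < e / 2"
  proof -
    have "(LINT x|lebesgue_on U. \<bar>f x - h x\<bar>) = (LINT x|lebesgue_on U. \<bar>f x\<bar> - \<bar>h x\<bar>)"
      by (intro Bochner_Integration.integral_cong) (auto simp: h_def)
    also have "\<dots> = (LINT x|lebesgue_on U. \<bar>f x\<bar>) - (LINT x|lebesgue_on U. \<bar>h x\<bar>)"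
      using fi hi2 by (intro Bochner_Integration.integral_diff integrable_abs)
    also have "(LINT x|lebesgue_on U. \<bar>h x\<bar>) = (LINT x|lebesgue_on (C n). \<bar>h x\<bar>)"
      by (rule integral_lebesgue_on_support) (use C(2) Cs Us h0 in auto)
    also have "\<dots> = (LINT x|lebesgue_on (C n). \<bar>f x\<bar>)"
      by (intro Bochner_Integration.integral_cong) (auto simp: h_def)
    finally show ?thesis using n by linarith
  qed
  have "(LINT x|lebesgue_on U. \<bar>f x - \<phi> m x\<bar>) \<le> (LINT x|lebesgue_on U. \<bar>f x - h x\<bar> + \<bar>h x - \<phi> m x\<bar>)"
  proof (rule integral_mono_AE)
    have fhi: "integrable (lebesgue_on U) (\<lambda>x. \<bar>f x - h x\<bar>)" using fi hi2 by auto
    show "integrable (lebesgue_on U) (\<lambda>x. \<bar>f x - h x\<bar> + \<bar>h x - \<phi> m x\<bar>)" using fhi hi by auto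
    then show "integrable (lebesgue_on U) (\<lambda>x. \<bar>f x - \<phi> m x\<bar>)"
      by (rule Bochner_Integration.integrable_bound) (use f pmU in auto)
  qed auto
  also have "\<dots> = (LINT x|lebesgue_on U. \<bar>f x - h x\<bar>) + (LINT x|lebesgue_on U. \<bar>h x - \<phi> m x\<bar>)"
    using fi hi2 hi by auto
  also have "\<dots> < e" using fh m by linarith
  finally show ?thesis using that[OF p(1,2,3,4,5,6)] by blast
qed

lemma AE_le_L2_limit:
  fixes f :: "'a::euclidean_space \<Rightarrow> real"
  assumes U: "open U" and fL: "L1_loc U f"
    and V: "\<And>n. V n \<in> sets lebesgue" "\<And>K. compact K \<Longrightarrow> K \<subseteq> U \<Longrightarrow> \<forall>\<^sub>F n in sequentially. K \<subseteq> V n"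
    and conv: "\<And>K. compact K \<Longrightarrow> K \<subseteq> U \<Longrightarrow> L2_converges K fn f"
    and le: "\<And>n. AE x in lebesgue_on (V n). fn n x \<le> C"
  shows "AE x in lebesgue_on U. f x \<le> C"
proof -
  have "AE x in lebesgue_on U. C - f x \<ge> 0"
  proof (rule AE_nonneg_if_tested_nonneg[OF U L1_loc_diff[OF L1_loc_const fL]])
    fix \<phi> D assume \<phi>: "C1_with_gradient \<phi> D" "compactly_supported_in U \<phi>" "\<And>x. \<phi> x \<ge> 0"
    obtain K where K: "compact K" "K \<subseteq> U" "\<And>x. x \<notin> K \<Longrightarrow> \<phi> x = 0"
      using \<phi>(2) by (auto simp: compactly_supported_in_def)
    have Ks: "K \<in> lmeasurable" using K(1) by (rule lmeasurable_compact)
    have \<phi>2: "L2_on K \<phi>"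
      by (rule L2_on_continuous_bounded_set[OF C1_continuous[OF \<phi>(1)] compact_imp_bounded[OF K(1)]]) (use Ks in auto)
    have c2: "L2_on K (\<lambda>_. C)" by (rule L2_on_bounded[where C = "\<bar>C\<bar>"]) (use Ks in auto)
    have "(\<lambda>n. LINT x|lebesgue_on K. (C - fn n x) * \<phi> x) \<longlonglongrightarrow> (LINT x|lebesgue_on K. (C - f x) * \<phi> x)"
      by (rule L2_converges_imp_weak[OF L2_converges_diff[OF L2_converges_const[OF c2] conv[OF K(1,2)]] \<phi>2])
    moreover have "\<forall>\<^sub>F n in sequentially. (LINT x|lebesgue_on K. (C - fn n x) * \<phi> x) \<ge> 0"
      using V(2)[OF K(1,2)]
    proof eventually_elim
      case (elim n)
      have "AE x in lebesgue_on K. fn n x \<le> C"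
        by (rule AE_lebesgue_on_subset[OF le elim]) (use Ks V in auto)
      then show ?case
        by (intro integral_nonneg_AE) (auto elim!: eventually_mono intro!: mult_nonneg_nonneg \<phi>(3))
    qed
    ultimately have "(LINT x|lebesgue_on K. (C - f x) * \<phi> x) \<ge> 0"
      by (rule tendsto_lowerbound) simp
    also have "(LINT x|lebesgue_on K. (C - f x) * \<phi> x) = (LINT x|lebesgue_on U. (C - f x) * \<phi> x)"
      by (rule integral_lebesgue_on_support[symmetric]) (use K Ks U in auto)
    finally show "(LINT x|lebesgue_on U. (C - f x) * \<phi> x) \<ge> 0" .
  qed
  then show ?thesis by eventually_elim simp
qed

text \<open>Functions converging locally in \<open>L\<^sup>2\<close> whose weak derivatives are uniformly bounded: the bound passes to the limit, and
  the derivatives converge weakly against all bounded functions with compact support.\<close>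

context
  fixes U :: "'a::euclidean_space set" and V :: "nat \<Rightarrow> 'a set" and fn gn :: "nat \<Rightarrow> 'a \<Rightarrow> real" and f g b C
  assumes U: "open U" and V: "\<And>n. open (V n)"
    and ev: "\<And>K. compact K \<Longrightarrow> K \<subseteq> U \<Longrightarrow> \<forall>\<^sub>F n in sequentially. K \<subseteq> V n"
    and conv: "\<And>K. compact K \<Longrightarrow> K \<subseteq> U \<Longrightarrow> L2_converges K fn f"
    and gn: "\<And>n. has_weak_deriv (V n) b (fn n) (gn n)" and g: "has_weak_deriv U b f g"
    and bd: "\<And>n. AE x in lebesgue_on (V n). \<bar>gn n x\<bar> \<le> C" and C: "0 \<le> C"
begin

lemma weak_deriv_limit_tested:
  assumes \<phi>: "C1_with_gradient \<phi> D" and K: "compact K" "K \<subseteq> U" "\<And>x. x \<notin> K \<Longrightarrow> \<phi> x = 0"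
  shows "(\<lambda>n. LINT x|lebesgue_on K. gn n x * \<phi> x) \<longlonglongrightarrow> (LINT x|lebesgue_on K. g x * \<phi> x)"
proof -
  have Ks: "K \<in> sets lebesgue" using lmeasurable_compact[OF K(1)] by auto
  have Dz: "D x = 0" if "x \<notin> K" for x by (rule C1_gradient_zero_off_compact[OF \<phi> K(1,3) that])
  have eq: "(LINT x|lebesgue_on K. h' x * \<phi> x) = - (LINT x|lebesgue_on K. h x * (D x \<bullet> b))"
    if W: "open W" "K \<subseteq> W" and h: "has_weak_deriv W b h h'" for W h h'
  proof -
    have "compactly_supported_in W \<phi>" using K W by (auto simp: compactly_supported_in_def)
    then have "(LINT x|lebesgue_on W. h x * (D x \<bullet> b)) = - (LINT x|lebesgue_on W. h' x * \<phi> x)"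
      using h \<phi> unfolding has_weak_deriv_def by blast
    moreover have "(LINT x|lebesgue_on W. h x * (D x \<bullet> b)) = (LINT x|lebesgue_on K. h x * (D x \<bullet> b))"
    proof (rule integral_lebesgue_on_support)
      fix x assume "x \<in> W - K"
      then have "D x = 0" using Dz by blast
      then show "h x * (D x \<bullet> b) = 0" by simp
    qed (use W Ks in auto)
    moreover have "(LINT x|lebesgue_on W. h' x * \<phi> x) = (LINT x|lebesgue_on K. h' x * \<phi> x)"
      by (rule integral_lebesgue_on_support) (use W Ks K in auto)
    ultimately show ?thesis by simp
  qed
  have "L2_on K (\<lambda>x. D x \<bullet> b)"
    by (rule L2_on_continuous_bounded_set)
      (use K compact_imp_bounded Ks C1_gradient_continuous[OF \<phi>] in \<open>auto intro!: continuous_intros\<close>)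
  then have "(\<lambda>n. - (LINT x|lebesgue_on K. fn n x * (D x \<bullet> b))) \<longlonglongrightarrow> - (LINT x|lebesgue_on K. f x * (D x \<bullet> b))"
    by (intro tendsto_minus L2_converges_imp_weak[OF conv[OF K(1,2)]])
  also have "- (LINT x|lebesgue_on K. f x * (D x \<bullet> b)) = (LINT x|lebesgue_on K. g x * \<phi> x)"
    using eq[OF U K(2) g] by simp
  finally show ?thesis
  proof (rule Lim_transform_eventually)
    show "\<forall>\<^sub>F n in sequentially. - (LINT x|lebesgue_on K. fn n x * (D x \<bullet> b)) = (LINT x|lebesgue_on K. gn n x * \<phi> x)"
      using ev[OF K(1,2)]
    proof eventually_elim
      case (elim n)
      show ?case using eq[OF V elim gn] by simp
    qed
  qed
qed

lemma weak_deriv_limit_bounded: "AE x in lebesgue_on U. \<bar>g x\<bar> \<le> C"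
proof -
  have gL: "L1_loc U g" using g by (simp add: has_weak_deriv_def)
  have sgn: "AE x in lebesgue_on U. C - \<sigma> * g x \<ge> 0" if \<sigma>: "\<sigma> = 1 \<or> \<sigma> = -1" for \<sigma> :: real
  proof (rule AE_nonneg_if_tested_nonneg[OF U])
    have "L1_loc U (\<lambda>x. \<sigma> * g x)" using L1_loc_integrable[OF gL] by (intro L1_locI) auto
    then show "L1_loc U (\<lambda>x. C - \<sigma> * g x)" by (rule L1_loc_diff[OF L1_loc_const])
    fix \<phi> D assume \<phi>: "C1_with_gradient \<phi> D" "compactly_supported_in U \<phi>" "\<And>x. \<phi> x \<ge> 0"
    obtain K where K: "compact K" "K \<subseteq> U" "\<And>x. x \<notin> K \<Longrightarrow> \<phi> x = 0"
      using \<phi>(2) by (auto simp: compactly_supported_in_def)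
    have Ks: "K \<in> sets lebesgue" using lmeasurable_compact[OF K(1)] by auto
    have \<phi>i: "integrable (lebesgue_on K) \<phi>"
      by (rule L2_on_integrable[OF L2_on_continuous_bounded_set])
        (use C1_continuous[OF \<phi>(1)] K Ks lmeasurable_compact compact_imp_bounded in auto)
    have gi: "integrable (lebesgue_on K) (\<lambda>x. h x * \<phi> x)" if "L1_loc W h" "open W" "K \<subseteq> W" for h W
      using L1_loc_mult_integrable[OF that(1) K(1) that(3,2) C1_continuous[OF \<phi>(1)] K(3)]
      by (rule integrable_lebesgue_on_subset) (use that Ks in auto)
    have lim: "(\<lambda>n. C * (LINT x|lebesgue_on K. \<phi> x) - \<sigma> * (LINT x|lebesgue_on K. gn n x * \<phi> x))
        \<longlonglongrightarrow> C * (LINT x|lebesgue_on K. \<phi> x) - \<sigma> * (LINT x|lebesgue_on K. g x * \<phi> x)"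
      by (intro tendsto_intros weak_deriv_limit_tested[OF \<phi>(1) K])
    have "\<forall>\<^sub>F n in sequentially. C * (LINT x|lebesgue_on K. \<phi> x) - \<sigma> * (LINT x|lebesgue_on K. gn n x * \<phi> x) \<ge> 0"
      using ev[OF K(1,2)]
    proof eventually_elim
      case (elim n)
      have i: "integrable (lebesgue_on K) (\<lambda>x. gn n x * \<phi> x)"
        using gn[of n] V[of n] elim by (intro gi) (auto simp: has_weak_deriv_def)
      have "AE x in lebesgue_on K. \<bar>gn n x\<bar> \<le> C"
        by (rule AE_lebesgue_on_subset[OF bd elim Ks]) (use V in auto)
      then have "0 \<le> (LINT x|lebesgue_on K. C * \<phi> x - \<sigma> * (gn n x * \<phi> x))"
      proof (intro integral_nonneg_AE, eventually_elim)
        case (elim x)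
        have "\<sigma> * gn n x \<le> C" using elim \<sigma> by (auto simp: abs_le_iff)
        then have "\<sigma> * gn n x * \<phi> x \<le> C * \<phi> x" using \<phi>(3) by (intro mult_right_mono)
        then show ?case by (simp add: mult.assoc)
      qed
      then show ?case using i \<phi>i by simp
    qed
    then have "0 \<le> C * (LINT x|lebesgue_on K. \<phi> x) - \<sigma> * (LINT x|lebesgue_on K. g x * \<phi> x)"
      by (rule tendsto_lowerbound[OF lim]) simp
    also have "\<dots> = (LINT x|lebesgue_on K. (C - \<sigma> * g x) * \<phi> x)"
      using gi[OF gL U K(2)] \<phi>i by (simp add: left_diff_distrib mult.assoc)
    also have "\<dots> = (LINT x|lebesgue_on U. (C - \<sigma> * g x) * \<phi> x)"
      by (rule integral_lebesgue_on_support[symmetric]) (use K Ks U in auto)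
    finally show "(LINT x|lebesgue_on U. (C - \<sigma> * g x) * \<phi> x) \<ge> 0" .
  qed
  have "AE x in lebesgue_on U. C - 1 * g x \<ge> 0" "AE x in lebesgue_on U. C - (-1) * g x \<ge> 0"
    by (rule sgn; simp)+
  then show ?thesis by eventually_elim auto
qed

lemma weak_deriv_limit_bounded_tested:
  assumes h: "h \<in> borel_measurable lebesgue" "\<And>x. \<bar>h x\<bar> \<le> M" and K: "compact K" "K \<subseteq> U" "\<And>x. x \<notin> K \<Longrightarrow> h x = 0"
  shows "(\<lambda>n. LINT x|lebesgue_on K. gn n x * h x) \<longlonglongrightarrow> (LINT x|lebesgue_on K. g x * h x)"
proof (rule LIMSEQ_I)
  fix e :: real assume e: "e > 0"
  obtain S0 where S0: "compact S0" "S0 \<subseteq> U" "K \<subseteq> interior S0"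
  proof -
    obtain C where C: "\<And>n. compact (C n)" "\<And>n. C n \<subseteq> U" "\<And>n. C n \<subseteq> interior (C (Suc n))" "\<Union>(range C) = U"
      and CK: "\<And>K. \<lbrakk>compact K; K \<subseteq> U\<rbrakk> \<Longrightarrow> \<exists>N. \<forall>n\<ge>N. K \<subseteq> C n"
      using open_Union_compact_subsets[OF U] by metis
    obtain N where "K \<subseteq> C N" using CK[OF K(1,2)] by blast
    then show ?thesis using that[of "C (Suc N)"] C by blast
  qed
  let ?W = "interior S0"
  have W: "open ?W" "?W \<in> lmeasurable" "?W \<subseteq> U"
    using S0 interior_subset[of S0] lmeasurable_open[OF bounded_subset[OF compact_imp_bounded[OF S0(1)] interior_subset]] by auto
  have Ws: "?W \<in> sets lebesgue" using W by auto
  have Ks: "K \<in> sets lebesgue" using lmeasurable_compact[OF K(1)] by auto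
  have M: "0 \<le> M" using h(2)[of undefined] by linarith
  define \<delta> where "\<delta> = e / (3 * (C + 1))"
  have \<delta>: "\<delta> > 0" "C * \<delta> \<le> e / 3"
    using e C by (auto simp: \<delta>_def field_simps)
  have hW: "h \<in> borel_measurable (lebesgue_on ?W)" using h(1) by (rule measurable_restrict_space1)
  have hb: "- M \<le> h x" "h x \<le> M" for x using h(2)[of x] by auto
  obtain \<phi> D S where p: "C1_with_gradient \<phi> D" "compact S" "S \<subseteq> ?W" "\<And>x. x \<notin> S \<Longrightarrow> \<phi> x = 0"
    "\<And>x. - M \<le> \<phi> x" "\<And>x. \<phi> x \<le> M + 2" and small: "(LINT x|lebesgue_on ?W. \<bar>h x - \<phi> x\<bar>) < \<delta>"
    using C1_dense_L1[OF W(1,2) hW, of "- M" M \<delta>] hb M \<delta>(1) by auto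
  have Ss: "S \<in> sets lebesgue" using lmeasurable_compact[OF p(2)] by auto
  have \<phi>W: "\<phi> \<in> borel_measurable (lebesgue_on ?W)"
    by (rule continuous_imp_measurable_on_sets_lebesgue[OF C1_continuous[OF p(1)] Ws])
  have hi: "integrable (lebesgue_on ?W) (\<lambda>x. \<bar>h x - \<phi> x\<bar>)"
  proof (rule integrable_lebesgue_on_bounded[OF _ W(2)])
    show "AE x in lebesgue_on ?W. norm \<bar>h x - \<phi> x\<bar> \<le> 2 * M + 2"
    proof (rule AE_I2)
      fix x show "norm \<bar>h x - \<phi> x\<bar> \<le> 2 * M + 2" using hb[of x] p(5,6)[of x] by (simp add: abs_le_iff)
    qed
  qed (use hW \<phi>W in auto)
  have est: "\<bar>(LINT x|lebesgue_on K. q x * h x) - (LINT x|lebesgue_on S. q x * \<phi> x)\<bar> \<le> e / 3"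
    if q: "q \<in> borel_measurable (lebesgue_on ?W)" "AE x in lebesgue_on ?W. \<bar>q x\<bar> \<le> C" for q
  proof -
    have qi: "integrable (lebesgue_on ?W) q"
      by (rule integrable_lebesgue_on_bounded[OF q(1) W(2)]) (use q(2) in auto)
    have "(LINT x|lebesgue_on K. q x * h x) = (LINT x|lebesgue_on ?W. q x * h x)"
      by (rule integral_lebesgue_on_support[symmetric]) (use S0 Ks Ws K(3) in auto)
    moreover have "(LINT x|lebesgue_on S. q x * \<phi> x) = (LINT x|lebesgue_on ?W. q x * \<phi> x)"
      by (rule integral_lebesgue_on_support[symmetric]) (use p Ss Ws in auto)
    moreover have "(LINT x|lebesgue_on ?W. q x * h x) - (LINT x|lebesgue_on ?W. q x * \<phi> x) = (LINT x|lebesgue_on ?W. q x * (h x - \<phi> x))"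
    proof -
      have "integrable (lebesgue_on ?W) (\<lambda>x. q x * h x)"
        by (rule integrable_bounded_mult[OF qi hW]) (use h(2) in auto)
      moreover have "integrable (lebesgue_on ?W) (\<lambda>x. q x * \<phi> x)"
      proof (rule integrable_bounded_mult[OF qi \<phi>W])
        show "AE x in lebesgue_on ?W. \<bar>\<phi> x\<bar> \<le> M + 2"
        proof (rule AE_I2)
          fix x show "\<bar>\<phi> x\<bar> \<le> M + 2" using p(5,6)[of x] by (simp add: abs_le_iff)
        qed
      qed
      ultimately show ?thesis by (simp add: right_diff_distrib)
    qed
    moreover have "\<bar>LINT x|lebesgue_on ?W. q x * (h x - \<phi> x)\<bar> \<le> (LINT x|lebesgue_on ?W. C * \<bar>h x - \<phi> x\<bar>)"
    proof (rule abs_integral_le)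
      show "integrable (lebesgue_on ?W) (\<lambda>x. C * \<bar>h x - \<phi> x\<bar>)" using hi by (rule integrable_mult_right)
      show "AE x in lebesgue_on ?W. \<bar>q x * (h x - \<phi> x)\<bar> \<le> C * \<bar>h x - \<phi> x\<bar>"
        using q(2) by eventually_elim (auto simp: abs_mult intro!: mult_right_mono)
    qed
    moreover have "(LINT x|lebesgue_on ?W. C * \<bar>h x - \<phi> x\<bar>) \<le> C * \<delta>"
      using small C by (simp add: mult_left_mono)
    ultimately show ?thesis using \<delta>(2) by linarith
  qed
  have gm: "q \<in> borel_measurable (lebesgue_on ?W)" if "L1_loc X q" "open X" "?W \<subseteq> X" for q X
    using L1_loc_measurable[OF that(1,2)] that(3) by (rule measurable_lebesgue_on_subset)
  have gW: "\<bar>(LINT x|lebesgue_on K. g x * h x) - (LINT x|lebesgue_on S. g x * \<phi> x)\<bar> \<le> e / 3"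
  proof (rule est)
    show "g \<in> borel_measurable (lebesgue_on ?W)" using g U W(3) by (intro gm) (auto simp: has_weak_deriv_def)
    show "AE x in lebesgue_on ?W. \<bar>g x\<bar> \<le> C"
      by (rule AE_lebesgue_on_subset[OF weak_deriv_limit_bounded W(3) Ws]) (use U in auto)
  qed
  have lim: "(\<lambda>n. LINT x|lebesgue_on S. gn n x * \<phi> x) \<longlonglongrightarrow> (LINT x|lebesgue_on S. g x * \<phi> x)"
    by (rule weak_deriv_limit_tested[OF p(1,2)]) (use p W in auto)
  have "\<forall>\<^sub>F n in sequentially. dist (LINT x|lebesgue_on S. gn n x * \<phi> x) (LINT x|lebesgue_on S. g x * \<phi> x) < e / 3"
    by (rule tendstoD[OF lim]) (use e in simp)
  then have "\<forall>\<^sub>F n in sequentially. norm ((LINT x|lebesgue_on K. gn n x * h x) - (LINT x|lebesgue_on K. g x * h x)) < e"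
    using ev[OF S0(1,2)]
  proof eventually_elim
    case (elim n)
    have WV: "?W \<subseteq> V n" using elim(2) interior_subset by blast
    have "\<bar>(LINT x|lebesgue_on K. gn n x * h x) - (LINT x|lebesgue_on S. gn n x * \<phi> x)\<bar> \<le> e / 3"
    proof (rule est)
      show "gn n \<in> borel_measurable (lebesgue_on ?W)" using gn V WV by (intro gm) (auto simp: has_weak_deriv_def)
      show "AE x in lebesgue_on ?W. \<bar>gn n x\<bar> \<le> C"
        by (rule AE_lebesgue_on_subset[OF bd WV Ws]) (use V in auto)
    qed
    then show ?case using gW elim(1) unfolding real_norm_def dist_real_def by linarith
  qed
  then show "\<exists>no. \<forall>n\<ge>no. norm ((LINT x|lebesgue_on K. gn n x * h x) - (LINT x|lebesgue_on K. g x * h x)) < e"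
    by (simp add: eventually_sequentially)
qed

end

section \<open>The flux of a limit solution\<close>

lemma e_z_Basis [simp]: "e_z \<in> Basis"
  by (simp add: Basis_prod_def)

lemma open_Omega: "open (Omega L)"
  unfolding Omega_def by (intro open_Times) auto

lemma Omega_sets [simp]: "Omega L \<in> sets lebesgue"
  using open_Omega by simp

lemma strip_subset_Omega: "0 \<le> a \<Longrightarrow> b \<le> L \<Longrightarrow> 0 \<le> c \<Longrightarrow> {a<..<b} \<times> {c<..<d} \<subseteq> Omega L"
  by (auto simp: Omega_def)

lemma above_strip: "x \<in> Omega L - {0<..<L} \<times> {0<..<T} \<Longrightarrow> T \<le> snd x"
  by (cases x) (auto simp: Omega_def not_less)

lemma rectangle_sets [simp]: "({a<..<b} \<times> {c<..<d} :: (real \<times> real) set) \<in> sets lebesgue"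
  using rectangle_measurable by auto

lemma compact_eventually_below:
  assumes "filterlim Hn at_top sequentially" "compact K" "K \<subseteq> Omega L"
  shows "\<forall>\<^sub>F n in sequentially. K \<subseteq> Omega_H L (Hn n)"
proof -
  obtain T where T: "\<And>x. x \<in> K \<Longrightarrow> norm x \<le> T" using compact_imp_bounded[OF assms(2)] by (auto simp: bounded_iff)
  have "\<forall>\<^sub>F n in sequentially. T < Hn n" using assms(1) unfolding filterlim_at_top_dense by blast
  then show ?thesis
  proof eventually_elim
    case (elim n)
    show ?case
    proof
      fix x assume x: "x \<in> K"
      have "snd x \<le> norm x" using norm_snd_le[of "snd x" "fst x"] by simp
      then have "snd x < Hn n" using T[OF x] elim by linarith
      moreover have "x \<in> Omega L" using x assms(3) by blast
      ultimately show "x \<in> Omega_H L (Hn n)" by (cases x) (auto simp: Omega_def Omega_H_def)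
    qed
  qed
qed

lemma test_with_trace_C1:
  assumes \<phi>: "C1_with_gradient \<phi> D" and T: "\<And>x. x \<in> Omega L \<Longrightarrow> T \<le> snd x \<Longrightarrow> \<phi> x = 0 \<and> D x = 0"
    and a: "\<And>y. \<phi> (y, 0) = a"
  shows "test_with_trace L (\<lambda>_. a) \<phi>"
  unfolding test_with_trace_def
proof (intro conjI allI impI)
  show "in_H1 (Omega L) \<phi>"
  proof (rule in_H1_C1[OF open_Omega \<phi>, of "{0<..<L} \<times> {0<..<T}"])
    show "bounded ({0<..<L} \<times> {0<..<T})" by (intro bounded_Times) auto
    show "\<phi> x = 0" "D x = 0" if "x \<in> Omega L - {0<..<L} \<times> {0<..<T}" for x
      using T[of x] above_strip[OF that] that by auto
  qed (auto simp: Omega_def)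
  show "\<exists>R. AE x in lebesgue_on (Omega L). R < snd x \<longrightarrow> \<phi> x = 0"
    by (intro exI[of _ T] AE_I2) (use T in auto)
  show "has_trace {0<..<L} {0<..<R} 0 \<phi> (\<lambda>_. a)" for R
    using has_trace_C1[OF \<phi>, of 0 L 0 R 0] by (simp add: a)
qed

lemma test_with_trace_diff:
  assumes "test_with_trace L \<psi> \<phi>" "test_with_trace L \<omega> \<phi>2"
  shows "test_with_trace L (\<lambda>y. \<psi> y - \<omega> y) (\<lambda>x. \<phi> x - \<phi>2 x)"
  unfolding test_with_trace_def
proof (intro conjI allI impI)
  show "in_H1 (Omega L) (\<lambda>x. \<phi> x - \<phi>2 x)"
    using assms by (intro in_H1_diff open_Omega) (auto simp: test_with_trace_def)
  obtain R1 R2 where "AE x in lebesgue_on (Omega L). R1 < snd x \<longrightarrow> \<phi> x = 0"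
    "AE x in lebesgue_on (Omega L). R2 < snd x \<longrightarrow> \<phi>2 x = 0"
    using assms by (auto simp: test_with_trace_def)
  then have "AE x in lebesgue_on (Omega L). max R1 R2 < snd x \<longrightarrow> \<phi> x - \<phi>2 x = 0"
    by eventually_elim auto
  then show "\<exists>R. AE x in lebesgue_on (Omega L). R < snd x \<longrightarrow> \<phi> x - \<phi>2 x = 0" by blast
  show "has_trace {0<..<L} {0<..<R} 0 (\<lambda>x. \<phi> x - \<phi>2 x) (\<lambda>y. \<psi> y - \<omega> y)" if "0 < R" for R
    using assms that by (intro has_trace_diff) (auto simp: test_with_trace_def)
qed

text \<open>A test function vanishes only almost everywhere above some height; by uniqueness of weak derivatives on the open set above that height
  the same holds for its weak gradient. Hence its pairing with a bounded field is integrable, although the strip has infinite measure.\<close>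

lemma test_gradient_support:
  assumes "test_with_trace L \<psi> \<phi>"
  obtains R where "R \<ge> 0" "AE x in lebesgue_on (Omega L). R < snd x \<longrightarrow> weak_gradient (Omega L) \<phi> x = 0"
proof -
  obtain R0 where R0: "AE x in lebesgue_on (Omega L). R0 < snd x \<longrightarrow> \<phi> x = 0"
    using assms by (auto simp: test_with_trace_def)
  define R where "R = max 0 R0"
  let ?W = "{0<..<L} \<times> {R<..} :: (real \<times> real) set"
  have W: "open ?W" "?W \<subseteq> Omega L"
    by (auto simp: Omega_def R_def intro!: open_Times)
  have wd: "weakly_differentiable (Omega L) \<phi>" using assms by (simp add: test_with_trace_def in_H1_def)
  have z: "AE x in lebesgue_on ?W. \<phi> x = 0"
  proof -
    have "AE x in lebesgue_on ?W. R0 < snd x \<longrightarrow> \<phi> x = 0"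
      by (rule AE_lebesgue_on_subset[OF R0 W(2)]) (use W in auto)
    then show ?thesis by (rule lebesgue_on_mono) (auto simp: R_def)
  qed
  have "AE x in lebesgue_on ?W. \<forall>b\<in>Basis. weak_deriv (Omega L) b \<phi> x = 0"
  proof (rule AE_Basis)
    fix b :: "real \<times> real" assume b: "b \<in> Basis"
    have 1: "has_weak_deriv ?W b \<phi> (weak_deriv (Omega L) b \<phi>)"
      by (rule has_weak_deriv_subset[OF weakly_differentiable_weak_deriv[OF wd b] W(2,1) open_Omega])
    then have "L1_loc ?W \<phi>" by (simp add: has_weak_deriv_def)
    from has_weak_deriv_unique[OF W(1) 1 has_weak_deriv_AE_zero[OF W(1) this z]]
    show "AE x in lebesgue_on ?W. weak_deriv (Omega L) b \<phi> x = 0" .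
  qed
  then have "AE x in lebesgue_on ?W. weak_gradient (Omega L) \<phi> x = 0"
    by eventually_elim (simp add: weak_gradient_def)
  then have "AE x in lebesgue. x \<in> ?W \<longrightarrow> weak_gradient (Omega L) \<phi> x = 0"
    using W(1) by (simp add: AE_restrict_space_iff)
  moreover have "x \<in> ?W" if "x \<in> Omega L" "R < snd x" for x
    using that by (auto simp: Omega_def)
  ultimately have "AE x in lebesgue. x \<in> Omega L \<longrightarrow> R < snd x \<longrightarrow> weak_gradient (Omega L) \<phi> x = 0"
    by (auto elim!: eventually_mono)
  then have "AE x in lebesgue_on (Omega L). R < snd x \<longrightarrow> weak_gradient (Omega L) \<phi> x = 0"
    by (simp add: AE_restrict_space_iff)
  then show ?thesis using that[of R] by (simp add: R_def)
qed

text \<open>A limit solution for one speed \<open>c\<close>, detached from the approximating sequence: of the latter only the bounds \<open>p_bar\<close> on \<open>p\<close> and \<open>C_P\<close> on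
  the partial derivatives of \<open>p\<close> are retained.\<close>

locale limit_wave =
  fixes g L \<tau> c s_star :: real and k pc s0 p0 :: "real \<Rightarrow> real"
    and s p :: "real \<times> real \<Rightarrow> real" and C_P p_bar :: real
  assumes pos: "0 < g" "0 < L" "0 < \<tau>" "0 < c" "0 \<le> C_P"
    and s_star: "0 < s_star" "s_star < 1"
    and k_cont: "continuous_on {0..1} k" and k_nonneg: "\<And>x. x \<in> {0..1} \<Longrightarrow> 0 \<le> k x"
    and k_mono: "\<And>x y. 0 \<le> x \<Longrightarrow> x \<le> y \<Longrightarrow> y \<le> 1 \<Longrightarrow> k x \<le> k y"
    and pc_star: "pc s_star = 0" and pc_mono: "\<And>x y. 0 < x \<Longrightarrow> x < y \<Longrightarrow> y < 1 \<Longrightarrow> pc x < pc y"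
    and pc_unbounded: "\<And>M. \<exists>x\<in>{0<..<1}. M \<le> pc x"
    and s0_cont: "continuous_on {0<..<L} s0"
    and s0_range: "\<And>y. y \<in> {0<..<L} \<Longrightarrow> s0 y < 1"
    and s0_ge: "\<And>y. y \<in> {0<..<L} \<Longrightarrow> s_star \<le> s0 y"
    and p0_gt: "\<And>y. y \<in> {0<..<L} \<Longrightarrow> pc (s0 y) < p0 y"
    and s_cont: "continuous_on (Omega L) s" and s_range: "\<And>x. x \<in> Omega L \<Longrightarrow> s x \<in> {0..1}"
    and s_wd: "\<exists>s'. has_weak_deriv (Omega L) e_z s s'" and s_L2: "L2_on (Omega L) (weak_deriv (Omega L) e_z s)"
    and p_wd: "weakly_differentiable (Omega L) p"
    and p_grad: "\<And>b. b \<in> Basis \<Longrightarrow> AE x in lebesgue_on (Omega L). \<bar>weak_deriv (Omega L) b p x\<bar> \<le> C_P"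
    and p_le: "AE x in lebesgue_on (Omega L). p x \<le> p_bar"
    and s_trace: "\<And>a b R. 0 < a \<Longrightarrow> a < b \<Longrightarrow> b < L \<Longrightarrow> 0 < R \<Longrightarrow> has_trace {a<..<b} {0<..<R} 0 s s0"
    and p_trace: "\<And>a b R. 0 < a \<Longrightarrow> a < b \<Longrightarrow> b < L \<Longrightarrow> 0 < R \<Longrightarrow> has_trace {a<..<b} {0<..<R} 0 p p0"
    and weak_eq: "\<And>\<phi>. test_with_trace L (\<lambda>_. 0) \<phi> \<Longrightarrow>
          (LINT x|lebesgue_on (Omega L). c * weak_deriv (Omega L) e_z s x * \<phi> x)
          + (LINT x|lebesgue_on (Omega L). flux_field g k (Omega L) s p x \<bullet> weak_gradient (Omega L) \<phi> x) = 0"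
    and capillary: "capillary_eq pc (Omega L) c \<tau> s p"
begin

abbreviation "U \<equiv> Omega L"
abbreviation "s_z \<equiv> weak_deriv U e_z s"
abbreviation "p_z \<equiv> weak_deriv U e_z p"
abbreviation "q \<equiv> flux_field g k U s p"

lemma s_weak_deriv: "has_weak_deriv U e_z s s_z"
  by (rule has_weak_deriv_weak_deriv[OF s_wd])

lemma p_weak_deriv: "has_weak_deriv U e_z p p_z"
  by (rule weakly_differentiable_weak_deriv[OF p_wd e_z_Basis])

lemma s_z_nonneg: "AE x in lebesgue_on U. 0 \<le> s_z x"
  using capillary unfolding capillary_eq_def
proof eventually_elim
  case (elim x)
  have "0 \<le> ereal (c * \<tau> * s_z x)" unfolding elim by simp
  then have "0 \<le> c * \<tau> * s_z x" by simp
  then show ?case using mult_pos_pos[OF pos(4,3)] by (auto simp: zero_le_mult_iff)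
qed

lemma s_mono:
  assumes "y \<in> {0<..<L}" "0 < z1" "z1 \<le> z2"
  shows "s (y, z1) \<le> s (y, z2)"
proof -
  let ?V = "{0<..<L} \<times> {0<..<z2 + 1}"
  have V: "?V \<subseteq> U" by (rule strip_subset_Omega) auto
  show ?thesis
  proof (rule mono_if_weak_deriv_nonneg[of 0 L 0 "z2 + 1"])
    show "continuous_on ?V s" using s_cont V continuous_on_subset by blast
    show "has_weak_deriv ?V e_z s s_z"
      by (rule has_weak_deriv_subset[OF s_weak_deriv V open_rectangle open_Omega])
    show "AE x in lebesgue_on ?V. 0 \<le> s_z x"
      by (rule AE_lebesgue_on_subset[OF s_z_nonneg V]) auto
  qed (use assms in auto)
qed

lemma ks_bounds: "x \<in> U \<Longrightarrow> 0 \<le> k (s x)" "x \<in> U \<Longrightarrow> k (s x) \<le> k 1"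
  using s_range[of x] by (auto intro: k_nonneg k_mono)

lemma k1_nonneg: "0 \<le> k 1"
  by (simp add: k_nonneg)

lemma ks_cont: "continuous_on U (\<lambda>x. k (s x))"
  by (rule continuous_on_compose2[OF k_cont s_cont]) (use s_range in auto)

lemma ks_measurable: "(\<lambda>x. k (s x)) \<in> borel_measurable (lebesgue_on U)"
  by (rule continuous_imp_measurable_on_sets_lebesgue[OF ks_cont]) simp

lemma s_measurable: "s \<in> borel_measurable (lebesgue_on U)"
  by (rule continuous_imp_measurable_on_sets_lebesgue[OF s_cont]) simp

lemma p_z_measurable: "p_z \<in> borel_measurable (lebesgue_on U)"
  using p_weak_deriv by (intro L1_loc_measurable open_Omega) (auto simp: has_weak_deriv_def)

definition M_q :: real where "M_q = k 1 * (2 * C_P + g)"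

lemma q_measurable: "q \<in> borel_measurable (lebesgue_on U)"
  unfolding flux_field_def[abs_def]
  by (intro borel_measurable_scaleR borel_measurable_add borel_measurable_const ks_measurable
      weak_gradient_measurable[OF open_Omega p_wd])

lemma q_bounded: "AE x in lebesgue_on U. norm (q x) \<le> M_q"
proof -
  have "AE x in lebesgue_on U. \<forall>b\<in>Basis. \<bar>weak_deriv U b p x\<bar> \<le> C_P"
    by (rule AE_Basis[OF p_grad])
  moreover have "AE x in lebesgue_on U. x \<in> U" by (rule AE_I2) simp
  ultimately show ?thesis
  proof eventually_elim
    case (elim x)
    have "norm (weak_gradient U p x) \<le> (\<Sum>b\<in>Basis. \<bar>weak_gradient U p x \<bullet> b\<bar>)" by (rule norm_le_l1)
    also have "\<dots> \<le> (\<Sum>b\<in>(Basis :: (real \<times> real) set). C_P)"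
      using elim(1) by (intro sum_mono) (simp add: weak_gradient_inner_Basis)
    also have "\<dots> = 2 * C_P" by simp
    finally have "norm (weak_gradient U p x + g *\<^sub>R e_z) \<le> 2 * C_P + g"
      using norm_triangle_ineq[of "weak_gradient U p x" "g *\<^sub>R e_z"] pos(1) by (simp add: norm_Pair)
    then have "\<bar>k (s x)\<bar> * norm (weak_gradient U p x + g *\<^sub>R e_z) \<le> k 1 * (2 * C_P + g)"
      using ks_bounds[OF elim(2)] by (intro mult_mono) auto
    then show ?case by (simp only: flux_field_def norm_scaleR M_q_def)
  qed
qed

lemma q_vertical: "q x \<bullet> e_z = k (s x) * (p_z x + g)"
  by (simp add: flux_field_def inner_add_left weak_gradient_inner_Basis)

definition flux_density :: "real \<times> real \<Rightarrow> real" where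
  "flux_density x = k (s x) * (p_z x + g) - c * s x"

lemma flux_density_measurable: "flux_density \<in> borel_measurable (lebesgue_on U)"
  unfolding flux_density_def[abs_def]
  by (intro borel_measurable_diff borel_measurable_times borel_measurable_add borel_measurable_const
      ks_measurable s_measurable p_z_measurable)

definition M_d :: real where "M_d = k 1 * (C_P + g) + c"

lemma flux_density_bounded: "AE x in lebesgue_on U. \<bar>flux_density x\<bar> \<le> M_d"
proof -
  have "AE x in lebesgue_on U. x \<in> U" by (rule AE_I2) simp
  with p_grad[OF e_z_Basis] show ?thesis
  proof eventually_elim
    case (elim x)
    have "\<bar>k (s x) * (p_z x + g)\<bar> \<le> k 1 * (C_P + g)"
      unfolding abs_mult using elim(1) ks_bounds[OF elim(2)] pos by (intro mult_mono) auto
    moreover have "\<bar>c * s x\<bar> \<le> c" using s_range[OF elim(2)] pos(4) by (auto simp: abs_mult mult_left_le)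
    ultimately show ?case unfolding flux_density_def M_d_def by linarith
  qed
qed

lemma test_integrable:
  assumes \<phi>: "test_with_trace L \<psi> \<phi>"
  shows "integrable (lebesgue_on U) (\<lambda>x. q x \<bullet> weak_gradient U \<phi> x)"
    and "integrable (lebesgue_on U) (\<lambda>x. c * s_z x * \<phi> x)"
proof -
  have wd: "weakly_differentiable U \<phi>" and L2: "L2_on U \<phi>" and L2g: "L2_on U (weak_gradient U \<phi>)"
    using \<phi> by (auto simp: test_with_trace_def in_H1_def)
  show "integrable (lebesgue_on U) (\<lambda>x. c * s_z x * \<phi> x)"
    using L2_on_mult_integrable[OF L2_on_cmult[OF s_L2, of c] L2] .
  have mg: "weak_gradient U \<phi> \<in> borel_measurable (lebesgue_on U)"
    by (rule weak_gradient_measurable[OF open_Omega wd])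
  have mqg: "(\<lambda>x. q x \<bullet> weak_gradient U \<phi> x) \<in> borel_measurable (lebesgue_on U)"
    by (intro borel_measurable_inner q_measurable mg)
  obtain R where R: "R \<ge> 0" "AE x in lebesgue_on U. R < snd x \<longrightarrow> weak_gradient U \<phi> x = 0"
    using test_gradient_support[OF \<phi>] .
  let ?B = "{0<..<L} \<times> {0<..<R + 1}"
  have B: "?B \<subseteq> U" by (rule strip_subset_Omega) auto
  have nB: "L2_on ?B (\<lambda>x. norm (weak_gradient U \<phi> x))"
    using L2_on_subset[OF L2g B] by (auto simp: L2_on_def)
  have iB: "integrable (lebesgue_on ?B) (\<lambda>x. M_q * norm (weak_gradient U \<phi> x))"
    by (intro integrable_mult_right L2_on_integrable[OF nB rectangle_measurable])
  have i1: "integrable (lebesgue_on ?B) (\<lambda>x. q x \<bullet> weak_gradient U \<phi> x)"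
  proof (rule Bochner_Integration.integrable_bound[OF iB])
    show "(\<lambda>x. q x \<bullet> weak_gradient U \<phi> x) \<in> borel_measurable (lebesgue_on ?B)"
      by (rule measurable_lebesgue_on_subset[OF mqg B])
    have "AE x in lebesgue_on ?B. norm (q x) \<le> M_q"
      by (rule AE_lebesgue_on_subset[OF q_bounded B]) auto
    then show "AE x in lebesgue_on ?B. norm (q x \<bullet> weak_gradient U \<phi> x) \<le> norm (M_q * norm (weak_gradient U \<phi> x))"
    proof eventually_elim
      case (elim x)
      have "\<bar>q x \<bullet> weak_gradient U \<phi> x\<bar> \<le> norm (q x) * norm (weak_gradient U \<phi> x)"
        by (rule Cauchy_Schwarz_ineq2)
      also have "\<dots> \<le> M_q * norm (weak_gradient U \<phi> x)" using elim by (intro mult_right_mono) auto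
      finally show ?case by simp
    qed
  qed
  let ?f = "\<lambda>x. if x \<in> ?B then q x \<bullet> weak_gradient U \<phi> x else 0"
  have "integrable (lebesgue_on ?B) ?f \<longleftrightarrow> integrable (lebesgue_on ?B) (\<lambda>x. q x \<bullet> weak_gradient U \<phi> x)"
    by (rule Bochner_Integration.integrable_cong) auto
  then have "integrable (lebesgue_on ?B) ?f" using i1 by blast
  then have i2: "integrable (lebesgue_on U) ?f"
    by (subst integrable_lebesgue_on_support[OF B]) auto
  show "integrable (lebesgue_on U) (\<lambda>x. q x \<bullet> weak_gradient U \<phi> x)"
  proof (rule integrable_cong_AE_imp[OF i2 mqg])
    have "AE x in lebesgue_on U. x \<in> U" by (rule AE_I2) simp
    with R(2) show "AE x in lebesgue_on U. ?f x = q x \<bullet> weak_gradient U \<phi> x"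
      by eventually_elim (auto simp: Omega_def)
  qed
qed

lemma test_C1_pairing:
  assumes C1: "C1_with_gradient \<phi> D" and \<phi>: "test_with_trace L \<psi> \<phi>"
  shows "(LINT x|lebesgue_on U. q x \<bullet> weak_gradient U \<phi> x) = (LINT x|lebesgue_on U. q x \<bullet> D x)"
proof (rule integral_cong_AE)
  have "weakly_differentiable U \<phi>" using \<phi> by (auto simp: test_with_trace_def in_H1_def)
  then show "(\<lambda>x. q x \<bullet> weak_gradient U \<phi> x) \<in> borel_measurable (lebesgue_on U)"
    by (intro borel_measurable_inner q_measurable weak_gradient_measurable[OF open_Omega])
  show "(\<lambda>x. q x \<bullet> D x) \<in> borel_measurable (lebesgue_on U)"
    by (intro borel_measurable_inner q_measurable continuous_imp_measurable_on_sets_lebesgue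
        C1_gradient_continuous[OF C1]) simp
  show "AE x in lebesgue_on U. q x \<bullet> weak_gradient U \<phi> x = q x \<bullet> D x"
    using weak_gradient_C1[OF open_Omega C1] by eventually_elim simp
qed

lemma q_divergence: "has_weak_divergence U q (\<lambda>x. c * s_z x)"
  unfolding has_weak_divergence_def
proof (intro conjI allI impI)
  show "L1_loc U q"
  proof (rule L1_locI)
    fix K assume K: "compact K" "K \<subseteq> U"
    have Kl: "K \<in> lmeasurable" by (rule lmeasurable_compact[OF K(1)])
    show "integrable (lebesgue_on K) q"
      by (rule integrable_lebesgue_on_bounded[OF measurable_lebesgue_on_subset[OF q_measurable K(2)] Kl
            AE_lebesgue_on_subset[OF q_bounded K(2)]]) (use Kl in auto)
  qed
  show "L1_loc U (\<lambda>x. c * s_z x)"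
    by (rule L2_on_imp_L1_loc[OF L2_on_cmult[OF s_L2]]) simp
  fix \<phi> D assume "C1_with_gradient \<phi> D \<and> compactly_supported_in U \<phi>"
  then obtain K where C1: "C1_with_gradient \<phi> D" and K: "compact K" "K \<subseteq> U" "\<And>x. x \<notin> K \<Longrightarrow> \<phi> x = 0"
    by (auto simp: compactly_supported_in_def)
  obtain T where T: "\<And>x. x \<in> K \<Longrightarrow> norm x \<le> T" using compact_imp_bounded[OF K(1)] by (auto simp: bounded_iff)
  have \<phi>: "test_with_trace L (\<lambda>_. 0) \<phi>"
  proof (rule test_with_trace_C1[OF C1, of L "T + 1"])
    fix x :: "real \<times> real" assume "x \<in> Omega L" "T + 1 \<le> snd x"
    moreover have "\<bar>snd x\<bar> \<le> norm x" using norm_snd_le[of "snd x" "fst x"] by simp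
    ultimately have "x \<notin> K" using T[of x] by force
    then show "\<phi> x = 0 \<and> D x = 0"
      using K(3) C1_gradient_zero_off_compact[OF C1 K(1,3)] by blast
  next
    fix y :: real
    have "(y, 0) \<notin> K" using K(2) by (auto simp: Omega_def)
    then show "\<phi> (y, 0) = 0" by (rule K(3))
  qed
  show "(LINT x|lebesgue_on U. q x \<bullet> D x) = - (LINT x|lebesgue_on U. c * s_z x * \<phi> x)"
    using weak_eq[OF \<phi>] test_C1_pairing[OF C1 \<phi>] by linarith
qed

text \<open>By the weak equation the Gauss functional takes the same value for all test functions with the same
  trace, and the divergence is unique; hence the pairing may be computed with any one test function.\<close>

lemma normal_trace_pairing_eq:
  assumes \<phi>: "test_with_trace L \<psi> \<phi>"
  shows "normal_trace_pairing L q \<psi>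
    = - ((LINT x|lebesgue_on U. q x \<bullet> weak_gradient U \<phi> x) + (LINT x|lebesgue_on U. c * s_z x * \<phi> x))"
    (is "_ = - ?J \<phi>")
  unfolding normal_trace_pairing_def
proof (rule the_equality)
  have J: "(LINT x|lebesgue_on U. q x \<bullet> weak_gradient U \<phi>2 x + c * s_z x * \<phi>2 x) = ?J \<phi>2"
    if "test_with_trace L \<psi> \<phi>2" for \<phi>2
    using test_integrable[OF that] by simp
  have same: "?J \<phi>2 = ?J \<phi>" if \<phi>2: "test_with_trace L \<psi> \<phi>2" for \<phi>2
  proof -
    have \<theta>: "test_with_trace L (\<lambda>_. 0) (\<lambda>x. \<phi>2 x - \<phi> x)" using test_with_trace_diff[OF \<phi>2 \<phi>] by simp
    have "(LINT x|lebesgue_on U. q x \<bullet> weak_gradient U (\<lambda>x. \<phi>2 x - \<phi> x) x)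
        = (LINT x|lebesgue_on U. q x \<bullet> weak_gradient U \<phi>2 x - q x \<bullet> weak_gradient U \<phi> x)"
    proof (rule integral_cong_AE)
      have wd: "weakly_differentiable U \<phi>2" "weakly_differentiable U \<phi>"
        using \<phi> \<phi>2 by (auto simp: test_with_trace_def in_H1_def)
      show "AE x in lebesgue_on U. q x \<bullet> weak_gradient U (\<lambda>x. \<phi>2 x - \<phi> x) x
          = q x \<bullet> weak_gradient U \<phi>2 x - q x \<bullet> weak_gradient U \<phi> x"
        using weak_gradient_diff[OF open_Omega wd] by eventually_elim (simp add: inner_diff_right)
    qed (use test_integrable(1)[OF \<theta>] test_integrable(1)[OF \<phi>] test_integrable(1)[OF \<phi>2] in auto)
    also have "\<dots> = (LINT x|lebesgue_on U. q x \<bullet> weak_gradient U \<phi>2 x) - (LINT x|lebesgue_on U. q x \<bullet> weak_gradient U \<phi> x)"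
      by (rule Bochner_Integration.integral_diff[OF test_integrable(1)[OF \<phi>2] test_integrable(1)[OF \<phi>]])
    finally have 1: "(LINT x|lebesgue_on U. q x \<bullet> weak_gradient U (\<lambda>x. \<phi>2 x - \<phi> x) x)
        = (LINT x|lebesgue_on U. q x \<bullet> weak_gradient U \<phi>2 x) - (LINT x|lebesgue_on U. q x \<bullet> weak_gradient U \<phi> x)" .
    have 2: "(LINT x|lebesgue_on U. c * s_z x * (\<phi>2 x - \<phi> x))
        = (LINT x|lebesgue_on U. c * s_z x * \<phi>2 x) - (LINT x|lebesgue_on U. c * s_z x * \<phi> x)"
      unfolding right_diff_distrib
      by (rule Bochner_Integration.integral_diff[OF test_integrable(2)[OF \<phi>2] test_integrable(2)[OF \<phi>]])
    show ?thesis using weak_eq[OF \<theta>] unfolding 1 2 by linarith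
  qed
  show "\<exists>d. has_weak_divergence U q d \<and> (\<forall>\<phi>2. test_with_trace L \<psi> \<phi>2 \<longrightarrow>
      (LINT x|lebesgue_on U. q x \<bullet> weak_gradient U \<phi>2 x + d x * \<phi>2 x) = - (- ?J \<phi>))"
    using q_divergence J same by (intro exI[of _ "\<lambda>x. c * s_z x"]) auto
  fix Q assume "\<exists>d. has_weak_divergence U q d \<and> (\<forall>\<phi>2. test_with_trace L \<psi> \<phi>2 \<longrightarrow>
      (LINT x|lebesgue_on U. q x \<bullet> weak_gradient U \<phi>2 x + d x * \<phi>2 x) = - Q)"
  then obtain d where d: "has_weak_divergence U q d"
    and Q: "(LINT x|lebesgue_on U. q x \<bullet> weak_gradient U \<phi> x + d x * \<phi> x) = - Q" using \<phi> by blast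
  have dL: "L1_loc U d" using d by (simp add: has_weak_divergence_def)
  have eL: "L1_loc U (\<lambda>x. c * s_z x)" using q_divergence by (simp add: has_weak_divergence_def)
  have "AE x in lebesgue_on U. d x - c * s_z x = 0"
  proof (rule AE_zero_if_tested_zero[OF open_Omega L1_loc_diff[OF dL eL]])
    fix \<theta> D assume t: "C1_with_gradient \<theta> D" "compactly_supported_in U \<theta>"
    then obtain K where K: "compact K" "K \<subseteq> U" "\<And>x. x \<notin> K \<Longrightarrow> \<theta> x = 0"
      by (auto simp: compactly_supported_in_def)
    have "(LINT x|lebesgue_on U. q x \<bullet> D x) = - (LINT x|lebesgue_on U. d x * \<theta> x)"
      "(LINT x|lebesgue_on U. q x \<bullet> D x) = - (LINT x|lebesgue_on U. c * s_z x * \<theta> x)"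
      using d q_divergence t unfolding has_weak_divergence_def by blast+
    then show "(LINT x|lebesgue_on U. (d x - c * s_z x) * \<theta> x) = 0"
      using L1_loc_mult_integrable[OF dL K(1,2) open_Omega C1_continuous[OF t(1)] K(3)]
        L1_loc_mult_integrable[OF eL K(1,2) open_Omega C1_continuous[OF t(1)] K(3)]
      by (simp add: left_diff_distrib)
  qed
  then have de: "AE x in lebesgue_on U. d x = c * s_z x" by eventually_elim simp
  have "(LINT x|lebesgue_on U. q x \<bullet> weak_gradient U \<phi> x + d x * \<phi> x)
      = (LINT x|lebesgue_on U. q x \<bullet> weak_gradient U \<phi> x + c * s_z x * \<phi> x)"
  proof (rule integral_cong_AE)
    have "\<phi> \<in> borel_measurable (lebesgue_on U)" using \<phi> by (auto simp: test_with_trace_def in_H1_def L2_on_def)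
    then show "(\<lambda>x. q x \<bullet> weak_gradient U \<phi> x + d x * \<phi> x) \<in> borel_measurable (lebesgue_on U)"
      using test_integrable(1)[OF \<phi>] L1_loc_measurable[OF dL open_Omega] by auto
    show "(\<lambda>x. q x \<bullet> weak_gradient U \<phi> x + c * s_z x * \<phi> x) \<in> borel_measurable (lebesgue_on U)"
      using test_integrable[OF \<phi>] by auto
    show "AE x in lebesgue_on U. q x \<bullet> weak_gradient U \<phi> x + d x * \<phi> x = q x \<bullet> weak_gradient U \<phi> x + c * s_z x * \<phi> x"
      using de by eventually_elim simp
  qed
  then show "Q = - ?J \<phi>" using Q J[OF \<phi>] by linarith
qed

lemma inner_interval_exhaustion:
  fixes y :: real
  assumes "y \<in> {0<..<L}"
  shows "\<forall>\<^sub>F n in sequentially. L / real (n + 3) < y \<and> y < L - L / real (n + 3)"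
proof -
  have "(\<lambda>n. L * inverse (real (n + 3))) \<longlonglongrightarrow> L * 0"
    by (intro tendsto_intros LIMSEQ_ignore_initial_segment[OF lim_inverse_n])
  then have lim: "(\<lambda>n. L / real (n + 3)) \<longlonglongrightarrow> 0" by (simp add: divide_inverse)
  have "\<forall>\<^sub>F n in sequentially. L / real (n + 3) < y" "\<forall>\<^sub>F n in sequentially. L / real (n + 3) < L - y"
    using order_tendstoD(2)[OF lim, of y] order_tendstoD(2)[OF lim, of "L - y"] assms by simp_all
  then show ?thesis by eventually_elim auto
qed

lemma inner_interval: "0 < L / real (n + 3)" "L / real (n + 3) < L - L / real (n + 3)" "L - L / real (n + 3) < L"
proof -
  show 1: "0 < L / real (n + 3)" using pos(2) by simp
  then show "L - L / real (n + 3) < L" by simp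
  have "L / real (n + 3) < L / 2" using pos(2) by (intro divide_strict_left_mono) auto
  then show "L / real (n + 3) < L - L / real (n + 3)" by linarith
qed

lemma s0_integrable: "integrable (lebesgue_on {0<..<L}) s0"
proof (rule integrable_lebesgue_on_bounded[where C = 1])
  show "s0 \<in> borel_measurable (lebesgue_on {0<..<L})"
    by (rule continuous_imp_measurable_on_sets_lebesgue[OF s0_cont]) simp
  show "AE x in lebesgue_on {0<..<L}. norm (s0 x) \<le> 1"
  proof (rule AE_I2)
    fix y assume "y \<in> space (lebesgue_on {0<..<L})"
    then show "norm (s0 y) \<le> 1" using s0_ge[of y] s0_range[of y] s_star by auto
  qed
qed simp

text \<open>The pairing is computed with a function of the height whose derivative is a multiple of the plateau weight. The Gauss formula for the saturation, on
  rectangles exhausting the strip, turns the divergence term into an average of \<open>s\<close> and a boundary term that cancels \<open>c \<integral> s\<^sub>0\<close>.\<close>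

lemma bottom_flux_average:
  assumes Z: "0 < Z" and R: "0 < R"
  shows "bottom_flux g L k c s0 s p * R = (LINT x|lebesgue_on ({0<..<L} \<times> {0<..<Z + R + 1}). flux_density x * plateau Z R (snd x))"
proof -
  let ?T = "Z + R + 1"
  let ?B = "{0<..<L} \<times> {0<..<?T}"
  let ?I = "{0<..<L}"
  have R0: "0 \<le> R" using R by simp
  have B: "?B \<subseteq> U" by (rule strip_subset_Omega) auto
  \<comment> \<open>A test function with trace \<open>1\<close> on the bottom whose vertical derivative is, up to the sign, the normalised plateau weight.\<close>
  define \<eta> where "\<eta> = (\<lambda>z. 1 - plateau_integral Z R z / R)"
  define \<eta>' where "\<eta>' = (\<lambda>z. - plateau Z R z / R)"
  have d\<eta>: "(\<eta> has_real_derivative \<eta>' t) (at t)" for t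
    unfolding \<eta>_def \<eta>'_def using R
    by (auto intro!: derivative_eq_intros plateau_integral_has_derivative)
  have c\<eta>': "continuous_on UNIV \<eta>'"
    unfolding \<eta>'_def using R by (intro continuous_intros continuous_on_plateau) auto
  have \<eta>T: "\<eta> z = 0" "\<eta>' z = 0" if "?T \<le> z" for z
    using that R plateau_integral_eq[OF R0] plateau_zero[OF R0] by (auto simp: \<eta>_def \<eta>'_def)
  have \<eta>0: "\<eta> 0 = 1" using Z plateau_integral_zero[OF R0] by (simp add: \<eta>_def)
  let ?\<phi> = "\<lambda>x::real \<times> real. \<eta> (snd x)" and ?D = "\<lambda>x::real \<times> real. (0::real, \<eta>' (snd x))"
  have C1: "C1_with_gradient ?\<phi> ?D" by (rule C1_snd[OF d\<eta> c\<eta>'])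
  have \<phi>: "test_with_trace L (\<lambda>_. 1) ?\<phi>"
    by (rule test_with_trace_C1[OF C1, of L ?T]) (use \<eta>T \<eta>0 in \<open>auto simp: zero_prod_def\<close>)
  have c\<phi>: "continuous_on UNIV ?\<phi>" by (rule C1_continuous[OF C1])
  have c\<phi>': "continuous_on UNIV (\<lambda>x::real \<times> real. \<eta>' (snd x))"
    by (intro continuous_on_compose2[OF c\<eta>'] continuous_intros) auto
  have szB: "L2_on ?B s_z" by (rule L2_on_subset[OF s_L2 B]) auto
  have i1: "integrable (lebesgue_on ?B) (\<lambda>x. s_z x * \<eta> (snd x))"
    by (rule L2_on_mult_integrable[OF szB integrable_continuous_rectangle(1)[OF c\<phi>]])
  have sB: "L2_on ?B s"
  proof (rule L2_on_bounded[where C = 1])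
    show "s \<in> borel_measurable (lebesgue_on ?B)" by (rule measurable_lebesgue_on_subset[OF s_measurable B])
    show "AE x in lebesgue_on ?B. norm (s x) \<le> 1"
      using B s_range by (intro AE_I2) force
  qed (rule rectangle_measurable)
  have i2: "integrable (lebesgue_on ?B) (\<lambda>x. s x * \<eta>' (snd x))"
    by (rule L2_on_mult_integrable[OF sB integrable_continuous_rectangle(1)[OF c\<phi>']])
  have gauss: "(LINT x|lebesgue_on ?B. s_z x * \<eta> (snd x)) + (LINT x|lebesgue_on ?B. s x * \<eta>' (snd x))
      = - (LINT y|lebesgue_on ?I. s0 y)"
  proof -
    let ?a = "\<lambda>n::nat. L / real (n + 3)" and ?b = "\<lambda>n::nat. L - L / real (n + 3)"
    let ?J = "\<lambda>n. {?a n<..<?b n}" and ?A = "\<lambda>n. {?a n<..<?b n} \<times> {0<..<?T}"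
    have A: "?A n \<subseteq> ?B" for n
    proof -
      have "{?a n<..<?b n} \<subseteq> {0<..<L}" using inner_interval[of n] by auto
      then show ?thesis by blast
    qed
    have Aex: "\<forall>\<^sub>F n in sequentially. x \<in> ?A n" if "x \<in> ?B" for x
    proof -
      have "fst x \<in> {0<..<L}" using that by auto
      from inner_interval_exhaustion[OF this] show ?thesis
        by eventually_elim (use that in \<open>auto simp: mem_Times_iff\<close>)
    qed
    have As: "?A n \<in> sets lebesgue" for n by (rule rectangle_sets)
    have Jex: "\<forall>\<^sub>F n in sequentially. y \<in> ?J n" if "y \<in> ?I" for y
      using inner_interval_exhaustion[OF that] by eventually_elim simp
    have J: "?J n \<subseteq> ?I" for n using inner_interval[of n] by auto
    have "(LINT x|lebesgue_on (?A n). s_z x * \<eta> (snd x)) + (LINT x|lebesgue_on (?A n). s x * \<eta>' (snd x))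
      = - (LINT y|lebesgue_on (?J n). s0 y)" for n
    proof -
      have tr: "has_trace (?J n) {0<..<?T} 0 s s0"
        by (rule s_trace[OF inner_interval]) (use Z R in auto)
      have wd: "has_weak_deriv (?A n) e_z s s_z"
        by (rule has_weak_deriv_subset[OF s_weak_deriv order_trans[OF A B] open_rectangle open_Omega])
      have one: "continuous_on UNIV (\<lambda>_::real. 1::real)" by simp
      show ?thesis
        using Gauss_rectangle_trace[OF tr wd one d\<eta> c\<eta>' \<eta>T(1)] Z R \<eta>0 by simp
    qed
    moreover have "(\<lambda>n. (LINT x|lebesgue_on (?A n). s_z x * \<eta> (snd x)) + (LINT x|lebesgue_on (?A n). s x * \<eta>' (snd x)))
        \<longlonglongrightarrow> (LINT x|lebesgue_on ?B. s_z x * \<eta> (snd x)) + (LINT x|lebesgue_on ?B. s x * \<eta>' (snd x))"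
      by (intro tendsto_add integral_exhaustion[OF i1 rectangle_sets A As Aex] integral_exhaustion[OF i2 rectangle_sets A As Aex])
    moreover have "(\<lambda>n. - (LINT y|lebesgue_on (?J n). s0 y)) \<longlonglongrightarrow> - (LINT y|lebesgue_on ?I. s0 y)"
      by (intro tendsto_minus integral_exhaustion[OF s0_integrable _ J _ Jex]) auto
    ultimately show ?thesis using LIMSEQ_unique by simp
  qed
  have e1: "(LINT x|lebesgue_on U. c * s_z x * \<eta> (snd x)) = c * (LINT x|lebesgue_on ?B. s_z x * \<eta> (snd x))"
  proof -
    have "(LINT x|lebesgue_on U. c * s_z x * \<eta> (snd x)) = (LINT x|lebesgue_on ?B. c * s_z x * \<eta> (snd x))"
      by (rule integral_lebesgue_on_support[OF B]) (use \<eta>T above_strip in auto)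
    then show ?thesis by (simp add: mult.assoc)
  qed
  have e2: "(LINT x|lebesgue_on U. q x \<bullet> ?D x) = (LINT x|lebesgue_on ?B. k (s x) * (p_z x + g) * \<eta>' (snd x))"
  proof -
    have "q x \<bullet> ?D x = k (s x) * (p_z x + g) * \<eta>' (snd x)" for x
      using q_vertical[of x] by (cases "q x") (simp add: inner_prod_def)
    then have "(LINT x|lebesgue_on U. q x \<bullet> ?D x) = (LINT x|lebesgue_on U. k (s x) * (p_z x + g) * \<eta>' (snd x))"
      by simp
    also have "\<dots> = (LINT x|lebesgue_on ?B. k (s x) * (p_z x + g) * \<eta>' (snd x))"
      by (rule integral_lebesgue_on_support[OF B]) (use \<eta>T above_strip in auto)
    finally show ?thesis .
  qed
  have i3: "integrable (lebesgue_on ?B) (\<lambda>x. k (s x) * (p_z x + g) * \<eta>' (snd x))"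
  proof -
    have "integrable (lebesgue_on ?B) (\<lambda>x. q x \<bullet> e_z)"
    proof (rule integrable_lebesgue_on_bounded[OF _ rectangle_measurable])
      show "(\<lambda>x. q x \<bullet> e_z) \<in> borel_measurable (lebesgue_on ?B)"
        by (intro borel_measurable_inner measurable_lebesgue_on_subset[OF q_measurable B]) simp
      have "AE x in lebesgue_on ?B. norm (q x) \<le> M_q"
        by (rule AE_lebesgue_on_subset[OF q_bounded B]) auto
      then show "AE x in lebesgue_on ?B. norm (q x \<bullet> e_z) \<le> M_q"
      proof eventually_elim
        case (elim x)
        then show ?case using Basis_le_norm[OF e_z_Basis, of "q x"] by simp
      qed
    qed
    moreover have "AE x in lebesgue_on ?B. \<bar>\<eta>' (snd x)\<bar> \<le> 1 / R"
      using plateau_bounds[OF R0] R by (intro AE_I2) (auto simp: \<eta>'_def divide_right_mono)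
    moreover have "(\<lambda>x. \<eta>' (snd x)) \<in> borel_measurable (lebesgue_on ?B)"
      by (rule continuous_imp_measurable_on_sets_lebesgue[OF continuous_on_subset[OF c\<phi>']]) auto
    ultimately show ?thesis unfolding q_vertical[symmetric] by (intro integrable_bounded_mult)
  qed
  have "bottom_flux g L k c s0 s p
      = - ((LINT x|lebesgue_on U. q x \<bullet> ?D x) + (LINT x|lebesgue_on U. c * s_z x * \<eta> (snd x))) - c * (LINT y|lebesgue_on ?I. s0 y)"
    unfolding bottom_flux_def normal_trace_pairing_eq[OF \<phi>] test_C1_pairing[OF C1 \<phi>] ..
  also have "\<dots> = - (LINT x|lebesgue_on ?B. k (s x) * (p_z x + g) * \<eta>' (snd x)) + c * (LINT x|lebesgue_on ?B. s x * \<eta>' (snd x))"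
  proof -
    have eq: "(LINT x|lebesgue_on ?B. s_z x * \<eta> (snd x)) = - (LINT x|lebesgue_on ?B. s x * \<eta>' (snd x)) - (LINT y|lebesgue_on ?I. s0 y)"
      using gauss by linarith
    show ?thesis unfolding e1 e2 eq by (simp add: algebra_simps)
  qed
  also have "\<dots> = (LINT x|lebesgue_on ?B. - (k (s x) * (p_z x + g) * \<eta>' (snd x)) + c * (s x * \<eta>' (snd x)))"
    using i2 i3 by simp
  also have "\<dots> = (LINT x|lebesgue_on ?B. flux_density x * plateau Z R (snd x) / R)"
    by (intro Bochner_Integration.integral_cong) (simp_all add: flux_density_def \<eta>'_def add_divide_distrib diff_divide_distrib algebra_simps)
  finally show ?thesis using R by simp
qed

end

section \<open>Bounds for the limit saturation\<close>

lemma horizontal_neighbourhood: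
  fixes W :: "(real \<times> real) set"
  assumes "open W" "(y, z) \<in> W" "y \<in> {0<..<L}"
  obtains a b where "0 < a" "a < y" "y < b" "b < L" "\<And>y'. y' \<in> {a<..<b} \<Longrightarrow> (y', z) \<in> W"
proof -
  obtain e where e: "e > 0" "ball (y, z) e \<subseteq> W" using assms(1,2) unfolding open_contains_ball by blast
  define d where "d = min e (min y (L - y)) / 2"
  have d: "d > 0" "d < e" "d < y" "d < L - y" using e(1) assms(3) by (auto simp: d_def)
  show ?thesis
  proof (rule that[of "y - d" "y + d"])
    fix y' assume "y' \<in> {y - d<..<y + d}"
    then have "dist (y, z) (y', z) < e" using d(2) by (auto simp: dist_Pair_Pair dist_real_def)
    then show "(y', z) \<in> W" using e(2) by auto
  qed (use d in auto)
qed

context limit_wave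
begin

lemma s_level_open: "open (U \<inter> s -` {..<m})" "open (U \<inter> s -` {m<..})"
  by (rule continuous_open_preimage[OF s_cont open_Omega open_lessThan]
      continuous_open_preimage[OF s_cont open_Omega open_greaterThan])+

text \<open>Since \<open>s\<close> increases with the height, a value below a level \<open>m < s_star\<close> at one point gives values below \<open>m\<close> on a whole rectangle that
  reaches down to the bottom, and then boundary values at most \<open>m\<close>.\<close>

lemma s_ge_star:
  assumes x: "x \<in> U"
  shows "s_star \<le> s x"
proof (rule ccontr)
  assume "\<not> s_star \<le> s x"
  then obtain m where m: "s x < m" "m < s_star" using dense[of "s x" s_star] by auto
  obtain y z where yz: "x = (y, z)" "y \<in> {0<..<L}" "0 < z" using x by (auto simp: Omega_def)
  have "(y, z) \<in> U \<inter> s -` {..<m}" using x m yz by auto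
  from horizontal_neighbourhood[OF s_level_open(1) this yz(2)]
  obtain a b where ab: "0 < a" "a < y" "y < b" "b < L" and near: "\<And>y'. y' \<in> {a<..<b} \<Longrightarrow> (y', z) \<in> U \<inter> s -` {..<m}"
    by blast
  have "AE y' in lebesgue_on {a<..<b}. s0 y' \<le> m"
  proof (rule trace_le_if_AE_le[OF s_trace yz(3)])
    show "AE x in lebesgue_on ({a<..<b} \<times> {0<..<z}). s x \<le> m"
    proof (rule AE_I2)
      fix x assume "x \<in> space (lebesgue_on ({a<..<b} \<times> {0<..<z}))"
      then obtain y' z' where x': "x = (y', z')" "y' \<in> {a<..<b}" "0 < z'" "z' < z" by auto
      have "s (y', z') \<le> s (y', z)" using x' ab by (intro s_mono) auto
      then show "s x \<le> m" using near[OF x'(2)] x'(1) by auto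
    qed
  qed (use ab yz in auto)
  then obtain y' where "y' \<in> {a<..<b}" "s0 y' \<le> m"
    by (rule AE_open_obtains[of _ _ "{a<..<b}"]) (use ab in auto)
  moreover have "s_star \<le> s0 y'" using calculation(1) ab by (intro s0_ge) auto
  ultimately show False using m by linarith
qed

lemma s_z_zero_above:
  assumes sb: "0 < sb" "sb < 1" "p_bar \<le> pc sb"
  shows "AE x in lebesgue_on U. sb < s x \<longrightarrow> s_z x = 0"
proof -
  have "AE x in lebesgue_on U. x \<in> U" by (rule AE_I2) simp
  with capillary[unfolded capillary_eq_def] p_le show ?thesis
  proof eventually_elim
    case (elim x)
    show ?case
    proof
      assume gt: "sb < s x"
      have "ereal (p x) - pc_ext pc (s x) \<le> 0"
      proof (cases "s x < 1")
        case True
        then have "pc sb < pc (s x)" using gt sb by (intro pc_mono) auto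
        then have "p x \<le> pc (s x)" using elim(2) sb by linarith
        then show ?thesis using True gt sb by (simp add: pc_ext_def)
      next
        case False
        then show ?thesis using gt sb by (simp add: pc_ext_def)
      qed
      then have "ereal (c * \<tau> * s_z x) = 0" using elim(1) by (simp add: max_absorb1)
      then show "s_z x = 0" using pos by simp
    qed
  qed
qed

text \<open>Above a level \<open>sb\<close> with \<open>p\<^sub>c(sb) \<ge> p_bar\<close> the saturation cannot grow. Following a vertical line downwards from a
  point above that level, the saturation is locally constant as long as it stays above the level, and hence stays above it down
  to the bottom; there this contradicts \<open>p\<^sub>c(s\<^sub>0) < p\<^sub>0 \<le> p_bar\<close>.\<close>

lemma s_above_propagates_down:
  assumes sb: "0 < sb" "sb < 1" "p_bar \<le> pc sb" and y: "y \<in> {0<..<L}" and z: "0 < z0" "z0 < z1" and gt: "sb < s (y, z1)"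
  shows "sb < s (y, z0)"
proof (rule ccontr)
  assume "\<not> sb < s (y, z0)"
  then have le: "s (y, z0) \<le> sb" by simp
  \<comment> \<open>Stop at a height \<open>z2\<close> with value \<open>v\<close> strictly above the level, so that the closed segment from \<open>z2\<close> to \<open>z1\<close> lies in the open set where
    \<open>s\<close> does not grow.\<close>
  obtain v where v: "sb < v" "v < s (y, z1)" using dense[OF gt] by auto
  let ?h = "\<lambda>z. s (y, z)"
  have hc: "continuous_on {z0..z1} ?h"
    by (rule continuous_on_compose2[OF s_cont]) (use y z in \<open>auto simp: Omega_def intro!: continuous_intros\<close>)
  have "\<exists>z. z0 \<le> z \<and> z \<le> z1 \<and> ?h z = v"
    by (rule IVT'[OF _ _ _ hc]) (use le v z in auto)
  then obtain z2 where z2: "z0 \<le> z2" "z2 \<le> z1" "?h z2 = v" by auto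
  have z21: "z2 < z1" using z2 v by (cases "z2 = z1") auto
  have loc: "(?h has_real_derivative 0) (at z)" if zz: "z2 < z" "z < z1" for z
  proof -
    have "v \<le> ?h z" using s_mono[OF y, of z2 z] z z2 zz by auto
    then have xin: "(y, z) \<in> U \<inter> s -` {sb<..}" using v zz z z2 y by (auto simp: Omega_def)
    then obtain e where e: "e > 0" "ball (y, z) e \<subseteq> U \<inter> s -` {sb<..}"
      using s_level_open(2) unfolding open_contains_ball by blast
    define d where "d = e / 3"
    have d: "d > 0" "2 * d < e" using e(1) by (auto simp: d_def)
    let ?V = "{y - d<..<y + d} \<times> {z - d<..<z + d}"
    have V: "?V \<subseteq> U \<inter> s -` {sb<..}"
    proof
      fix x assume "x \<in> ?V"
      then obtain y' z' where x': "x = (y', z')" "\<bar>y' - y\<bar> < d" "\<bar>z' - z\<bar> < d" by force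
      have "dist (y, z) (y', z') \<le> dist y y' + dist z z'"
        by (simp add: dist_Pair_Pair sqrt_sum_squares_le_sum)
      also have "\<dots> < e" using x' d by (simp add: dist_real_def abs_minus_commute)
      finally have "x \<in> ball (y, z) e" by (simp add: x')
      then show "x \<in> U \<inter> s -` {sb<..}" by (rule subsetD[OF e(2)])
    qed
    have VU: "?V \<subseteq> U" using V by blast
    have wd: "has_weak_deriv ?V e_z s s_z"
      by (rule has_weak_deriv_subset[OF s_weak_deriv VU open_rectangle open_Omega])
    have "AE x in lebesgue_on ?V. sb < s x \<longrightarrow> s_z x = 0"
      by (rule AE_lebesgue_on_subset[OF s_z_zero_above[OF sb] VU]) auto
    then have z0': "AE x in lebesgue_on ?V. s_z x = 0"
      by (rule lebesgue_on_mono) (use V in auto)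
    have cV: "continuous_on ?V s" using s_cont VU continuous_on_subset by blast
    have cV': "continuous_on ?V (\<lambda>x. - s x)" using cV by (rule continuous_on_minus)
    have mono: "s (y, u) = s (y, w)" if "z - d < u" "u \<le> w" "w < z + d" for u w
    proof (rule antisym)
      show "s (y, u) \<le> s (y, w)"
        by (rule mono_if_weak_deriv_nonneg[OF cV wd]) (use z0' that d in \<open>auto elim: eventually_mono\<close>)
      have "- s (y, u) \<le> - s (y, w)"
        by (rule mono_if_weak_deriv_nonneg[OF cV' has_weak_deriv_uminus[OF open_rectangle wd]])
          (use z0' that d in \<open>auto elim: eventually_mono\<close>)
      then show "s (y, w) \<le> s (y, u)" by simp
    qed
    have "((\<lambda>_. ?h z) has_real_derivative 0) (at z)" by simp
    then show ?thesis
    proof (rule has_field_derivative_transform_within_open)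
      show "open {z - d<..<z + d}" "z \<in> {z - d<..<z + d}" using d by auto
      fix w assume w: "w \<in> {z - d<..<z + d}"
      show "?h z = ?h w"
      proof (cases "z \<le> w")
        case True
        show ?thesis by (rule mono) (use True w d in auto)
      next
        case False
        show ?thesis by (rule mono[symmetric]) (use False w d in auto)
      qed
    qed
  qed
  have "?h z1 = ?h z2"
    by (rule DERIV_isconst_end[OF z21]) (use hc z2 loc in \<open>auto intro: continuous_on_subset\<close>)
  then show False using z2 v by simp
qed

lemma s_le_bar:
  assumes sb: "0 < sb" "sb < 1" "p_bar \<le> pc sb" and x: "x \<in> U"
  shows "s x \<le> sb"
proof (rule ccontr)
  assume "\<not> s x \<le> sb"
  then have gt: "sb < s x" by simp
  obtain y z where yz: "x = (y, z)" "y \<in> {0<..<L}" "0 < z" using x by (auto simp: Omega_def)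
  have "(y, z) \<in> U \<inter> s -` {sb<..}" using x gt yz by auto
  from horizontal_neighbourhood[OF s_level_open(2) this yz(2)]
  obtain a b where ab: "0 < a" "a < y" "y < b" "b < L" and near: "\<And>y'. y' \<in> {a<..<b} \<Longrightarrow> (y', z) \<in> U \<inter> s -` {sb<..}"
    by blast
  have "AE y' in lebesgue_on {a<..<b}. - s0 y' \<le> - sb"
  proof (rule trace_le_if_AE_le[OF has_trace_uminus[OF s_trace] yz(3)])
    show "AE x in lebesgue_on ({a<..<b} \<times> {0<..<z}). - s x \<le> - sb"
    proof (rule AE_I2)
      fix x assume "x \<in> space (lebesgue_on ({a<..<b} \<times> {0<..<z}))"
      then obtain y' z' where x': "x = (y', z')" "y' \<in> {a<..<b}" "0 < z'" "z' < z" by auto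
      have "sb < s (y', z')"
        by (rule s_above_propagates_down[OF sb, of y' z' z]) (use x' ab near[OF x'(2)] in auto)
      then show "- s x \<le> - sb" using x'(1) by simp
    qed
  qed (use ab yz in auto)
  moreover have "AE y' in lebesgue_on {a<..<b}. p0 y' \<le> p_bar"
  proof (rule trace_le_if_AE_le[OF p_trace yz(3)])
    show "AE x in lebesgue_on ({a<..<b} \<times> {0<..<z}). p x \<le> p_bar"
      by (rule AE_lebesgue_on_subset[OF p_le strip_subset_Omega]) (use ab in auto)
  qed (use ab yz in auto)
  ultimately have "AE y' in lebesgue_on {a<..<b}. sb \<le> s0 y' \<and> p0 y' \<le> p_bar"
    by eventually_elim simp
  then obtain y' where y': "y' \<in> {a<..<b}" "sb \<le> s0 y' \<and> p0 y' \<le> p_bar"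
    by (rule AE_open_obtains[of _ _ "{a<..<b}"]) (use ab in auto)
  have yI: "y' \<in> {0<..<L}" using y' ab by auto
  have "pc sb \<le> pc (s0 y')"
    using pc_mono[of sb "s0 y'"] sb s0_range[OF yI] y' by (cases "sb = s0 y'") auto
  then show False using p0_gt[OF yI] y' sb by linarith
qed

text \<open>If \<open>s\<close> were identically \<open>s_star\<close>, it would not grow, so that \<open>p \<le> p\<^sub>c(s_star) = 0\<close> everywhere,
  against the boundary values of \<open>p\<close>.\<close>

lemma exists_above_star: "\<exists>x\<in>U. s_star < s x"
proof (rule ccontr)
  assume "\<not> ?thesis"
  then have const: "s x = s_star" if "x \<in> U" for x using s_ge_star[OF that] that by force
  have d: "has_weak_deriv U e_z (\<lambda>x. s x - s_star) (\<lambda>x. s_z x - 0 \<bullet> e_z)"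
    by (rule has_weak_deriv_diff[OF open_Omega s_weak_deriv has_weak_deriv_C1[OF C1_const open_Omega]])
  have "AE x in lebesgue_on U. s x - s_star = 0" by (rule AE_I2) (simp add: const)
  then have "has_weak_deriv U e_z (\<lambda>x. s x - s_star) (\<lambda>_. 0)"
    using d by (intro has_weak_deriv_AE_zero open_Omega) (auto simp: has_weak_deriv_def)
  from has_weak_deriv_unique[OF open_Omega d this]
  have sz: "AE x in lebesgue_on U. s_z x - 0 \<bullet> e_z = 0" .
  have "AE x in lebesgue_on U. x \<in> U" by (rule AE_I2) simp
  with sz capillary[unfolded capillary_eq_def] have p0': "AE x in lebesgue_on U. p x \<le> 0"
  proof eventually_elim
    case (elim x)
    have "max 0 (ereal (p x) - ereal 0) = ereal 0"
      using elim const[of x] s_star pc_star by (simp add: pc_ext_def zero_ereal_def)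
    then have "ereal (p x) - ereal 0 \<le> ereal 0" by (metis max.cobounded2)
    then show ?case by simp
  qed
  have "AE y in lebesgue_on {L/3<..<2*L/3}. p0 y \<le> 0"
  proof (rule trace_le_if_AE_le[OF p_trace, of _ _ 1])
    show "AE x in lebesgue_on ({L/3<..<2*L/3} \<times> {0<..<1}). p x \<le> 0"
      by (rule AE_lebesgue_on_subset[OF p0' strip_subset_Omega]) (use pos in auto)
  qed (use pos in auto)
  then obtain y where y: "y \<in> {L/3<..<2*L/3}" "p0 y \<le> 0"
    by (rule AE_open_obtains[of _ _ "{L/3<..<2*L/3}"]) (use pos in auto)
  have yI: "y \<in> {0<..<L}" using y(1) pos(2) by auto
  have "0 \<le> pc (s0 y)"
    using pc_mono[of s_star "s0 y"] s_star s0_range[OF yI] s0_ge[OF yI] pc_star by (cases "s_star = s0 y") auto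
  then show False using p0_gt[OF yI] y by linarith
qed

end

section \<open>The lower bound for the flux\<close>

lemma measurable_AE_lebesgue_on:
  fixes f g :: "'a::euclidean_space \<Rightarrow> real"
  assumes "f \<in> borel_measurable (lebesgue_on S)" "AE x in lebesgue_on S. f x = g x" "S \<in> sets lebesgue"
  shows "g \<in> borel_measurable (lebesgue_on S)"
proof -
  have 1: "(\<lambda>x. if x \<in> S then f x else 0) \<in> borel_measurable lebesgue"
    using assms(1,3) by (simp add: borel_measurable_if)
  have "AE x in lebesgue. x \<in> S \<longrightarrow> f x = g x" using assms(2,3) by (simp add: AE_restrict_space_iff)
  then have 2: "AE x in lebesgue. (if x \<in> S then f x else 0) = (if x \<in> S then g x else 0)"
    by eventually_elim auto
  have "(\<lambda>x. if x \<in> S then g x else 0) \<in> borel_measurable lebesgue"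
    by (rule borel_measurable_AE[OF 1 2])
  then show ?thesis using assms(3) by (simp add: borel_measurable_if)
qed

lemma measurable_compose_unit_interval:
  fixes s :: "'a::euclidean_space \<Rightarrow> real" and k :: "real \<Rightarrow> real"
  assumes k: "continuous_on {0..1} k" and s: "s \<in> borel_measurable (lebesgue_on S)" "AE x in lebesgue_on S. s x \<in> {0..1}"
    and S: "S \<in> sets lebesgue"
  shows "(\<lambda>x. k (s x)) \<in> borel_measurable (lebesgue_on S)"
proof (rule measurable_AE_lebesgue_on[OF _ _ S])
  have "continuous_on UNIV (\<lambda>t. k (max 0 (min 1 t)))"
    by (rule continuous_on_compose2[OF k]) (auto intro!: continuous_intros)
  then show "(\<lambda>x. k (max 0 (min 1 (s x)))) \<in> borel_measurable (lebesgue_on S)"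
    using measurable_compose[OF s(1) borel_measurable_continuous_onI] by simp
  show "AE x in lebesgue_on S. k (max 0 (min 1 (s x))) = k (s x)"
    using s(2) by eventually_elim auto
qed

text \<open>Uniform continuity bounds \<open>|k u - k t|\<close> by \<open>e + M (u - t)\<^sup>2\<close>, which is controlled by convergence in \<open>L\<^sup>2\<close> without a Lipschitz
  condition on \<open>k\<close>.\<close>

lemma L2_converges_compose:
  fixes s :: "'a::euclidean_space \<Rightarrow> real" and k :: "real \<Rightarrow> real"
  assumes k: "continuous_on {0..1} k" and K: "K \<in> lmeasurable" and conv: "L2_converges K sn s"
    and s: "AE x in lebesgue_on K. s x \<in> {0..1}"
    and sn: "\<forall>\<^sub>F n in sequentially. AE x in lebesgue_on K. sn n x \<in> {0..1}"
  shows "(\<lambda>n. LINT x|lebesgue_on K. \<bar>k (sn n x) - k (s x)\<bar>) \<longlonglongrightarrow> 0"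
proof (rule LIMSEQ_I)
  fix r :: real assume r: "r > 0"
  define \<mu> where "\<mu> = (LINT x|lebesgue_on K. (1::real))"
  have \<mu>: "\<mu> \<ge> 0" unfolding \<mu>_def by simp
  obtain B where "\<forall>t\<in>{0..1}. \<bar>k t\<bar> \<le> B"
    using compact_imp_bounded[OF compact_continuous_image[OF k compact_Icc]] by (auto simp: bounded_iff)
  then have B: "\<bar>k t\<bar> \<le> B" if "t \<in> {0..1}" for t using that by blast
  have B0: "B \<ge> 0" using B[of 0] by auto
  define e where "e = r / 2 / (\<mu> + 1)"
  have e: "e > 0" "e * \<mu> < r / 2"
  proof -
    show "e > 0" using r \<mu> by (simp add: e_def)
    then have "e * \<mu> < e * (\<mu> + 1)" by simp
    also have "\<dots> = r / 2"
    proof -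
      have "\<mu> + 1 \<noteq> 0" using \<mu> by linarith
      then show ?thesis unfolding e_def by (rule nonzero_eq_divide_eq[THEN iffD1, OF _ refl])
    qed
    finally show "e * \<mu> < r / 2" .
  qed
  have "uniformly_continuous_on {0..1} k" by (rule compact_uniformly_continuous[OF k compact_Icc])
  then obtain d where d: "d > 0" "\<And>t u. t \<in> {0..1} \<Longrightarrow> u \<in> {0..1} \<Longrightarrow> dist u t < d \<Longrightarrow> dist (k u) (k t) < e"
    using e(1) unfolding uniformly_continuous_on_def by metis
  define M where "M = 2 * B / d\<^sup>2"
  have M: "M \<ge> 0" using B0 by (simp add: M_def)
  have est: "\<bar>k u - k t\<bar> \<le> e + M * (u - t)\<^sup>2" if "t \<in> {0..1}" "u \<in> {0..1}" for t u
  proof (cases "\<bar>u - t\<bar> < d")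
    case True
    then have "\<bar>k u - k t\<bar> < e" using d(2)[OF that] by (simp add: dist_real_def)
    then show ?thesis using M by (simp add: add_increasing2)
  next
    case False
    then have "d\<^sup>2 \<le> (u - t)\<^sup>2" using d(1) by (metis abs_le_square_iff abs_of_pos not_less)
    then have "M * d\<^sup>2 \<le> M * (u - t)\<^sup>2" using M by (rule mult_left_mono)
    moreover have "M * d\<^sup>2 = 2 * B" using d(1) by (simp add: M_def)
    moreover have "\<bar>k u - k t\<bar> \<le> 2 * B" using B[OF that(1)] B[OF that(2)] by linarith
    ultimately show ?thesis using e(1) by linarith
  qed
  have lim: "(\<lambda>n. M * (LINT x|lebesgue_on K. (norm (sn n x - s x))\<^sup>2)) \<longlonglongrightarrow> M * 0"
    using conv unfolding L2_converges_def by (intro tendsto_mult_left) auto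
  have "\<forall>\<^sub>F n in sequentially. M * (LINT x|lebesgue_on K. (norm (sn n x - s x))\<^sup>2) < r / 2"
    by (rule order_tendstoD(2)[OF lim]) (use r in simp)
  moreover have "\<forall>\<^sub>F n in sequentially. L2_on K (sn n)" using conv by (auto simp: L2_converges_def)
  ultimately have "\<forall>\<^sub>F n in sequentially. norm ((LINT x|lebesgue_on K. \<bar>k (sn n x) - k (s x)\<bar>) - 0) < r"
    using sn
  proof eventually_elim
    case (elim n)
    have l2: "L2_on K (\<lambda>x. sn n x - s x)" using elim(2) conv by (auto simp: L2_converges_def intro: L2_on_diff)
    have i1: "integrable (lebesgue_on K) (\<lambda>x. (norm (sn n x - s x))\<^sup>2)" using l2 by (simp add: L2_on_def)
    have i2: "integrable (lebesgue_on K) (\<lambda>x. e)"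
      by (rule integrable_lebesgue_on_bounded[where C = e]) (use K e in auto)
    have "\<bar>LINT x|lebesgue_on K. \<bar>k (sn n x) - k (s x)\<bar>\<bar> \<le> (LINT x|lebesgue_on K. e + M * (norm (sn n x - s x))\<^sup>2)"
    proof (rule abs_integral_le)
      show "integrable (lebesgue_on K) (\<lambda>x. e + M * (norm (sn n x - s x))\<^sup>2)" using i1 i2 by auto
      show "AE x in lebesgue_on K. \<bar>\<bar>k (sn n x) - k (s x)\<bar>\<bar> \<le> e + M * (norm (sn n x - s x))\<^sup>2"
        using s elim(3) by eventually_elim (use est in simp)
    qed
    also have "\<dots> = (LINT x|lebesgue_on K. e * 1) + M * (LINT x|lebesgue_on K. (norm (sn n x - s x))\<^sup>2)"
      using i1 i2 by simp
    also have "(LINT x|lebesgue_on K. e * 1) = e * \<mu>" unfolding \<mu>_def by (rule integral_mult_right_zero)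
    also have "e * \<mu> + M * (LINT x|lebesgue_on K. (norm (sn n x - s x))\<^sup>2) < r"
      using e(2) elim(1) by linarith
    finally show ?case by simp
  qed
  then show "\<exists>no. \<forall>n\<ge>no. norm ((LINT x|lebesgue_on K. \<bar>k (sn n x) - k (s x)\<bar>) - 0) < r"
    by (simp add: eventually_sequentially)
qed

lemma Omega_H_open: "open (Omega_H L H)"
  unfolding Omega_H_def by (rule open_rectangle)

text \<open>Test the flux condition with a function of the height that grows from \<open>0\<close> to \<open>R\<close>. As the saturation is at most \<open>1\<close> at
  the top, the Gauss formula bounds the contribution of \<open>\<partial>\<^sub>z s\<close> from above.\<close>

lemma TW_H_flux_lower_bound:
  assumes TW: "TW_H_solution g L k pc H c \<tau> F_inf s0 p0 s p"
    and pos: "0 < L" "0 < c" "0 < g" and ZR: "0 < Z" "0 < R" "Z + R + 1 < H"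
    and k: "continuous_on {0..1} k"
    and grad: "AE x in lebesgue_on (Omega_H L H). \<bar>weak_deriv (Omega_H L H) e_z p x\<bar> \<le> C_P"
  shows "(F_inf - c * L) * R \<le> (LINT x|lebesgue_on ({0<..<L} \<times> {0<..<Z + R + 1}).
      (k (s x) * (weak_deriv (Omega_H L H) e_z p x + g) - c * s x) * plateau Z R (snd x))"
proof -
  define V where "V = {0<..<L} \<times> {0<..<H}"
  have VO: "Omega_H L H = V" by (simp add: Omega_H_def V_def)
  have Vo: "open V" and Vl: "V \<in> lmeasurable" unfolding V_def by (rule open_rectangle rectangle_measurable)+
  have Vs: "V \<in> sets lebesgue" using Vl by auto
  let ?s' = "weak_deriv V e_z s" and ?p' = "weak_deriv V e_z p"
  have R0: "0 \<le> R" and H: "0 < H" using ZR by auto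
  note T = TW[unfolded TW_H_solution_def Let_def VO]
  have s01: "AE x in lebesgue_on V. s x \<in> {0..1}" and sL2: "L2_on V s" and s'L2: "L2_on V ?s'"
    and pH1: "in_H1 V p"
    and tr: "has_trace {0<..<L} {0<..<H} 0 s s0"
    and eqn: "\<And>\<phi> \<phi>_star. in_H1 V \<phi> \<Longrightarrow> has_trace {0<..<L} {0<..<H} 0 \<phi> (\<lambda>_. 0) \<Longrightarrow>
       has_trace {0<..<L} {0<..<H} H \<phi> (\<lambda>_. \<phi>_star) \<Longrightarrow>
          (LINT x|lebesgue_on V. c * ?s' x * \<phi> x)
          + (LINT x|lebesgue_on V. flux_field g k V s p x \<bullet> weak_gradient V \<phi> x) = F_inf * \<phi>_star"
    using T by blast+
  have swd: "has_weak_deriv V e_z s ?s'" using T by (intro has_weak_deriv_weak_deriv) blast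
  have pwd: "weakly_differentiable V p" using pH1 by (simp add: in_H1_def)
  have pm: "?p' \<in> borel_measurable (lebesgue_on V)"
    using weakly_differentiable_weak_deriv[OF pwd e_z_Basis] Vo
    by (intro L1_loc_measurable) (auto simp: has_weak_deriv_def)
  have sm: "s \<in> borel_measurable (lebesgue_on V)" using sL2 by (simp add: L2_on_def)
  have ksm: "(\<lambda>x. k (s x)) \<in> borel_measurable (lebesgue_on V)"
    by (rule measurable_compose_unit_interval[OF k sm s01 Vs])
  let ?\<phi> = "\<lambda>x::real \<times> real. plateau_integral Z R (snd x)" and ?w = "\<lambda>x::real \<times> real. plateau Z R (snd x)"
  let ?D = "\<lambda>x::real \<times> real. (0::real, plateau Z R (snd x))"
  have C1: "C1_with_gradient ?\<phi> ?D" by (rule C1_snd[OF plateau_integral_has_derivative continuous_on_plateau])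
  have H1: "in_H1 V ?\<phi>"
    by (rule in_H1_C1[OF Vo C1, of V]) (use Vs in \<open>auto simp: V_def intro: bounded_Times\<close>)
  have "has_trace {0<..<L} {0<..<H} 0 ?\<phi> (\<lambda>_. 0)"
    using has_trace_C1[OF C1, of 0 L 0 H 0] ZR plateau_integral_zero[OF R0] by simp
  moreover have "has_trace {0<..<L} {0<..<H} H ?\<phi> (\<lambda>_. R)"
    using has_trace_C1[OF C1, of 0 L 0 H H] ZR plateau_integral_eq[OF R0] by simp
  ultimately have main: "(LINT x|lebesgue_on V. c * ?s' x * ?\<phi> x)
      + (LINT x|lebesgue_on V. flux_field g k V s p x \<bullet> weak_gradient V ?\<phi> x) = F_inf * R"
    by (rule eqn[OF H1])
  have cw: "continuous_on UNIV ?w"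
    by (intro continuous_on_compose2[OF continuous_on_plateau] continuous_intros) auto
  have c\<phi>: "continuous_on UNIV ?\<phi>" by (rule C1_continuous[OF C1])
  have wm: "?w \<in> borel_measurable (lebesgue_on V)"
    using cw Vs continuous_on_subset by (intro continuous_imp_measurable_on_sets_lebesgue) blast+
  have flux: "(LINT x|lebesgue_on V. flux_field g k V s p x \<bullet> weak_gradient V ?\<phi> x)
      = (LINT x|lebesgue_on V. k (s x) * (?p' x + g) * ?w x)"
  proof (rule integral_cong_AE)
    have "flux_field g k V s p \<in> borel_measurable (lebesgue_on V)"
      unfolding flux_field_def[abs_def]
      by (intro borel_measurable_scaleR borel_measurable_add borel_measurable_const ksm weak_gradient_measurable[OF Vo pwd])
    moreover have "weak_gradient V ?\<phi> \<in> borel_measurable (lebesgue_on V)"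
      using H1 by (intro weak_gradient_measurable[OF Vo]) (simp add: in_H1_def)
    ultimately show "(\<lambda>x. flux_field g k V s p x \<bullet> weak_gradient V ?\<phi> x) \<in> borel_measurable (lebesgue_on V)"
      by (rule borel_measurable_inner)
    show "(\<lambda>x. k (s x) * (?p' x + g) * ?w x) \<in> borel_measurable (lebesgue_on V)"
      by (intro borel_measurable_times borel_measurable_add borel_measurable_const ksm pm wm)
    show "AE x in lebesgue_on V. flux_field g k V s p x \<bullet> weak_gradient V ?\<phi> x = k (s x) * (?p' x + g) * ?w x"
      using weak_gradient_C1[OF Vo C1]
    proof eventually_elim
      case (elim x)
      have "flux_field g k V s p x \<bullet> e_z = k (s x) * (?p' x + g)"
        by (simp add: flux_field_def inner_add_left weak_gradient_inner_Basis)
      then show ?case unfolding elim by (cases "flux_field g k V s p x") (simp add: inner_prod_def)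
    qed
  qed
  obtain B where "\<forall>t\<in>{0..1}. \<bar>k t\<bar> \<le> B"
    using compact_imp_bounded[OF compact_continuous_image[OF k compact_Icc]] by (auto simp: bounded_iff)
  then have B: "\<bar>k t\<bar> \<le> B" if "t \<in> {0..1}" for t using that by blast
  have B0: "B \<ge> 0" using B[of 0] by auto
  have iq: "integrable (lebesgue_on V) (\<lambda>x. k (s x) * (?p' x + g) * ?w x)"
  proof (rule integrable_lebesgue_on_bounded[OF _ Vl])
    show "(\<lambda>x. k (s x) * (?p' x + g) * ?w x) \<in> borel_measurable (lebesgue_on V)"
      by (intro borel_measurable_times borel_measurable_add borel_measurable_const ksm pm wm)
    show "AE x in lebesgue_on V. norm (k (s x) * (?p' x + g) * ?w x) \<le> B * (C_P + g) * 1"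
      using s01 grad[unfolded VO]
    proof eventually_elim
      case (elim x)
      have "\<bar>?p' x + g\<bar> \<le> C_P + g" using elim(2) pos(3) by linarith
      then show ?case unfolding real_norm_def abs_mult
        using B[OF elim(1)] B0 plateau_bounds[OF R0, of Z "snd x"] by (intro mult_mono) auto
    qed
  qed
  have isw: "integrable (lebesgue_on V) (\<lambda>x. s x * ?w x)"
    using L2_on_mult_integrable[OF sL2] integrable_continuous_rectangle(1)[OF cw] by (simp add: V_def)
  have is\<phi>: "integrable (lebesgue_on V) (\<lambda>x. ?s' x * ?\<phi> x)"
    using L2_on_mult_integrable[OF s'L2] integrable_continuous_rectangle(1)[OF c\<phi>] by (simp add: V_def)
  let ?r = "\<lambda>m z. ramp (1 + real (Suc m) * (z - H) / H)"
  let ?r' = "\<lambda>m z. real (Suc m) / H * ramp_deriv (1 + real (Suc m) * (z - H) / H)"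
  have dr: "(?r m has_real_derivative ?r' m t) (at t)" for m t
  proof -
    have "((\<lambda>z. 1 + real (Suc m) * (z - H) / H) has_real_derivative real (Suc m) / H) (at t)"
      using H by (auto intro!: derivative_eq_intros simp del: of_nat_Suc)
    from DERIV_chain2[OF ramp_has_derivative this] show ?thesis by (simp only: mult.commute)
  qed
  have cr: "continuous_on UNIV (?r m)" and cr': "continuous_on UNIV (?r' m)" for m
    using H by (intro continuous_intros continuous_on_compose2[OF continuous_on_ramp]
        continuous_on_compose2[OF continuous_on_ramp_deriv]; simp)+
  have r0: "?r m 0 = 0" and rH: "?r m H = 1" for m using H by (simp_all add: ramp_zero ramp_one)
  have c2: "continuous_on UNIV (\<lambda>x::real \<times> real. ?r m (snd x))" "continuous_on UNIV (\<lambda>x::real \<times> real. ?r' m (snd x))" for m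
    by (intro continuous_on_compose2[OF cr] continuous_on_compose2[OF cr'] continuous_intros; simp)+
  have L2V: "continuous_on UNIV f \<Longrightarrow> L2_on V f" for f :: "real \<times> real \<Rightarrow> real"
    unfolding V_def by (rule integrable_continuous_rectangle(1))
  have bound: "(LINT x|lebesgue_on V. ?s' x * ?\<phi> x) \<le> R * L - (LINT x|lebesgue_on V. s x * ?w x)
      + R * (LINT x|lebesgue_on V. ?s' x * ?r m (snd x))" for m
  proof -
    \<comment> \<open>Subtracting a ramp in a thin layer below the top makes the weight vanish there, so that the unknown trace of \<open>s\<close> at
      the top does not enter.\<close>
    let ?\<eta> = "\<lambda>z. plateau_integral Z R z - R * ?r m z" and ?\<eta>' = "\<lambda>z. plateau Z R z - R * ?r' m z"
    have d\<eta>: "(?\<eta> has_real_derivative ?\<eta>' t) (at t)" for t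
      by (intro DERIV_diff DERIV_cmult plateau_integral_has_derivative dr)
    have c\<eta>': "continuous_on UNIV ?\<eta>'"
      by (intro continuous_on_diff continuous_on_plateau continuous_on_mult continuous_on_const cr')
    have \<eta>H: "?\<eta> H = 0" unfolding rH using plateau_integral_eq[OF R0, of Z H] ZR by simp
    have \<eta>0: "?\<eta> 0 = 0" unfolding r0 using plateau_integral_zero[OF R0, of 0 Z] ZR by simp
    have one: "continuous_on UNIV (\<lambda>_::real. 1::real)" by simp
    have ir: "integrable (lebesgue_on V) (\<lambda>x. ?s' x * ?r m (snd x))"
      by (rule L2_on_mult_integrable[OF s'L2 L2V[OF c2(1)]])
    have isr: "integrable (lebesgue_on V) (\<lambda>x. s x * ?r' m (snd x))"
      by (rule L2_on_mult_integrable[OF sL2 L2V[OF c2(2)]])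
    have f1: "(LINT x|lebesgue_on V. ?s' x * (1 * ?\<eta> (snd x))) + (LINT x|lebesgue_on V. s x * (1 * ?\<eta>' (snd x))) = 0"
      unfolding V_def
      by (rule Gauss_rectangle_no_trace[OF tr swd[unfolded V_def] one d\<eta> c\<eta>' \<eta>H _ \<eta>0]) (use H in auto)
    have f2: "(LINT x|lebesgue_on V. ?s' x * (1 * ?\<eta> (snd x)))
        = (LINT x|lebesgue_on V. ?s' x * ?\<phi> x) - R * (LINT x|lebesgue_on V. ?s' x * ?r m (snd x))"
    proof -
      have "(\<lambda>x. ?s' x * (1 * ?\<eta> (snd x))) = (\<lambda>x. ?s' x * ?\<phi> x - R * (?s' x * ?r m (snd x)))"
        by (auto simp: algebra_simps)
      then show ?thesis
        using Bochner_Integration.integral_diff[OF is\<phi> integrable_mult_right[OF ir, of R]]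
        by (simp only: integral_mult_right_zero)
    qed
    have f3: "(LINT x|lebesgue_on V. s x * (1 * ?\<eta>' (snd x)))
        = (LINT x|lebesgue_on V. s x * ?w x) - R * (LINT x|lebesgue_on V. s x * ?r' m (snd x))"
    proof -
      have "(\<lambda>x. s x * (1 * ?\<eta>' (snd x))) = (\<lambda>x. s x * ?w x - R * (s x * ?r' m (snd x)))"
        by (auto simp: algebra_simps)
      then show ?thesis
        using Bochner_Integration.integral_diff[OF isw integrable_mult_right[OF isr, of R]]
        by (simp only: integral_mult_right_zero)
    qed
    have f4: "(LINT x|lebesgue_on V. s x * ?r' m (snd x)) \<le> L"
    proof -
      have "(LINT x|lebesgue_on V. s x * ?r' m (snd x)) \<le> (LINT x|lebesgue_on V. ?r' m (snd x))"
      proof (rule integral_mono_AE[OF isr])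
        show "integrable (lebesgue_on V) (\<lambda>x. ?r' m (snd x))"
          unfolding V_def by (rule integrable_continuous_rectangle(2)[OF c2(2)])
        show "AE x in lebesgue_on V. s x * ?r' m (snd x) \<le> ?r' m (snd x)"
          using s01
        proof eventually_elim
          case (elim x)
          have "0 \<le> ?r' m (snd x)" using H by (intro mult_nonneg_nonneg ramp_deriv_bounds divide_nonneg_pos) auto
          then show ?case using elim mult_right_mono[of "s x" 1 "?r' m (snd x)"] by simp
        qed
      qed
      also have "\<dots> = (LINT y|lebesgue_on {0<..<L}. ?r m (snd (y, H)) - ?r m (snd (y, 0)))"
        unfolding V_def
      proof (rule integral_vertical_derivative_rectangle)
        fix y z :: real
        show "((\<lambda>z. ?r m (snd (y, z))) has_real_derivative ?r' m (snd (y, z))) (at z)"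
          unfolding snd_conv by (rule dr)
      qed (use H c2 continuous_on_subset in \<open>blast intro: less_imp_le\<close>)+
      also have "\<dots> = L" unfolding snd_conv rH r0 using pos(1) by (simp add: measure_restrict_space)
      finally show ?thesis .
    qed
    have "R * (LINT x|lebesgue_on V. s x * ?r' m (snd x)) \<le> R * L" by (rule mult_left_mono[OF f4 R0])
    then show ?thesis using f1 unfolding f2 f3 by linarith
  qed
  have "(\<lambda>m. LINT x|lebesgue_on V. ?s' x * ?r m (snd x)) \<longlonglongrightarrow> (LINT x|lebesgue_on V. 0)"
  proof (rule integral_dominated_convergence[where w = "\<lambda>x. \<bar>?s' x\<bar>"])
    show "integrable (lebesgue_on V) (\<lambda>x. \<bar>?s' x\<bar>)" by (rule integrable_abs[OF L2_on_integrable[OF s'L2 Vl]])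
    show "(\<lambda>x. ?s' x * ?r m (snd x)) \<in> borel_measurable (lebesgue_on V)" for m
      by (rule borel_measurable_integrable[OF L2_on_mult_integrable[OF s'L2 L2V[OF c2(1)]]])
    show "AE x in lebesgue_on V. norm (?s' x * ?r m (snd x)) \<le> \<bar>?s' x\<bar>" for m
    proof (rule AE_I2)
      fix x
      have "\<bar>?s' x\<bar> * \<bar>?r m (snd x)\<bar> \<le> \<bar>?s' x\<bar> * 1"
        using ramp_bounds[of "1 + real (Suc m) * (snd x - H) / H"] by (intro mult_left_mono) auto
      then show "norm (?s' x * ?r m (snd x)) \<le> \<bar>?s' x\<bar>" by (simp only: real_norm_def abs_mult mult_1_right)
    qed
    show "AE x in lebesgue_on V. (\<lambda>m. ?s' x * ?r m (snd x)) \<longlonglongrightarrow> 0"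
    proof (rule AE_I2)
      fix x assume "x \<in> space (lebesgue_on V)"
      then have z: "snd x < H" by (auto simp: V_def)
      obtain N :: nat where N: "real N > H / (H - snd x)" using reals_Archimedean2 by blast
      have "?s' x * ?r m (snd x) = 0" if "N \<le> m" for m
      proof -
        have "H / (H - snd x) < real (Suc m)" using N that by linarith
        then have "1 \<le> real (Suc m) * (H - snd x) / H" using H z by (simp add: field_simps del: of_nat_Suc)
        then have "1 + real (Suc m) * (snd x - H) / H \<le> 0"
          by (simp add: diff_divide_distrib right_diff_distrib del: of_nat_Suc)
        then show ?thesis by (simp only: ramp_zero mult_zero_right)
      qed
      then show "(\<lambda>m. ?s' x * ?r m (snd x)) \<longlonglongrightarrow> 0"
        by (intro tendsto_eventually eventually_sequentiallyI[of N]) blast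
    qed
  qed simp
  then have "(\<lambda>m. R * L - (LINT x|lebesgue_on V. s x * ?w x) + R * (LINT x|lebesgue_on V. ?s' x * ?r m (snd x)))
      \<longlonglongrightarrow> R * L - (LINT x|lebesgue_on V. s x * ?w x) + R * (LINT x|lebesgue_on V. 0)"
    by (intro tendsto_intros)
  then have "(LINT x|lebesgue_on V. ?s' x * ?\<phi> x) \<le> R * L - (LINT x|lebesgue_on V. s x * ?w x) + R * (LINT x|lebesgue_on V. 0)"
    by (rule LIMSEQ_le_const) (use bound in blast)
  then have s'\<phi>: "c * (LINT x|lebesgue_on V. ?s' x * ?\<phi> x) \<le> c * (R * L - (LINT x|lebesgue_on V. s x * ?w x))"
    using pos(2) by (intro mult_left_mono) auto
  have "F_inf * R = c * (LINT x|lebesgue_on V. ?s' x * ?\<phi> x) + (LINT x|lebesgue_on V. k (s x) * (?p' x + g) * ?w x)"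
    using main unfolding flux by (simp add: mult.assoc)
  then have "(F_inf - c * L) * R \<le> (LINT x|lebesgue_on V. k (s x) * (?p' x + g) * ?w x) - c * (LINT x|lebesgue_on V. s x * ?w x)"
    using s'\<phi> by (simp add: algebra_simps)
  also have "\<dots> = (LINT x|lebesgue_on V. k (s x) * (?p' x + g) * ?w x - c * (s x * ?w x))"
    using iq isw by simp
  also have "\<dots> = (LINT x|lebesgue_on V. (k (s x) * (?p' x + g) - c * s x) * ?w x)"
    by (simp add: algebra_simps)
  also have "\<dots> = (LINT x|lebesgue_on ({0<..<L} \<times> {0<..<Z + R + 1}). (k (s x) * (?p' x + g) - c * s x) * ?w x)"
  proof (rule integral_lebesgue_on_support)
    fix x assume "x \<in> V - {0<..<L} \<times> {0<..<Z + R + 1}"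
    then have "Z + R + 1 \<le> snd x" by (cases x) (auto simp: V_def not_less)
    then show "(k (s x) * (?p' x + g) - c * s x) * ?w x = 0" using plateau_zero[OF R0] by simp
  qed (use ZR Vs in \<open>auto simp: V_def\<close>)
  finally show ?thesis unfolding VO .
qed

context limit_wave
begin

text \<open>The lower bound for the truncated problems passes to the limit: on compact sets the flux densities converge
  weakly, being products of strongly and weakly convergent factors, and the remaining part of the rectangle has small measure.\<close>

lemma bottom_flux_lower_bound:
  assumes H: "filterlim Hn at_top sequentially"
    and TW: "\<And>n. TW_H_solution g L k pc (Hn n) c \<tau> F_inf s0 p0 (sn n) (pn n)"
    and grad: "\<And>n. AE x in lebesgue_on (Omega_H L (Hn n)). \<bar>weak_deriv (Omega_H L (Hn n)) e_z (pn n) x\<bar> \<le> C_P"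
    and conv: "\<And>K. compact K \<Longrightarrow> K \<subseteq> U \<Longrightarrow> L2_converges K sn s"
      "\<And>K. compact K \<Longrightarrow> K \<subseteq> U \<Longrightarrow> L2_converges K pn p"
  shows "F_inf - c * L \<le> bottom_flux g L k c s0 s p"
proof -
  define B where "B = {0<..<L} \<times> {0<..<1 + 1 + 1 :: real}"
  define w where "w = (\<lambda>x::real \<times> real. plateau 1 1 (snd x))"
  let ?V = "\<lambda>n. Omega_H L (Hn n)"
  let ?p' = "\<lambda>n. weak_deriv (?V n) e_z (pn n)"
  let ?f = "\<lambda>n x. (k (sn n x) * (?p' n x + g) - c * sn n x) * w x"
  let ?F = "\<lambda>x. flux_density x * w x"
  have BU: "B \<subseteq> U" unfolding B_def by (rule strip_subset_Omega) auto
  have Bl: "B \<in> lmeasurable" and Bo: "open B" unfolding B_def by (rule rectangle_measurable open_rectangle)+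
  have Bs: "B \<in> sets lebesgue" using Bl by auto
  have w01: "0 \<le> w x" "w x \<le> 1" for x unfolding w_def by (rule plateau_bounds; simp)+
  have cw: "continuous_on S w" for S
    unfolding w_def by (intro continuous_on_compose2[OF continuous_on_plateau] continuous_intros) auto
  have wm: "w \<in> borel_measurable (lebesgue_on S)" if "S \<in> sets lebesgue" for S
    by (rule continuous_imp_measurable_on_sets_lebesgue[OF cw that])
  have Md: "0 \<le> M_d" unfolding M_d_def using k1_nonneg pos by (intro add_nonneg_nonneg mult_nonneg_nonneg) auto
  have s01: "AE x in lebesgue_on (?V n). sn n x \<in> {0..1}" for n
    using TW[of n] unfolding TW_H_solution_def Let_def by blast
  have snm: "sn n \<in> borel_measurable (lebesgue_on (?V n))" for n
    using TW[of n] unfolding TW_H_solution_def Let_def L2_on_def by blast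
  have Vs: "?V n \<in> sets lebesgue" for n using Omega_H_open[of L "Hn n"] by simp
  have pwd: "has_weak_deriv (?V n) e_z (pn n) (?p' n)" for n
    using TW[of n] unfolding TW_H_solution_def Let_def in_H1_def
    by (intro weakly_differentiable_weak_deriv e_z_Basis) blast
  have p'm: "?p' n \<in> borel_measurable (lebesgue_on (?V n))" for n
    using pwd[of n] by (intro L1_loc_measurable Omega_H_open) (auto simp: has_weak_deriv_def)
  have ksm: "(\<lambda>x. k (sn n x)) \<in> borel_measurable (lebesgue_on (?V n))" for n
    by (rule measurable_compose_unit_interval[OF k_cont snm s01 Vs])
  have fm: "?f n \<in> borel_measurable (lebesgue_on (?V n))" for n
    by (intro borel_measurable_times borel_measurable_diff borel_measurable_add borel_measurable_const ksm p'm snm wm Vs)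
  have fb: "AE x in lebesgue_on (?V n). \<bar>?f n x\<bar> \<le> M_d" for n
    using s01[of n] grad[of n]
  proof eventually_elim
    case (elim x)
    have "\<bar>k (sn n x)\<bar> \<le> k 1" using k_mono[of "sn n x" 1] k_nonneg[OF elim(1)] elim(1) by auto
    then have "\<bar>k (sn n x) * (?p' n x + g)\<bar> \<le> k 1 * (C_P + g)"
      unfolding abs_mult using elim(2) pos k1_nonneg by (intro mult_mono) auto
    moreover have "\<bar>c * sn n x\<bar> \<le> c" using elim(1) pos(4) by (auto simp: abs_mult mult_left_le)
    ultimately have "\<bar>k (sn n x) * (?p' n x + g) - c * sn n x\<bar> \<le> M_d" unfolding M_d_def by linarith
    then have "\<bar>k (sn n x) * (?p' n x + g) - c * sn n x\<bar> * \<bar>w x\<bar> \<le> M_d * 1"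
      using w01[of x] Md by (intro mult_mono) auto
    then show ?case by (simp only: abs_mult mult_1_right)
  qed
  have Mi: "integrable (lebesgue_on S) (\<lambda>x. M_d)" if "S \<in> lmeasurable" for S :: "(real \<times> real) set"
    by (rule integrable_lebesgue_on_bounded[where C = M_d]) (use that Md in auto)
  obtain C where C: "\<And>m. compact (C m)" "\<And>m. C m \<subseteq> B" and Cs: "\<And>m. C m \<in> sets lebesgue"
    and Cex: "\<And>x. x \<in> B \<Longrightarrow> \<forall>\<^sub>F m in sequentially. x \<in> C m"
    using open_compact_exhaustion[OF Bo] by metis
  have Cl: "C m \<in> lmeasurable" for m using C(1) by (rule lmeasurable_compact)
  have Fi: "integrable (lebesgue_on B) ?F"
  proof (rule integrable_lebesgue_on_bounded[OF _ Bl])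
    show "?F \<in> borel_measurable (lebesgue_on B)"
      by (intro borel_measurable_times wm Bs measurable_lebesgue_on_subset[OF flux_density_measurable BU])
    have "AE x in lebesgue_on B. \<bar>flux_density x\<bar> \<le> M_d"
      by (rule AE_lebesgue_on_subset[OF flux_density_bounded BU Bs]) simp
    then show "AE x in lebesgue_on B. norm (?F x) \<le> M_d * 1"
    proof eventually_elim
      case (elim x)
      then show ?case unfolding real_norm_def abs_mult using w01[of x] Md by (intro mult_mono) auto
    qed
  qed
  have lim: "(\<lambda>n. LINT x|lebesgue_on (C m). ?f n x) \<longlonglongrightarrow> (LINT x|lebesgue_on (C m). ?F x)" for m
  proof -
    let ?K = "C m"
    have KU: "?K \<subseteq> U" using C(2) BU by blast
    have ev: "\<forall>\<^sub>F n in sequentially. ?K \<subseteq> ?V n" by (rule compact_eventually_below[OF H C(1) KU])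
    define h where "h = (\<lambda>x. if x \<in> ?K then k (s x) * w x else 0)"
    have ksK: "(\<lambda>x. k (s x)) \<in> borel_measurable (lebesgue_on ?K)"
      by (rule measurable_lebesgue_on_subset[OF ks_measurable KU])
    have hb: "\<bar>h x\<bar> \<le> k 1" for x
    proof (cases "x \<in> ?K")
      case True
      have "\<bar>k (s x)\<bar> * \<bar>w x\<bar> \<le> k 1 * 1"
        using ks_bounds[of x] KU True w01[of x] k1_nonneg by (intro mult_mono) auto
      then show ?thesis using True by (simp add: h_def abs_mult)
    qed (use k1_nonneg in \<open>simp add: h_def\<close>)
    have hm: "h \<in> borel_measurable lebesgue"
      unfolding h_def using borel_measurable_times[OF ksK wm[OF Cs]] Cs by (simp add: borel_measurable_if)
    have hmK: "h \<in> borel_measurable (lebesgue_on ?K)" using hm by (rule measurable_restrict_space1)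
    have hi: "integrable (lebesgue_on ?K) h"
      by (rule integrable_lebesgue_on_bounded[OF hmK Cl, where C = "k 1"]) (use hb in auto)
    have w2: "L2_on ?K w" by (rule L2_on_bounded[OF wm[OF Cs] Cl, where C = 1]) (use w01 in auto)
    have sK: "L2_on ?K s" using conv(1)[OF C(1) KU] by (simp add: L2_converges_def)
    have 1: "(\<lambda>n. LINT x|lebesgue_on ?K. ?p' n x * h x) \<longlonglongrightarrow> (LINT x|lebesgue_on ?K. p_z x * h x)"
      by (rule weak_deriv_limit_bounded_tested[where U = U and V = ?V and fn = pn and gn = ?p' and f = p and b = e_z and C = C_P and M = "k 1",
            OF open_Omega Omega_H_open compact_eventually_below[OF H] conv(2) pwd p_weak_deriv grad pos(5) hm hb C(1) KU])
        (simp_all add: h_def)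
    have 2: "(\<lambda>n. LINT x|lebesgue_on ?K. sn n x * w x) \<longlonglongrightarrow> (LINT x|lebesgue_on ?K. s x * w x)"
      by (rule L2_converges_imp_weak[OF conv(1)[OF C(1) KU] w2])
    have s01K: "AE x in lebesgue_on ?K. s x \<in> {0..1}"
      using KU s_range by (intro AE_I2) auto
    have 3: "(\<lambda>n. LINT x|lebesgue_on ?K. \<bar>k (sn n x) - k (s x)\<bar>) \<longlonglongrightarrow> 0"
    proof (rule L2_converges_compose[OF k_cont Cl conv(1)[OF C(1) KU] s01K])
      show "\<forall>\<^sub>F n in sequentially. AE x in lebesgue_on ?K. sn n x \<in> {0..1}"
        using ev by eventually_elim (rule AE_lebesgue_on_subset[OF s01 _ Cs Vs])
    qed
    let ?err = "\<lambda>n. LINT x|lebesgue_on ?K. (k (sn n x) - k (s x)) * ((?p' n x + g) * w x)"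
    have 4: "?err \<longlonglongrightarrow> 0"
    proof (rule tendsto_rabs_zero_cancel, rule tendsto_sandwich[OF _ _ tendsto_const])
      show "(\<lambda>n. (C_P + g) * (LINT x|lebesgue_on ?K. \<bar>k (sn n x) - k (s x)\<bar>)) \<longlonglongrightarrow> 0"
        using tendsto_mult_left[OF 3, of "C_P + g"] by simp
      show "\<forall>\<^sub>F n in sequentially. \<bar>?err n\<bar> \<le> (C_P + g) * (LINT x|lebesgue_on ?K. \<bar>k (sn n x) - k (s x)\<bar>)"
        using ev
      proof eventually_elim
        case (elim n)
        have gK: "AE x in lebesgue_on ?K. \<bar>?p' n x\<bar> \<le> C_P" by (rule AE_lebesgue_on_subset[OF grad elim Cs Vs])
        have sK': "AE x in lebesgue_on ?K. sn n x \<in> {0..1}" by (rule AE_lebesgue_on_subset[OF s01 elim Cs Vs])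
        have dm: "(\<lambda>x. \<bar>k (sn n x) - k (s x)\<bar>) \<in> borel_measurable (lebesgue_on ?K)"
          by (intro borel_measurable_abs borel_measurable_diff ksK measurable_lebesgue_on_subset[OF ksm elim])
        have di: "integrable (lebesgue_on ?K) (\<lambda>x. \<bar>k (sn n x) - k (s x)\<bar>)"
        proof (rule integrable_lebesgue_on_bounded[OF dm Cl])
          show "AE x in lebesgue_on ?K. norm \<bar>k (sn n x) - k (s x)\<bar> \<le> k 1"
            using sK' s01K
          proof eventually_elim
            case (elim x)
            then show ?case
              using k_nonneg[OF elim(1)] k_nonneg[OF elim(2)] k_mono[of "s x" 1] k_mono[of "sn n x" 1] by auto
          qed
        qed
        have "\<bar>?err n\<bar> \<le> (LINT x|lebesgue_on ?K. (C_P + g) * \<bar>k (sn n x) - k (s x)\<bar>)"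
        proof (rule abs_integral_le[OF integrable_mult_right[OF di]])
          show "AE x in lebesgue_on ?K. \<bar>(k (sn n x) - k (s x)) * ((?p' n x + g) * w x)\<bar> \<le> (C_P + g) * \<bar>k (sn n x) - k (s x)\<bar>"
            using gK
          proof eventually_elim
            case (elim x)
            have "\<bar>?p' n x + g\<bar> * \<bar>w x\<bar> \<le> (C_P + g) * 1"
              using elim w01[of x] pos by (intro mult_mono) auto
            then have "\<bar>k (sn n x) - k (s x)\<bar> * (\<bar>?p' n x + g\<bar> * \<bar>w x\<bar>) \<le> \<bar>k (sn n x) - k (s x)\<bar> * (C_P + g)"
              by (intro mult_left_mono) auto
            then show ?case by (simp only: abs_mult mult.commute)
          qed
        qed
        then show ?case by (simp only: integral_mult_right_zero)
      qed
    qed simp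
    have "(\<lambda>n. ?err n + ((LINT x|lebesgue_on ?K. ?p' n x * h x) + g * (LINT x|lebesgue_on ?K. h x))
        - c * (LINT x|lebesgue_on ?K. sn n x * w x))
      \<longlonglongrightarrow> 0 + ((LINT x|lebesgue_on ?K. p_z x * h x) + g * (LINT x|lebesgue_on ?K. h x)) - c * (LINT x|lebesgue_on ?K. s x * w x)"
      by (intro tendsto_intros 1 2 4)
    moreover have "0 + ((LINT x|lebesgue_on ?K. p_z x * h x) + g * (LINT x|lebesgue_on ?K. h x)) - c * (LINT x|lebesgue_on ?K. s x * w x)
        = (LINT x|lebesgue_on ?K. ?F x)"
    proof -
      have pzK: "integrable (lebesgue_on ?K) p_z"
        using p_weak_deriv C(1) KU by (intro L1_loc_integrable) (auto simp: has_weak_deriv_def)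
      have i1: "integrable (lebesgue_on ?K) (\<lambda>x. p_z x * h x)"
        by (rule integrable_bounded_mult[OF pzK hmK, where C = "k 1"]) (use hb in auto)
      have "(LINT x|lebesgue_on ?K. ?F x) = (LINT x|lebesgue_on ?K. p_z x * h x + g * h x - c * (s x * w x))"
        by (intro Bochner_Integration.integral_cong) (auto simp: h_def flux_density_def algebra_simps)
      also have "\<dots> = (LINT x|lebesgue_on ?K. p_z x * h x) + g * (LINT x|lebesgue_on ?K. h x) - c * (LINT x|lebesgue_on ?K. s x * w x)"
        using i1 hi L2_on_mult_integrable[OF sK w2] by simp
      finally show ?thesis by simp
    qed
    ultimately have lim': "(\<lambda>n. ?err n + ((LINT x|lebesgue_on ?K. ?p' n x * h x) + g * (LINT x|lebesgue_on ?K. h x))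
        - c * (LINT x|lebesgue_on ?K. sn n x * w x)) \<longlonglongrightarrow> (LINT x|lebesgue_on ?K. ?F x)" by (simp only:)
    then show ?thesis
    proof (rule Lim_transform_eventually)
      show "\<forall>\<^sub>F n in sequentially. ?err n + ((LINT x|lebesgue_on ?K. ?p' n x * h x) + g * (LINT x|lebesgue_on ?K. h x))
        - c * (LINT x|lebesgue_on ?K. sn n x * w x) = (LINT x|lebesgue_on ?K. ?f n x)"
        using ev
      proof eventually_elim
        case (elim n)
        have p'K: "integrable (lebesgue_on ?K) (?p' n)"
          using pwd[of n] C(1) elim by (intro L1_loc_integrable) (auto simp: has_weak_deriv_def)
        have i1: "integrable (lebesgue_on ?K) (\<lambda>x. ?p' n x * h x)"
          by (rule integrable_bounded_mult[OF p'K hmK, where C = "k 1"]) (use hb in auto)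
        have snK: "sn n \<in> borel_measurable (lebesgue_on ?K)" by (rule measurable_lebesgue_on_subset[OF snm elim])
        have s01n: "AE x in lebesgue_on ?K. sn n x \<in> {0..1}" by (rule AE_lebesgue_on_subset[OF s01 elim Cs Vs])
        have snK2: "L2_on ?K (sn n)"
          by (rule L2_on_bounded[OF snK Cl, where C = 1]) (use s01n in \<open>auto elim: eventually_mono\<close>)
        have i2: "integrable (lebesgue_on ?K) (\<lambda>x. sn n x * w x)" by (rule L2_on_mult_integrable[OF snK2 w2])
        have i3: "integrable (lebesgue_on ?K) (?f n)"
          by (rule integrable_lebesgue_on_bounded[OF measurable_lebesgue_on_subset[OF fm elim] Cl])
            (use AE_lebesgue_on_subset[OF fb elim Cs Vs] in auto)
        have e: "(k (sn n x) - k (s x)) * ((?p' n x + g) * w x) = ?f n x - (?p' n x * h x + g * h x) + c * (sn n x * w x)"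
          if "x \<in> ?K" for x using that by (simp add: h_def algebra_simps)
        have "?err n = (LINT x|lebesgue_on ?K. ?f n x - (?p' n x * h x + g * h x) + c * (sn n x * w x))"
          by (intro Bochner_Integration.integral_cong) (simp_all only: space_lebesgue_on e)
        also have "\<dots> = (LINT x|lebesgue_on ?K. ?f n x) - ((LINT x|lebesgue_on ?K. ?p' n x * h x) + g * (LINT x|lebesgue_on ?K. h x))
            + c * (LINT x|lebesgue_on ?K. sn n x * w x)"
          by (simp only: Bochner_Integration.integral_add[OF Bochner_Integration.integrable_diff[OF i3
                Bochner_Integration.integrable_add[OF i1 integrable_mult_right[OF hi]]] integrable_mult_right[OF i2]]
              Bochner_Integration.integral_diff[OF i3 Bochner_Integration.integrable_add[OF i1 integrable_mult_right[OF hi]]]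
              Bochner_Integration.integral_add[OF i1 integrable_mult_right[OF hi]] integral_mult_right_zero)
        finally show ?case by linarith
      qed
    qed
  qed
  \<comment> \<open>The flux densities are bounded by \<open>M_d\<close>, hence the part of the average outside \<open>C m\<close> is at most \<open>M_d\<close> times the measure left out.\<close>
  have step: "F_inf - c * L \<le> (LINT x|lebesgue_on (C m). ?F x) + ((LINT x|lebesgue_on B. M_d) - (LINT x|lebesgue_on (C m). M_d))" for m
  proof -
    have "\<forall>\<^sub>F n in sequentially. F_inf - c * L \<le> (LINT x|lebesgue_on (C m). ?f n x) + ((LINT x|lebesgue_on B. M_d) - (LINT x|lebesgue_on (C m). M_d))"
    proof -
      have "\<forall>\<^sub>F n in sequentially. 1 + 1 + 1 < Hn n" using H unfolding filterlim_at_top_dense by blast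
      then show ?thesis
      proof eventually_elim
        case (elim n)
        have BV: "B \<subseteq> ?V n" using elim by (auto simp: B_def Omega_H_def)
        have fbB: "AE x in lebesgue_on B. \<bar>?f n x\<bar> \<le> M_d" by (rule AE_lebesgue_on_subset[OF fb BV Bs Vs])
        have fiB: "integrable (lebesgue_on B) (?f n)"
          by (rule integrable_lebesgue_on_bounded[OF measurable_lebesgue_on_subset[OF fm BV] Bl]) (use fbB in simp)
        have fiC: "integrable (lebesgue_on (C m)) (?f n)"
          by (rule integrable_lebesgue_on_subset[OF fiB C(2) Cs Bs])
        have f1: "(F_inf - c * L) * 1 \<le> (LINT x|lebesgue_on B. ?f n x)"
          unfolding B_def w_def
          by (rule TW_H_flux_lower_bound[OF TW pos(2,4,1) _ _ elim k_cont grad]) simp_all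
        have f2: "(LINT x|lebesgue_on (C m). M_d - ?f n x) \<le> (LINT x|lebesgue_on B. M_d - ?f n x)"
        proof (rule integral_mono_lebesgue_on_AE)
          show "integrable (lebesgue_on B) (\<lambda>x. M_d - ?f n x)" using Mi[OF Bl] fiB by (rule Bochner_Integration.integrable_diff)
          show "AE x in lebesgue_on B. 0 \<le> M_d - ?f n x" using fbB by eventually_elim linarith
        qed (use C(2) Cs Bs in auto)
        have f3: "(LINT x|lebesgue_on (C m). M_d - ?f n x) = (LINT x|lebesgue_on (C m). M_d) - (LINT x|lebesgue_on (C m). ?f n x)"
          by (rule Bochner_Integration.integral_diff[OF Mi[OF Cl] fiC])
        have f4: "(LINT x|lebesgue_on B. M_d - ?f n x) = (LINT x|lebesgue_on B. M_d) - (LINT x|lebesgue_on B. ?f n x)"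
          by (rule Bochner_Integration.integral_diff[OF Mi[OF Bl] fiB])
        have arith: "\<lbrakk>a * 1 \<le> x; u \<le> v; u = mc - xc; v = mb - x\<rbrakk> \<Longrightarrow> a \<le> xc + (mb - mc)"
          for a x u v mc xc mb :: real by linarith
        show ?case by (rule arith[OF f1 f2 f3 f4])
      qed
    qed
    then show ?thesis
      by (rule tendsto_lowerbound[OF tendsto_add[OF lim tendsto_const]]) simp
  qed
  have "(\<lambda>m. (LINT x|lebesgue_on (C m). ?F x) + ((LINT x|lebesgue_on B. M_d) - (LINT x|lebesgue_on (C m). M_d)))
      \<longlonglongrightarrow> (LINT x|lebesgue_on B. ?F x) + ((LINT x|lebesgue_on B. M_d) - (LINT x|lebesgue_on B. M_d))"
    by (intro tendsto_intros integral_exhaustion[OF Fi Bs C(2) Cs Cex] integral_exhaustion[OF Mi[OF Bl] Bs C(2) Cs Cex])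
  then have "F_inf - c * L \<le> (LINT x|lebesgue_on B. ?F x) + ((LINT x|lebesgue_on B. M_d) - (LINT x|lebesgue_on B. M_d))"
    by (rule LIMSEQ_le_const) (use step in blast)
  also have "\<dots> = bottom_flux g L k c s0 s p * 1"
    unfolding bottom_flux_average[OF zero_less_one zero_less_one] B_def w_def by simp
  finally show ?thesis by simp
qed

end

section \<open>The upper bound for the flux\<close>

lemma plateau_rectangle_integral:
  assumes R0: "0 \<le> R" and lu: "l \<le> u"
  shows "(LINT x|lebesgue_on ({l<..<u} \<times> {Z<..<Z + R + 1}). plateau Z R (snd x)) = (u - l) * R"
proof -
  have "(LINT x|lebesgue_on ({l<..<u} \<times> {Z<..<Z + R + 1}). plateau Z R (snd x))
      = (LINT y|lebesgue_on {l<..<u}. plateau_integral Z R (snd (y, Z + R + 1)) - plateau_integral Z R (snd (y, Z)))"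
  proof (rule integral_vertical_derivative_rectangle)
    have "continuous_on UNIV (plateau_integral Z R)"
      using plateau_integral_has_derivative by (meson DERIV_continuous continuous_at_imp_continuous_on)
    then show "continuous_on (cbox (l, Z) (u, Z + R + 1)) (\<lambda>x. plateau_integral Z R (snd x))"
      by (rule continuous_on_compose2) (auto intro: continuous_intros)
    show "continuous_on (cbox (l, Z) (u, Z + R + 1)) (\<lambda>x. plateau Z R (snd x))"
      by (intro continuous_on_compose2[OF continuous_on_plateau] continuous_intros) auto
    show "((\<lambda>z. plateau_integral Z R (snd (y, z))) has_real_derivative plateau Z R (snd (y, z))) (at z)" for y z
      unfolding snd_conv by (rule plateau_integral_has_derivative)
  qed (use R0 in simp)
  also have "\<dots> = (LINT y|lebesgue_on {l<..<u}. R)"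
    using plateau_integral_eq[OF R0, of Z "Z + R + 1"] plateau_integral_zero[OF R0, of Z Z] by simp
  also have "\<dots> = (u - l) * R" using lu by (simp add: measure_restrict_space)
  finally show ?thesis .
qed

context limit_wave
begin

text \<open>Fubini for a weighted integral over the strip; the integrand is continuous in the open strip only, hence the exhaustion by
  compact rectangles.\<close>

lemma strip_integral_le:
  assumes cG: "continuous_on U G" and Z: "0 < Z" and R: "0 < R"
    and G: "\<And>x. x \<in> U \<Longrightarrow> Z \<le> snd x \<Longrightarrow> 0 \<le> G x \<and> G x \<le> M"
    and e: "\<And>z. Z \<le> z \<Longrightarrow> (LINT y|lebesgue_on {0<..<L}. G (y, z)) \<le> e"
  shows "(LINT x|lebesgue_on ({0<..<L} \<times> {Z<..<Z + R + 1}). G x * plateau Z R (snd x)) \<le> e * R"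
proof -
  let ?T = "Z + R + 1"
  let ?B = "{0<..<L} \<times> {Z<..<?T}" and ?A = "\<lambda>n::nat. {L / real (n + 3)<..<L - L / real (n + 3)} \<times> {Z<..<?T}"
  have R0: "0 \<le> R" using R by simp
  have BU: "?B \<subseteq> U" using Z by (intro strip_subset_Omega) auto
  have GB: "0 \<le> G x \<and> G x \<le> M" if "x \<in> ?B" for x by (rule G) (use that BU in auto)
  have cw: "continuous_on S (\<lambda>x. plateau Z R (snd x))" for S :: "(real \<times> real) set"
    by (intro continuous_on_compose2[OF continuous_on_plateau] continuous_intros) auto
  have i: "integrable (lebesgue_on ?B) (\<lambda>x. G x * plateau Z R (snd x))"
  proof (rule integrable_lebesgue_on_bounded[OF _ rectangle_measurable])
    show "(\<lambda>x. G x * plateau Z R (snd x)) \<in> borel_measurable (lebesgue_on ?B)"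
      by (intro continuous_imp_measurable_on_sets_lebesgue continuous_on_mult continuous_on_subset[OF cG BU] cw rectangle_sets)
    show "AE x in lebesgue_on ?B. norm (G x * plateau Z R (snd x)) \<le> M * 1"
    proof (rule AE_I2)
      fix x assume "x \<in> space (lebesgue_on ?B)"
      then have "0 \<le> G x \<and> G x \<le> M" by (intro GB) simp
      then show "norm (G x * plateau Z R (snd x)) \<le> M * 1"
        unfolding norm_mult using plateau_bounds[OF R0, of Z "snd x"] by (intro mult_mono) auto
    qed
  qed
  have An: "?A n \<subseteq> ?B" for n
  proof -
    have "{L / real (n + 3)<..<L - L / real (n + 3)} \<subseteq> {0<..<L}" using inner_interval[of n] by auto
    then show ?thesis by blast
  qed
  have Aex: "\<forall>\<^sub>F n in sequentially. x \<in> ?A n" if xB: "x \<in> ?B" for x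
  proof -
    have "fst x \<in> {0<..<L}" using xB by auto
    from inner_interval_exhaustion[OF this] show ?thesis
      by eventually_elim (use xB in \<open>auto simp: mem_Times_iff\<close>)
  qed
  have lim: "(\<lambda>n. LINT x|lebesgue_on (?A n). G x * plateau Z R (snd x)) \<longlonglongrightarrow> (LINT x|lebesgue_on ?B. G x * plateau Z R (snd x))"
    by (rule integral_exhaustion[OF i rectangle_sets An rectangle_sets Aex])
  have "(LINT x|lebesgue_on (?A n). G x * plateau Z R (snd x)) \<le> e * R" for n
  proof -
    define a b where "a = L / real (n + 3)" and "b = L - L / real (n + 3)"
    have ab: "0 < a" "a < b" "b < L" using inner_interval[of n] by (simp_all only: a_def b_def)
    have sub: "cbox (a, Z) (b, ?T) \<subseteq> U" using ab Z by (auto simp: cbox_Pair_eq Omega_def)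
    let ?f = "\<lambda>y z. G (y, z) * plateau Z R z"
    have cf: "continuous_on (cbox (a, Z) (b, ?T)) (\<lambda>x. G x * plateau Z R (snd x))"
      by (intro continuous_on_mult continuous_on_subset[OF cG sub] cw)
    then have cf': "continuous_on (cbox (a, Z) (b, ?T)) (\<lambda>(y, z). ?f y z)" by (simp add: case_prod_beta)
    have inner: "integral (cbox a b) (\<lambda>y. ?f y z) \<le> e * plateau Z R z" if z: "z \<in> cbox Z ?T" for z
    proof -
      have line: "(y, z) \<in> U" if "y \<in> {0<..<L}" for y using that z Z by (auto simp: Omega_def)
      have cl: "continuous_on {0<..<L} (\<lambda>y. G (y, z))"
        by (rule continuous_on_compose2[OF cG]) (use line in \<open>auto intro!: continuous_intros\<close>)
      have il: "integrable (lebesgue_on {0<..<L}) (\<lambda>y. G (y, z))"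
      proof (rule integrable_lebesgue_on_bounded[where C = M])
        show "AE y in lebesgue_on {0<..<L}. norm (G (y, z)) \<le> M"
          using G line z by (intro AE_I2) force
      qed (use cl in \<open>auto intro!: continuous_imp_measurable_on_sets_lebesgue\<close>)
      have "integral (cbox a b) (\<lambda>y. G (y, z)) = (LINT y|lebesgue_on (box a b). G (y, z))"
        by (rule lebesgue_on_interior_cbox[symmetric], rule continuous_on_subset[OF cl]) (use ab in auto)
      also have "\<dots> \<le> (LINT y|lebesgue_on {0<..<L}. G (y, z))"
        using il ab G line z
        by (intro integral_mono_lebesgue_on_AE) (force intro!: AE_I2 simp: box_real_interval)+
      also have "\<dots> \<le> e" using z by (intro e) simp
      finally have "integral (cbox a b) (\<lambda>y. G (y, z)) * plateau Z R z \<le> e * plateau Z R z"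
        using plateau_bounds(1)[OF R0] by (rule mult_right_mono)
      then show ?thesis by simp
    qed
    have "(LINT x|lebesgue_on (?A n). G x * plateau Z R (snd x)) = integral (cbox (a, Z) (b, ?T)) (\<lambda>x. G x * plateau Z R (snd x))"
      using lebesgue_on_interior_cbox[OF cf] unfolding a_def b_def rectangle_eq_box .
    also have "\<dots> = integral (cbox a b) (\<lambda>y. integral (cbox Z ?T) (\<lambda>z. ?f y z))"
      using integral_prod_continuous[OF cf] by simp
    also have "\<dots> = integral (cbox Z ?T) (\<lambda>z. integral (cbox a b) (\<lambda>y. ?f y z))"
      by (rule integral_swap_continuous[OF cf'])
    also have "\<dots> \<le> integral (cbox Z ?T) (\<lambda>z. e * plateau Z R z)"
    proof (rule integral_le)
      have "continuous_on (cbox Z ?T) (\<lambda>z. integral (cbox a b) (\<lambda>y. ?f y z))"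
      proof (rule integral_continuous_on_param)
        have "continuous_on (cbox Z ?T \<times> cbox a b) (\<lambda>x. (\<lambda>x. G x * plateau Z R (snd x)) (snd x, fst x))"
          by (rule continuous_on_compose2[OF cf]) (auto simp: cbox_Pair_eq intro!: continuous_intros)
        then show "continuous_on (cbox Z ?T \<times> cbox a b) (\<lambda>(z, y). ?f y z)" by (simp add: case_prod_beta)
      qed
      then show "(\<lambda>z. integral (cbox a b) (\<lambda>y. ?f y z)) integrable_on cbox Z ?T" by (rule integrable_continuous)
      show "(\<lambda>z. e * plateau Z R z) integrable_on cbox Z ?T"
        by (intro integrable_continuous continuous_intros continuous_on_subset[OF continuous_on_plateau]) auto
    qed (rule inner)
    also have "\<dots> = e * integral (cbox Z ?T) (plateau Z R)" by simp
    also have "integral (cbox Z ?T) (plateau Z R) = R"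
    proof -
      have "(plateau Z R has_integral (plateau_integral Z R ?T - plateau_integral Z R Z)) {Z..?T}"
        using R plateau_integral_has_derivative
        by (intro fundamental_theorem_of_calculus)
          (auto simp: has_real_derivative_iff_has_vector_derivative[symmetric] intro: DERIV_subset)
      then show ?thesis
        using plateau_integral_eq[OF R0, of Z ?T] plateau_integral_zero[OF R0, of Z Z] by (simp add: integral_unique)
    qed
    finally show ?thesis .
  qed
  then show ?thesis using LIMSEQ_le_const2[OF lim] by blast
qed

lemma horizontal_line: "y \<in> {0<..<L} \<Longrightarrow> 0 < z \<Longrightarrow> (y, z) \<in> U"
  by (simp add: Omega_def)

lemma ks_line_cont: "0 < z \<Longrightarrow> continuous_on {0<..<L} (\<lambda>y. k (s (y, z)))"
  by (rule continuous_on_compose2[OF ks_cont]) (auto intro!: continuous_intros horizontal_line)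

lemma ks_line_integrable:
  assumes "0 < z"
  shows "integrable (lebesgue_on {0<..<L}) (\<lambda>y. k (s (y, z)))"
proof (rule integrable_lebesgue_on_bounded[where C = "k 1"])
  show "(\<lambda>y. k (s (y, z))) \<in> borel_measurable (lebesgue_on {0<..<L})"
    by (rule continuous_imp_measurable_on_sets_lebesgue[OF ks_line_cont[OF assms]]) simp
  show "AE y in lebesgue_on {0<..<L}. norm (k (s (y, z))) \<le> k 1"
    using ks_bounds[OF horizontal_line[OF _ assms]] by (intro AE_I2) auto
qed simp

lemma ks_mono: "y \<in> {0<..<L} \<Longrightarrow> 0 < z \<Longrightarrow> z \<le> z' \<Longrightarrow> k (s (y, z)) \<le> k (s (y, z'))"
  using s_mono[of y z z'] s_range[OF horizontal_line, of y z] s_range[OF horizontal_line, of y z']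
  by (intro k_mono) auto

text \<open>The horizontal integrals of \<open>k(s)\<close> increase with the height and are bounded, so that \<open>k(s)\<close> is nearly independent
  of the height, in \<open>L\<^sup>1\<close>, from some height on.\<close>

lemma ks_eventually_stationary:
  assumes "e > 0"
  obtains Z where "Z > z1" "Z > 0"
    "\<And>z. Z \<le> z \<Longrightarrow> (LINT y|lebesgue_on {0<..<L}. k (s (y, z)) - k (s (y, Z))) \<le> e"
proof -
  let ?I = "\<lambda>z. LINT y|lebesgue_on {0<..<L}. k (s (y, z))"
  let ?S = "?I ` {max 1 (z1 + 1)..}"
  have k1: "integrable (lebesgue_on {0<..<L}) (\<lambda>y. k 1)"
    by (rule integrable_lebesgue_on_bounded[where C = "k 1"]) (use k1_nonneg in auto)
  have "?I z \<le> (LINT y|lebesgue_on {0<..<L}. k 1)" if "0 < z" for z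
    by (rule integral_mono[OF ks_line_integrable[OF that] k1]) (use ks_bounds(2)[OF horizontal_line] that in auto)
  then have bdd: "bdd_above ?S" by (intro bdd_aboveI[of _ "LINT y|lebesgue_on {0<..<L}. k 1"]) auto
  have "Sup ?S - e < Sup ?S" using assms by simp
  then obtain Z where Z: "max 1 (z1 + 1) \<le> Z" "Sup ?S - e < ?I Z"
    using less_cSup_iff[OF _ bdd] by auto
  show ?thesis
  proof (rule that[of Z])
    fix z assume z: "Z \<le> z"
    have "?I z \<le> Sup ?S" using bdd z Z(1) by (intro cSup_upper) auto
    moreover have "(LINT y|lebesgue_on {0<..<L}. k (s (y, z)) - k (s (y, Z))) = ?I z - ?I Z"
      by (rule Bochner_Integration.integral_diff[OF ks_line_integrable ks_line_integrable]) (use Z z in auto)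
    ultimately show "(LINT y|lebesgue_on {0<..<L}. k (s (y, z)) - k (s (y, Z))) \<le> e" using Z(2) by linarith
  qed (use Z(1) in auto)
qed

text \<open>With a coefficient depending on \<open>y\<close> only, the vertical derivative of \<open>p\<close> may be integrated by parts against the
  plateau weight. The weight varies in two layers of unit height only; the upper one contributes with the favourable sign of the
  bound \<open>p \<le> p_bar\<close>, and the lower one does not depend on \<open>R\<close>.\<close>

lemma pressure_derivative_plateau_bounded:
  assumes \<phi>: "C1_with_gradient \<phi> D" and S: "compact S" "S \<subseteq> {0<..<L}" "\<And>y. y \<notin> S \<Longrightarrow> \<phi> y = 0"
    and b: "\<And>y. 0 \<le> \<phi> y" "\<And>y. \<phi> y \<le> N" and Z: "0 < Z"
  obtains K where "\<And>R. 0 < R \<Longrightarrow>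
    (LINT x|lebesgue_on U. p_z x * (\<phi> (fst x) * plateau Z R (snd x))) \<le> K"
proof -
  have d\<phi>: "(\<phi> has_real_derivative D t) (at t)" for t
    using \<phi> unfolding C1_with_gradient_def by simp
  have cD: "continuous_on UNIV D" using \<phi> unfolding C1_with_gradient_def by simp
  have c\<phi>: "continuous_on UNIV \<phi>" by (rule C1_continuous[OF \<phi>])
  have N: "0 \<le> N" using b[of 0] by linarith
  have pL: "L1_loc U p" using p_weak_deriv by (simp add: has_weak_deriv_def)
  let ?h = "\<lambda>Y x::real \<times> real. \<phi> (fst x) * ramp_deriv (snd x - Y)"
  have ch: "continuous_on A (?h Y)" for A Y
    by (intro continuous_intros continuous_on_compose2[OF c\<phi>] continuous_on_compose2[OF continuous_on_ramp_deriv]) auto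
  have h0: "?h Y x = 0" if "x \<notin> S \<times> {Y..Y + 1}" for Y x
  proof (cases "fst x \<in> S")
    case True
    then have "snd x - Y \<le> 0 \<or> 1 \<le> snd x - Y" using that by (cases x) auto
    then show ?thesis by (simp only: ramp_deriv_zero mult_zero_right)
  next
    case False
    then show ?thesis using S(3) by simp
  qed
  have ph: "integrable (lebesgue_on U) (\<lambda>x. p x * ?h Y x)" if "0 < Y" for Y
  proof (rule L1_loc_mult_integrable[OF pL, of "S \<times> {Y..Y + 1}"])
    show "S \<times> {Y..Y + 1} \<subseteq> U" using S(2) that by (auto simp: Omega_def)
  qed (use S(1) ch h0 open_Omega in \<open>auto intro: compact_Times\<close>)
  have hb: "0 \<le> ?h Y x" "?h Y x \<le> N * 2" for Y x
  proof -
    show "0 \<le> ?h Y x" by (intro mult_nonneg_nonneg b ramp_deriv_bounds)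
    show "?h Y x \<le> N * 2" by (intro mult_mono b ramp_deriv_bounds N)
  qed
  define P where "P = max 0 p_bar * (N * 2)"
  have upper: "(LINT x|lebesgue_on U. p x * ?h Y x) \<le> P * L" if Y: "0 < Y" for Y
  proof -
    let ?B = "{0<..<L} \<times> {Y<..<Y + 1}"
    have BU: "?B \<subseteq> U" using Y by (intro strip_subset_Omega) auto
    have "(LINT x|lebesgue_on U. p x * ?h Y x) = (LINT x|lebesgue_on ?B. p x * ?h Y x)"
    proof (rule integral_lebesgue_on_support[OF BU])
      fix x assume x: "x \<in> U - ?B"
      then have "snd x - Y \<le> 0 \<or> 1 \<le> snd x - Y" by (cases x) (auto simp: Omega_def)
      then show "p x * ?h Y x = 0" by (simp only: ramp_deriv_zero mult_zero_right)
    qed auto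
    also have "\<dots> \<le> (LINT x|lebesgue_on ?B. P)"
    proof (rule integral_mono_AE)
      show "integrable (lebesgue_on ?B) (\<lambda>x. p x * ?h Y x)"
        by (rule integrable_lebesgue_on_subset[OF ph[OF Y] BU]) auto
      show "integrable (lebesgue_on ?B) (\<lambda>x. P)"
        by (rule integrable_continuous_rectangle(2)) simp
      have "AE x in lebesgue_on ?B. p x \<le> p_bar"
        by (rule AE_lebesgue_on_subset[OF p_le BU]) auto
      then show "AE x in lebesgue_on ?B. p x * ?h Y x \<le> P"
      proof eventually_elim
        case (elim x)
        have "p x * ?h Y x \<le> max 0 p_bar * ?h Y x" using elim by (intro mult_right_mono hb) auto
        also have "\<dots> \<le> P" unfolding P_def by (intro mult_left_mono hb) auto
        finally show ?case .
      qed
    qed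
    also have "\<dots> = (LINT y|lebesgue_on {0<..<L}. P * snd (y, Y + 1) - P * snd (y, Y))"
      by (rule integral_vertical_derivative_rectangle[where F = "\<lambda>x. P * snd x"])
        (auto intro!: continuous_intros derivative_eq_intros)
    also have "\<dots> = P * L" using pos(2) by (simp add: algebra_simps measure_restrict_space)
    finally show ?thesis .
  qed
  show ?thesis
  proof (rule that[of "P * L + \<bar>LINT x|lebesgue_on U. p x * ?h Z x\<bar>"])
    fix R :: real assume R: "0 < R"
    then have R0: "0 \<le> R" by simp
    let ?\<psi> = "\<lambda>x::real \<times> real. \<phi> (fst x) * plateau Z R (snd x)"
    let ?E = "\<lambda>x::real \<times> real. \<phi> (fst x) *\<^sub>R (0::real, plateau_deriv Z R (snd x)) + plateau Z R (snd x) *\<^sub>R (D (fst x), 0::real)"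
    have C1: "C1_with_gradient ?\<psi> ?E"
      by (rule C1_mult[OF C1_fst[OF d\<phi> cD] C1_snd[OF plateau_has_derivative continuous_on_plateau_deriv]])
    have supp: "compactly_supported_in U ?\<psi>"
      unfolding compactly_supported_in_def
    proof (intro exI conjI allI impI)
      show "compact (S \<times> {Z..Z + R + 1})" using S(1) by (intro compact_Times) auto
      show "S \<times> {Z..Z + R + 1} \<subseteq> U" using S(2) Z by (auto simp: Omega_def)
      fix x :: "real \<times> real" assume x: "x \<notin> S \<times> {Z..Z + R + 1}"
      show "?\<psi> x = 0"
      proof (cases "fst x \<in> S")
        case True
        then have "snd x \<le> Z \<or> Z + R + 1 \<le> snd x" using x by (cases x) auto
        then show ?thesis by (simp only: plateau_zero[OF R0] mult_zero_right)
      next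
        case False
        then show ?thesis using S(3) by simp
      qed
    qed
    have wd: "(LINT x|lebesgue_on U. p x * (?E x \<bullet> e_z)) = - (LINT x|lebesgue_on U. p_z x * ?\<psi> x)"
      using p_weak_deriv C1 supp unfolding has_weak_deriv_def by blast
    have "?E x \<bullet> e_z = ?h Z x - ?h (Z + R) x" for x
      by (simp add: inner_add_left plateau_deriv_def algebra_simps)
    then have "(LINT x|lebesgue_on U. p x * (?E x \<bullet> e_z)) = (LINT x|lebesgue_on U. p x * ?h Z x - p x * ?h (Z + R) x)"
      by (simp only: right_diff_distrib)
    also have "\<dots> = (LINT x|lebesgue_on U. p x * ?h Z x) - (LINT x|lebesgue_on U. p x * ?h (Z + R) x)"
      by (rule Bochner_Integration.integral_diff[OF ph ph]) (use Z R in auto)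
    finally have "(LINT x|lebesgue_on U. p_z x * ?\<psi> x) = (LINT x|lebesgue_on U. p x * ?h (Z + R) x) - (LINT x|lebesgue_on U. p x * ?h Z x)"
      using wd by linarith
    then show "(LINT x|lebesgue_on U. p_z x * ?\<psi> x) \<le> P * L + \<bar>LINT x|lebesgue_on U. p x * ?h Z x\<bar>"
      using upper[of "Z + R"] Z R by linarith
  qed
qed

end

context limit_wave
begin

text \<open>Far above the bottom, the flux density is compared with \<open>g k(s) - c s\<close>, which by assumption is at most \<open>m = g k(s_star) - c s_star\<close> for saturations in
  \<open>[s_star, 1)\<close>, with a gain \<open>\<gamma> > 0\<close> over an interval of length \<open>len\<close> above which \<open>s\<close> stays away from both \<open>s_star\<close> and \<open>1\<close>. The remaining term
  \<open>k(s) \<partial>\<^sub>z p\<close> is replaced by \<open>\<phi>(y) \<partial>\<^sub>z p\<close>, where \<open>\<phi>\<close> is a test function close to \<open>k(s)\<close> at a fixed height; the error is smaller than the gain, and the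
  new term stays bounded when the weight is spread over a length \<open>R \<rightarrow> \<infinity>\<close>.\<close>

lemma bottom_flux_upper_bound:
  assumes chord: "\<And>t. s_star < t \<Longrightarrow> t < 1 \<Longrightarrow> g * k t - c * t < g * k s_star - c * s_star"
  shows "bottom_flux g L k c s0 s p < (g * k s_star - c * s_star) * L"
proof -
  define m where "m = g * k s_star - c * s_star"
  obtain sb where sb: "0 < sb" "sb < 1" "p_bar \<le> pc sb" using pc_unbounded[of p_bar] by auto
  have sle: "s x \<le> sb" if "x \<in> U" for x by (rule s_le_bar[OF sb that])
  obtain x1 where x1: "x1 \<in> U" "s_star < s x1" using exists_above_star by blast
  obtain y1 z1 where yz1: "x1 = (y1, z1)" "y1 \<in> {0<..<L}" "0 < z1" using x1 by (auto simp: Omega_def)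
  obtain v where v: "s_star < v" "v < s x1" using dense[OF x1(2)] by auto
  have "(y1, z1) \<in> U \<inter> s -` {v<..}" using x1 v yz1 by auto
  from horizontal_neighbourhood[OF s_level_open(2) this yz1(2)]
  obtain a b where ab: "0 < a" "a < y1" "y1 < b" "b < L" and near: "\<And>y. y \<in> {a<..<b} \<Longrightarrow> (y, z1) \<in> U \<inter> s -` {v<..}"
    by blast
  have vsb: "v \<le> sb" using v sle[OF x1(1)] by linarith
  have "\<exists>\<gamma>>0. \<forall>t\<in>{v..sb}. g * k t - c * t \<le> m - \<gamma>"
  proof -
    have "continuous_on {v..sb} (\<lambda>t. m - (g * k t - c * t))"
      by (intro continuous_intros continuous_on_subset[OF k_cont]) (use v s_star sb in auto)
    from continuous_attains_inf[OF compact_Icc _ this] vsb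
    obtain t0 where t0: "t0 \<in> {v..sb}" "\<And>t. t \<in> {v..sb} \<Longrightarrow> m - (g * k t0 - c * t0) \<le> m - (g * k t - c * t)"
      by auto
    have "0 < m - (g * k t0 - c * t0)" using chord[of t0] t0(1) v sb by (auto simp: m_def)
    then show ?thesis using t0(2) by (intro exI[of _ "m - (g * k t0 - c * t0)"]) force
  qed
  then obtain \<gamma> where \<gamma>: "\<gamma> > 0" "\<And>t. t \<in> {v..sb} \<Longrightarrow> g * k t - c * t \<le> m - \<gamma>" by blast
  have le_m: "g * k t - c * t \<le> m" if "s_star \<le> t" "t < 1" for t
    using chord[of t] that by (cases "t = s_star") (auto simp: m_def)
  define len where "len = b - a"
  have len: "len > 0" using ab by (simp add: len_def)
  \<comment> \<open>The error \<open>C_P * (2 * e)\<close> of the two approximations must stay below the gain \<open>\<gamma> * len\<close>; \<open>C_P\<close> itself may vanish.\<close>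
  define e where "e = \<gamma> * len / 2 / (C_P + 1)"
  have C1: "0 < C_P + 1" using pos(5) by simp
  have e: "e > 0" unfolding e_def using \<gamma>(1) len C1 by (intro divide_pos_pos mult_pos_pos) auto
  define \<delta> where "\<delta> = \<gamma> * len - C_P * (2 * e)"
  have \<delta>: "\<delta> > 0"
  proof -
    have "C_P + 1 \<noteq> 0" using C1 by simp
    then have "e * (C_P + 1) = \<gamma> * len / 2"
      unfolding e_def by (rule nonzero_eq_divide_eq[THEN iffD1, OF _ refl])
    then have "(C_P + 1) * (2 * e) = \<gamma> * len" by (simp add: algebra_simps)
    moreover have "(C_P + 1) * (2 * e) = C_P * (2 * e) + 2 * e" by (simp only: distrib_right mult_1_left)
    ultimately show ?thesis unfolding \<delta>_def using e by linarith
  qed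
  obtain Z where Z: "Z > z1" "Z > 0"
    and stat: "\<And>z. Z \<le> z \<Longrightarrow> (LINT y|lebesgue_on {0<..<L}. k (s (y, z)) - k (s (y, Z))) \<le> e"
    using ks_eventually_stationary[OF e] by blast
  let ?a = "\<lambda>y. k (s (y, Z))"
  have aU: "0 \<le> ?a y" "?a y \<le> k 1" if "y \<in> {0<..<L}" for y
    using ks_bounds[OF horizontal_line[OF that Z(2)]] by auto
  have am: "?a \<in> borel_measurable (lebesgue_on {0<..<L})"
    by (rule continuous_imp_measurable_on_sets_lebesgue[OF ks_line_cont[OF Z(2)]]) simp
  obtain \<phi> D S where \<phi>: "C1_with_gradient \<phi> D" "compact S" "S \<subseteq> {0<..<L}" "\<And>y. y \<notin> S \<Longrightarrow> \<phi> y = 0"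
    "\<And>y. 0 \<le> \<phi> y" "\<And>y. \<phi> y \<le> k 1 + 2" and small: "(LINT y|lebesgue_on {0<..<L}. \<bar>?a y - \<phi> y\<bar>) < e"
  proof (rule C1_dense_L1[of "{0<..<L}" ?a 0 "k 1" e])
    show "0 \<le> k 1" by (rule k1_nonneg)
  qed (use am aU e in auto)
  obtain K where K: "\<And>R. 0 < R \<Longrightarrow> (LINT x|lebesgue_on U. p_z x * (\<phi> (fst x) * plateau Z R (snd x))) \<le> K"
    using pressure_derivative_plateau_bounded[OF \<phi>(1,2,3,4,5,6) Z(2)] by blast
  have c\<phi>: "continuous_on A \<phi>" for A by (rule C1_continuous[OF \<phi>(1)])
  let ?F = "bottom_flux g L k c s0 s p"
  define G where "G = (\<lambda>x. k (s x) - ?a (fst x) + \<bar>?a (fst x) - \<phi> (fst x)\<bar>)"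
  have ca: "continuous_on U (\<lambda>x. ?a (fst x))"
    by (rule continuous_on_compose2[OF ks_line_cont[OF Z(2)]]) (auto simp: Omega_def intro!: continuous_intros)
  have cp: "continuous_on U (\<lambda>x. \<phi> (fst x))"
    by (rule continuous_on_compose2[OF c\<phi>[of UNIV]]) (auto intro!: continuous_intros)
  have cG: "continuous_on U G"
    unfolding G_def by (intro continuous_intros ks_cont ca cp)
  have ge_a: "?a (fst x) \<le> k (s x)" if "x \<in> U" "Z \<le> snd x" for x
    using ks_mono[of "fst x" Z "snd x"] that Z(2) by (cases x) (auto simp: Omega_def)
  have fst_U: "fst x \<in> {0<..<L}" if "x \<in> U" for x using that by (auto simp: Omega_def)
  have Gb: "0 \<le> G x \<and> G x \<le> 3 * k 1 + 2" if "x \<in> U" "Z \<le> snd x" for x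
  proof -
    have "\<bar>?a (fst x) - \<phi> (fst x)\<bar> \<le> k 1 + 2"
      using aU[OF fst_U[OF that(1)]] \<phi>(5,6)[of "fst x"] by (simp add: abs_le_iff)
    then show ?thesis
      using ge_a[OF that] ks_bounds[OF that(1)] aU[OF fst_U[OF that(1)]] k1_nonneg unfolding G_def by linarith
  qed
  have Gline: "(LINT y|lebesgue_on {0<..<L}. G (y, z)) \<le> 2 * e" if z: "Z \<le> z" for z
  proof -
    have z0: "0 < z" using z Z(2) by linarith
    have \<phi>2: "L2_on {0<..<L} \<phi>" by (rule L2_on_continuous_bounded_set[OF c\<phi>]) auto
    have \<phi>i: "integrable (lebesgue_on {0<..<L}) \<phi>" by (rule L2_on_integrable[OF \<phi>2]) simp
    have i1: "integrable (lebesgue_on {0<..<L}) (\<lambda>y. k (s (y, z)) - ?a y)"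
      by (rule Bochner_Integration.integrable_diff[OF ks_line_integrable[OF z0] ks_line_integrable[OF Z(2)]])
    have i2: "integrable (lebesgue_on {0<..<L}) (\<lambda>y. \<bar>?a y - \<phi> y\<bar>)"
      by (rule integrable_abs[OF Bochner_Integration.integrable_diff[OF ks_line_integrable[OF Z(2)] \<phi>i]])
    have "(LINT y|lebesgue_on {0<..<L}. G (y, z)) = (LINT y|lebesgue_on {0<..<L}. k (s (y, z)) - ?a y) + (LINT y|lebesgue_on {0<..<L}. \<bar>?a y - \<phi> y\<bar>)"
      unfolding G_def fst_conv by (rule Bochner_Integration.integral_add[OF i1 i2])
    then show ?thesis using stat[OF z] small by linarith
  qed
  have main: "?F * R \<le> m * (L * R) - \<gamma> * (len * R) + C_P * (2 * e * R) + K" if R: "0 < R" for R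
  proof -
    have R0: "0 \<le> R" using R by simp
    define T where "T = Z + R + 1"
    define B where "B = {0<..<L} \<times> {Z<..<T}"
    define A where "A = {a<..<b} \<times> {Z<..<T}"
    let ?w = "\<lambda>x::real \<times> real. plateau Z R (snd x)"
    have w01: "0 \<le> ?w x" "?w x \<le> 1" for x by (rule plateau_bounds[OF R0])+
    have BU: "B \<subseteq> U" unfolding B_def using Z by (intro strip_subset_Omega) auto
    have Bl: "B \<in> lmeasurable" and Bs: "B \<in> sets lebesgue" and As: "A \<in> sets lebesgue"
      unfolding B_def A_def by (rule rectangle_measurable rectangle_sets)+
    have AB: "A \<subseteq> B" using ab by (auto simp: A_def B_def)
    have cw: "continuous_on S ?w" for S
      by (intro continuous_on_compose2[OF continuous_on_plateau] continuous_intros) auto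
    have wm: "?w \<in> borel_measurable (lebesgue_on B)" by (rule continuous_imp_measurable_on_sets_lebesgue[OF cw Bs])
    have iw: "integrable (lebesgue_on B) ?w"
      unfolding B_def by (rule integrable_continuous_rectangle(2)[OF cw])
    have iA: "integrable (lebesgue_on B) (\<lambda>x. indicat_real A x * ?w x)"
    proof (rule Bochner_Integration.integrable_bound[OF iw])
      have "indicat_real A \<in> borel_measurable (lebesgue_on B)"
        using As by (intro measurable_restrict_space1) simp
      then show "(\<lambda>x. indicat_real A x * ?w x) \<in> borel_measurable (lebesgue_on B)"
        using wm by (rule borel_measurable_times)
    qed (auto simp: indicator_def)
    have mG: "G \<in> borel_measurable (lebesgue_on B)"
      by (rule continuous_imp_measurable_on_sets_lebesgue[OF continuous_on_subset[OF cG BU] Bs])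
    have GB: "0 \<le> G x \<and> G x \<le> 3 * k 1 + 2" if "x \<in> B" for x
      by (rule Gb) (use that BU in \<open>auto simp: B_def\<close>)
    have iGB: "integrable (lebesgue_on B) G"
      by (rule integrable_lebesgue_on_bounded[OF mG Bl, where C = "3 * k 1 + 2"]) (use GB in \<open>auto intro!: AE_I2\<close>)
    have iG: "integrable (lebesgue_on B) (\<lambda>x. G x * ?w x)"
      by (rule integrable_bounded_mult[OF iGB wm, where C = 1]) (use w01 in auto)
    have pzB: "integrable (lebesgue_on B) p_z"
    proof (rule integrable_lebesgue_on_bounded[OF measurable_lebesgue_on_subset[OF p_z_measurable BU] Bl])
      show "AE x in lebesgue_on B. norm (p_z x) \<le> C_P"
        using AE_lebesgue_on_subset[OF p_grad[OF e_z_Basis] BU Bs] by simp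
    qed
    have ip: "integrable (lebesgue_on B) (\<lambda>x. p_z x * (\<phi> (fst x) * ?w x))"
    proof (rule integrable_bounded_mult[OF pzB])
      show "(\<lambda>x. \<phi> (fst x) * ?w x) \<in> borel_measurable (lebesgue_on B)"
        by (intro continuous_imp_measurable_on_sets_lebesgue continuous_on_mult continuous_on_subset[OF cp BU] cw Bs)
      show "AE x in lebesgue_on B. \<bar>\<phi> (fst x) * ?w x\<bar> \<le> (k 1 + 2) * 1"
        unfolding abs_mult using w01 \<phi>(5,6) k1_nonneg by (intro AE_I2 mult_mono) auto
    qed
    have ifd: "integrable (lebesgue_on B) (\<lambda>x. flux_density x * ?w x)"
    proof (rule integrable_bounded_mult[OF _ wm])
      show "integrable (lebesgue_on B) flux_density"
        by (rule integrable_lebesgue_on_bounded[OF measurable_lebesgue_on_subset[OF flux_density_measurable BU] Bl])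
          (use AE_lebesgue_on_subset[OF flux_density_bounded BU Bs] in simp)
    qed (use w01 in \<open>auto intro!: AE_I2\<close>)
    have w0: "?w x = 0" if "x \<in> {0<..<L} \<times> {0<..<T} - B" for x
      by (rule plateau_zero[OF R0]) (use that in \<open>cases x; auto simp: B_def\<close>)
    have "?F * R = (LINT x|lebesgue_on ({0<..<L} \<times> {0<..<T}). flux_density x * ?w x)"
      unfolding T_def by (rule bottom_flux_average[OF Z(2) R])
    also have "\<dots> = (LINT x|lebesgue_on B. flux_density x * ?w x)"
      by (rule integral_lebesgue_on_support) (use w0 Bs Z in \<open>auto simp: B_def\<close>)
    also have "\<dots> \<le> (LINT x|lebesgue_on B. m * ?w x - \<gamma> * (indicat_real A x * ?w x) + C_P * (G x * ?w x) + p_z x * (\<phi> (fst x) * ?w x))"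
    proof (rule integral_mono_AE[OF ifd])
      show "integrable (lebesgue_on B) (\<lambda>x. m * ?w x - \<gamma> * (indicat_real A x * ?w x) + C_P * (G x * ?w x) + p_z x * (\<phi> (fst x) * ?w x))"
        by (intro Bochner_Integration.integrable_add Bochner_Integration.integrable_diff integrable_mult_right iw iA iG ip)
      have "AE x in lebesgue_on B. x \<in> B" by (rule AE_I2) simp
      moreover have "AE x in lebesgue_on B. \<bar>p_z x\<bar> \<le> C_P"
        by (rule AE_lebesgue_on_subset[OF p_grad[OF e_z_Basis] BU Bs]) simp
      ultimately show "AE x in lebesgue_on B. flux_density x * ?w x
          \<le> m * ?w x - \<gamma> * (indicat_real A x * ?w x) + C_P * (G x * ?w x) + p_z x * (\<phi> (fst x) * ?w x)"
      proof eventually_elim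
        case (elim x)
        have xU: "x \<in> U" and zx: "Z \<le> snd x" using elim(1) BU by (auto simp: B_def)
        have sx: "s_star \<le> s x" "s x \<le> sb" using s_ge_star[OF xU] sle[OF xU] by auto
        have 1: "g * k (s x) - c * s x \<le> m - \<gamma> * indicat_real A x"
        proof (cases "x \<in> A")
          case True
          then obtain y z where xyz: "x = (y, z)" "y \<in> {a<..<b}" "Z < z" by (auto simp: A_def)
          have "s (y, z1) \<le> s (y, z)" using xyz ab yz1 Z by (intro s_mono) auto
          then have "s x \<in> {v..sb}" using near[OF xyz(2)] xyz(1) sx by auto
          then show ?thesis using \<gamma>(2)[of "s x"] True by simp
        next
          case False
          then show ?thesis using le_m[of "s x"] sx sb by simp
        qed
        have "(k (s x) - \<phi> (fst x)) * p_z x \<le> \<bar>k (s x) - \<phi> (fst x)\<bar> * \<bar>p_z x\<bar>"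
          unfolding abs_mult[symmetric] by (rule abs_ge_self)
        also have "\<dots> \<le> G x * C_P"
          using ge_a[OF xU zx] elim(2) GB[OF elim(1)] by (intro mult_mono) (auto simp: G_def)
        finally have 2: "(k (s x) - \<phi> (fst x)) * p_z x \<le> C_P * G x" by (simp only: mult.commute)
        have "flux_density x = (g * k (s x) - c * s x) + (k (s x) - \<phi> (fst x)) * p_z x + p_z x * \<phi> (fst x)"
          unfolding flux_density_def by (simp add: algebra_simps)
        then have "flux_density x \<le> m - \<gamma> * indicat_real A x + C_P * G x + p_z x * \<phi> (fst x)"
          using 1 2 by linarith
        from mult_right_mono[OF this w01(1)[of x]] show ?case by (simp add: algebra_simps)
      qed
    qed
    also have "\<dots> = m * (LINT x|lebesgue_on B. ?w x) - \<gamma> * (LINT x|lebesgue_on B. indicat_real A x * ?w x)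
        + C_P * (LINT x|lebesgue_on B. G x * ?w x) + (LINT x|lebesgue_on B. p_z x * (\<phi> (fst x) * ?w x))"
      using iw iA iG ip by simp
    also have "(LINT x|lebesgue_on B. ?w x) = L * R"
      unfolding B_def T_def using plateau_rectangle_integral[OF R0, of 0 L Z] pos(2) by simp
    also have "(LINT x|lebesgue_on B. indicat_real A x * ?w x) = len * R"
    proof -
      have "(LINT x|lebesgue_on B. indicat_real A x * ?w x) = (LINT x|lebesgue_on A. indicat_real A x * ?w x)"
        by (rule integral_lebesgue_on_support[OF AB As Bs]) simp
      also have "\<dots> = (LINT x|lebesgue_on A. ?w x)" by (intro Bochner_Integration.integral_cong) auto
      also have "\<dots> = len * R"
        unfolding A_def T_def len_def using plateau_rectangle_integral[OF R0, of a b Z] ab by simp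
      finally show ?thesis .
    qed
    also have "(LINT x|lebesgue_on B. p_z x * (\<phi> (fst x) * ?w x)) = (LINT x|lebesgue_on U. p_z x * (\<phi> (fst x) * ?w x))"
    proof (rule integral_lebesgue_on_support[OF BU Bs Omega_sets, symmetric])
      fix x assume x: "x \<in> U - B"
      have "?w x = 0" by (rule plateau_zero[OF R0]) (use x in \<open>cases x; auto simp: B_def T_def Omega_def\<close>)
      then show "p_z x * (\<phi> (fst x) * ?w x) = 0" by simp
    qed
    finally have bd: "?F * R \<le> m * (L * R) - \<gamma> * (len * R) + C_P * (LINT x|lebesgue_on B. G x * ?w x)
        + (LINT x|lebesgue_on U. p_z x * (\<phi> (fst x) * ?w x))" .
    have "(LINT x|lebesgue_on B. G x * ?w x) \<le> 2 * e * R"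
      unfolding B_def T_def by (rule strip_integral_le[OF cG Z(2) R Gb Gline])
    from mult_left_mono[OF this pos(5)] show ?thesis using bd K[OF R] by linarith
  qed
  show ?thesis
  proof (rule ccontr)
    assume "\<not> ?thesis"
    then have ge: "m * L \<le> ?F" by (simp add: m_def)
    \<comment> \<open>Both sides of the estimate grow linearly in \<open>R\<close>, up to the constant \<open>K\<close>; a large \<open>R\<close> decides.\<close>
    define R where "R = (\<bar>K\<bar> + 1) / \<delta>"
    have R: "R > 0" unfolding R_def using \<delta> by (intro divide_pos_pos) auto
    have "m * L * R \<le> ?F * R" using ge R by (intro mult_right_mono) auto
    then have "m * (L * R) \<le> m * (L * R) - \<gamma> * (len * R) + C_P * (2 * e * R) + K" using main[OF R] by (simp add: mult.assoc)
    moreover have "\<delta> * R = \<gamma> * (len * R) - C_P * (2 * e * R)" by (simp add: \<delta>_def algebra_simps)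
    ultimately have "\<delta> * R \<le> K" by linarith
    moreover have "\<delta> * R = \<bar>K\<bar> + 1" using \<delta> by (simp add: R_def)
    ultimately show False by linarith
  qed
qed

end

section \<open>Convexity and the choice of the wave speed\<close>

context
  fixes k pc :: "real \<Rightarrow> real" and s_star :: real
  assumes coeff: "coefficient_functions k pc s_star" and s_star: "s_star \<in> {0<..<1}"
begin

lemma pc_strict_mono:
  assumes "0 < x" "x < y" "y < 1"
  shows "pc x < pc y"
proof (rule DERIV_pos_imp_increasing[OF assms(2)])
  fix t assume t: "x \<le> t" "t \<le> y"
  then have "t \<in> {0<..<1}" using assms by auto
  then have "DERIV pc t :> deriv pc t" "deriv pc t > 0"
    using coeff unfolding coefficient_functions_def
    by (auto simp: DERIV_deriv_iff_real_differentiable dest: bspec less_le_trans)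
  then show "\<exists>d. DERIV pc t :> d \<and> d > 0" by blast
qed

lemma pc_unbounded_above: "\<exists>x\<in>{0<..<1}. M \<le> pc x"
proof -
  have "filterlim pc at_top (at_left 1)" using coeff by (simp add: coefficient_functions_def)
  then have "\<forall>\<^sub>F x in at_left 1. M \<le> pc x" by (simp add: filterlim_at_top)
  then obtain b where b: "b < 1" "\<forall>y>b. y < 1 \<longrightarrow> M \<le> pc y" unfolding eventually_at_left_field by blast
  define x where "x = (max b 0 + 1) / 2"
  have "x \<in> {0<..<1}" "b < x" using b(1) by (auto simp: x_def)
  then show ?thesis using b(2) by auto
qed

lemma k_continuous: "continuous_on {0..1} k"
  using coeff by (auto simp: coefficient_functions_def intro: differentiable_imp_continuous_on)

lemma k_deriv:
  assumes "t \<in> {0<..<1}"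
  shows "DERIV k t :> deriv k t" "deriv k t > 0"
proof -
  have "k differentiable (at t within {0..1})"
    using coeff assms by (auto simp: coefficient_functions_def differentiable_on_def)
  moreover have "at t within {0..1} = at t"
    using assms by (intro at_within_interior) (simp add: interior_atLeastAtMost_real)
  ultimately show "DERIV k t :> deriv k t" by (simp add: DERIV_deriv_iff_real_differentiable)
  show "deriv k t > 0" using coeff assms by (auto simp: coefficient_functions_def)
qed

lemma deriv_k_strict_mono:
  assumes "0 < x" "x < y" "y < 1"
  shows "deriv k x < deriv k y"
proof (rule DERIV_pos_imp_increasing[OF assms(2)])
  fix t assume t: "x \<le> t" "t \<le> y"
  then have "t \<in> {0<..<1}" using assms by auto
  then have "DERIV (deriv k) t :> deriv (deriv k) t" "deriv (deriv k) t > 0"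
    using coeff unfolding coefficient_functions_def
    by (auto simp: DERIV_deriv_iff_real_differentiable)
  then show "\<exists>d. DERIV (deriv k) t :> d \<and> d > 0" by blast
qed

lemma k_increasing:
  assumes "0 \<le> x" "x \<le> y" "y \<le> 1"
  shows "k x \<le> k y"
proof (cases "x = y")
  case False
  have "k x < k y"
  proof (rule DERIV_pos_imp_increasing_open[of x y k])
    show "x < y" using False assms by simp
    fix t assume "x < t" "t < y"
    then have "t \<in> {0<..<1}" using assms by auto
    then show "\<exists>d. DERIV k t :> d \<and> 0 < d" using k_deriv by blast
  qed (use continuous_on_subset[OF k_continuous] assms in auto)
  then show ?thesis by simp
qed simp

lemma k_mean_value:
  assumes "0 \<le> x" "x < y" "y \<le> 1"
  obtains t where "x < t" "t < y" "k y - k x = (y - x) * deriv k t"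
proof -
  have c: "continuous_on {x..y} k" using continuous_on_subset[OF k_continuous] assms by auto
  have d: "k differentiable (at t)" if "x < t" "t < y" for t
    using k_deriv(1)[of t] that assms by (auto simp: real_differentiable_def)
  obtain l t where t: "x < t" "t < y" "DERIV k t :> l" "k y - k x = (y - x) * l"
    using MVT[OF assms(2) c d] by blast
  have "l = deriv k t" using t(3) by (simp add: DERIV_imp_deriv)
  then show ?thesis using that t by blast
qed

lemma tangent_below_chord: "deriv k s_star < (k 1 - k s_star) / (1 - s_star)"
proof -
  obtain t where t: "s_star < t" "t < 1" "k 1 - k s_star = (1 - s_star) * deriv k t"
    using k_mean_value[of s_star 1] s_star by auto
  have "deriv k s_star < deriv k t" using deriv_k_strict_mono[of s_star t] t s_star by auto
  moreover have "(k 1 - k s_star) / (1 - s_star) = deriv k t" using t s_star by simp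
  ultimately show ?thesis by simp
qed

text \<open>The chord slopes from \<open>s_star\<close> to \<open>t\<close> and from \<open>t\<close> to \<open>1\<close> are values of \<open>k'\<close> at increasing points; the slope from \<open>s_star\<close> to \<open>1\<close>
  is a weighted mean of the two.\<close>

lemma k_below_chord:
  assumes t: "s_star < t" "t < 1"
  shows "k t - k s_star < (k 1 - k s_star) / (1 - s_star) * (t - s_star)"
proof -
  obtain t1 where t1: "s_star < t1" "t1 < t" "k t - k s_star = (t - s_star) * deriv k t1"
    using k_mean_value[of s_star t] s_star t by auto
  obtain t2 where t2: "t < t2" "t2 < 1" "k 1 - k t = (1 - t) * deriv k t2"
    using k_mean_value[of t 1] s_star t by auto
  have lt: "deriv k t1 < deriv k t2" using deriv_k_strict_mono[of t1 t2] t1 t2 s_star by auto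
  have "(k t - k s_star) * (1 - s_star) = (t - s_star) * deriv k t1 * (1 - t) + (t - s_star) * deriv k t1 * (t - s_star)"
    unfolding t1(3) by (simp add: algebra_simps)
  also have "\<dots> < (t - s_star) * deriv k t2 * (1 - t) + (t - s_star) * deriv k t1 * (t - s_star)"
    using lt t by simp
  also have "\<dots> = (k 1 - k s_star) * (t - s_star)"
  proof -
    have eq: "k 1 - k s_star = (1 - t) * deriv k t2 + (t - s_star) * deriv k t1" using t1(3) t2(3) by linarith
    show ?thesis unfolding eq by (simp add: algebra_simps)
  qed
  finally have less: "(k t - k s_star) * (1 - s_star) < (k 1 - k s_star) * (t - s_star)" .
  have p: "0 < 1 - s_star" using s_star by auto
  have "k t - k s_star < (k 1 - k s_star) * (t - s_star) / (1 - s_star)"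
    by (subst pos_less_divide_eq[OF p]) (rule less)
  then show ?thesis by (simp only: times_divide_eq_left)
qed

end

text \<open>The bounds on \<open>p\<^sub>H\<close> and its gradient are inherited by the limit, the latter since the gradients converge weakly.\<close>

lemma limit_wave_if_limit_solution:
  assumes pos: "0 < g" "0 < L" "0 < \<tau>" "0 < c" "0 < C_P"
    and s_star: "s_star \<in> {0<..<1}" and coeff: "coefficient_functions k pc s_star"
    and s0: "continuous_on {0<..<L} s0"
    and data: "\<forall>y\<in>{0<..<L}. s0 y \<in> {0<..<1} \<and> pc s_star \<le> pc (s0 y) \<and> pc (s0 y) < p0 y"
    and H: "filterlim Hn at_top sequentially"
    and TW: "\<And>n. TW_H_solution g L k pc (Hn n) c \<tau> F_inf s0 p0 (sH n) (pH n)"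
    and p_bar: "\<And>n. AE x in lebesgue_on (Omega_H L (Hn n)). pH n x \<le> p_bar"
    and grad: "\<And>n. AE x in lebesgue_on (Omega_H L (Hn n)). norm (weak_gradient (Omega_H L (Hn n)) (pH n) x) \<le> C_P"
    and lim: "limit_solution g L k pc c \<tau> s0 p0 sH pH s p"
  shows "limit_wave g L \<tau> c s_star k pc s0 p0 s p C_P p_bar"
    and "F_inf - c * L \<le> bottom_flux g L k c s0 s p"
proof -
  note l = lim[unfolded limit_solution_def Let_def]
  obtain r :: "nat \<Rightarrow> nat" where r: "strict_mono r"
    and conv: "\<And>K. compact K \<Longrightarrow> K \<subseteq> Omega L \<Longrightarrow> L2_converges K (\<lambda>n. sH (r n)) s"
      "\<And>K. compact K \<Longrightarrow> K \<subseteq> Omega L \<Longrightarrow> L2_converges K (\<lambda>n. pH (r n)) p"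
    using conjunct1[OF l] by blast
  have Hr: "filterlim (\<lambda>n. Hn (r n)) at_top sequentially"
    by (rule filterlim_compose[OF H filterlim_subseq[OF r]])
  note coerc = compact_eventually_below[OF Hr]
  have pwd: "weakly_differentiable (Omega L) p"
    using l by (auto simp: in_H2_loc_def in_H1_loc_def)
  have pL: "L1_loc (Omega L) p"
    using weakly_differentiable_weak_deriv[OF pwd e_z_Basis] by (simp add: has_weak_deriv_def)
  have bound: "AE x in lebesgue_on (Omega_H L (Hn n)). \<bar>weak_deriv (Omega_H L (Hn n)) b (pH n) x\<bar> \<le> C_P"
    if b: "b \<in> Basis" for b n
    using grad[of n]
  proof eventually_elim
    case (elim x)
    then show ?case
      using Basis_le_norm[OF b, of "weak_gradient (Omega_H L (Hn n)) (pH n) x"] by (simp add: weak_gradient_inner_Basis[OF b])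
  qed
  have wdn: "has_weak_deriv (Omega_H L (Hn n)) b (pH n) (weak_deriv (Omega_H L (Hn n)) b (pH n))"
    if b: "b \<in> Basis" for b n
    using TW[of n] unfolding TW_H_solution_def Let_def in_H1_def
    by (intro weakly_differentiable_weak_deriv[OF _ b]) blast
  show wave: "limit_wave g L \<tau> c s_star k pc s0 p0 s p C_P p_bar"
  proof
    show "0 < s_star" "s_star < 1" using s_star by auto
    show "continuous_on {0..1} k" by (rule k_continuous[OF coeff s_star])
    show "0 \<le> k x" if "x \<in> {0..1}" for x using coeff that by (auto simp: coefficient_functions_def)
    show "k x \<le> k y" if "0 \<le> x" "x \<le> y" "y \<le> 1" for x y by (rule k_increasing[OF coeff s_star that])
    show "pc s_star = 0" using coeff by (simp add: coefficient_functions_def)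
    show mono: "pc x < pc y" if "0 < x" "x < y" "y < 1" for x y by (rule pc_strict_mono[OF coeff s_star that])
    show "\<exists>x\<in>{0<..<1}. M \<le> pc x" for M by (rule pc_unbounded_above[OF coeff s_star])
    show "s0 y < 1" "pc (s0 y) < p0 y" if "y \<in> {0<..<L}" for y using data that by auto
    show "s_star \<le> s0 y" if y: "y \<in> {0<..<L}" for y
    proof (rule ccontr)
      assume "\<not> s_star \<le> s0 y"
      then have "pc (s0 y) < pc s_star" using data y s_star by (intro mono) auto
      then show False using data y by force
    qed
    show "weakly_differentiable (Omega L) p" by (rule pwd)
    show "AE x in lebesgue_on (Omega L). \<bar>weak_deriv (Omega L) b p x\<bar> \<le> C_P" if b: "b \<in> Basis" for b
      using weak_deriv_limit_bounded[where U = "Omega L" and V = "\<lambda>n. Omega_H L (Hn (r n))" and fn = "\<lambda>n. pH (r n)"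
          and gn = "\<lambda>n. weak_deriv (Omega_H L (Hn (r n))) b (pH (r n))" and f = p and b = b and C = C_P,
          OF open_Omega Omega_H_open coerc conv(2) wdn[OF b] weakly_differentiable_weak_deriv[OF pwd b] bound[OF b]] pos(5)
      by simp
    show "AE x in lebesgue_on (Omega L). p x \<le> p_bar"
      by (rule AE_le_L2_limit[OF open_Omega pL _ coerc conv(2) p_bar]) (simp_all add: Omega_H_open)
  qed (use l pos s0 in \<open>auto simp del: split_paired_All\<close>)
  show "F_inf - c * L \<le> bottom_flux g L k c s0 s p"
    by (rule limit_wave.bottom_flux_lower_bound[OF wave Hr TW bound[OF e_z_Basis] conv])
qed

theorem theorem4p7:
  fixes g L \<tau> s_star F_inf c1 c2 :: real
    and k pc s0 p0 :: "real \<Rightarrow> real"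
    and H :: "real \<Rightarrow> nat \<Rightarrow> real"
    and sH pH :: "real \<Rightarrow> nat \<Rightarrow> real \<times> real \<Rightarrow> real"
    and S P :: "real \<Rightarrow> real \<times> real \<Rightarrow> real"
  assumes "g > 0" and "L > 0" and "\<tau> > 0" and "s_star \<in> {0<..<1}"
    and "coefficient_functions k pc s_star"
    and "s0 C1_differentiable_on {0<..<L}" and "p0 C1_differentiable_on {0<..<L}"
    and "\<forall>y\<in>{0<..<L}. s0 y \<in> {0<..<1} \<and> pc s_star \<le> pc (s0 y) \<and> pc (s0 y) < p0 y"
    and "g * L * (k s_star + deriv k s_star * (1 - s_star)) < F_inf"
    and "F_inf < g * L * k 1"
    and "c1 = deriv k s_star * g"
    and "c2 = g * (k 1 - k s_star) / (1 - s_star)"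
    and "\<forall>c\<in>{c1..c2}. (\<forall>n. H c n > 0) \<and> filterlim (H c) at_top sequentially \<and>
           (\<forall>n. TW_H_solution g L k pc (H c n) c \<tau> F_inf s0 p0 (sH c n) (pH c n)) \<and>
           (\<exists>p_bar. \<forall>n. AE x in lebesgue_on (Omega_H L (H c n)). pH c n x \<le> p_bar) \<and>
           (\<exists>C_P>0. \<forall>n. AE x in lebesgue_on (Omega_H L (H c n)).
              norm (weak_gradient (Omega_H L (H c n)) (pH c n) x) \<le> C_P) \<and>
           (\<forall>n. in_H1 (Omega_H L (H c n)) (sH c n) \<and>
                in_H1 (Omega_H L (H c n)) (weak_deriv (Omega_H L (H c n)) e_z (sH c n)))"
    and "\<forall>c\<in>{c1..c2}. limit_solution g L k pc c \<tau> s0 p0 (sH c) (pH c) (S c) (P c)"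
    and "continuous_on {c1..c2} (\<lambda>c. bottom_flux g L k c s0 (S c) (P c))"
  shows "\<exists>c_bar\<in>{c1<..<c2}.
    bottom_flux g L k c_bar s0 (S c_bar) (P c_bar) = (g * k s_star - c_bar * s_star) * L"
proof -
  note pos = assms(1,2,3) and s_star = assms(4) and coeff = assms(5) and data = assms(8)
    and Finf = assms(9) and c1 = assms(11) and c2 = assms(12) and TW = assms(13) and lim = assms(14) and cont = assms(15)
  let ?F = "\<lambda>c. bottom_flux g L k c s0 (S c) (P c)"
  let ?f = "\<lambda>c. ?F c - (g * k s_star - c * s_star) * L"
  have c1_pos: "0 < c1" unfolding c1 using k_deriv(2)[OF coeff s_star s_star] pos(1) by simp
  have c12: "c1 < c2"
    using mult_strict_left_mono[OF tangent_below_chord[OF coeff s_star] pos(1)] unfolding c1 c2 by (simp add: mult.commute)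
  have s0: "continuous_on {0<..<L} s0" by (rule C1_differentiable_imp_continuous_on[OF assms(6)])
  have wave: "\<exists>C_P p_bar. limit_wave g L \<tau> c s_star k pc s0 p0 (S c) (P c) C_P p_bar"
    and lower: "F_inf - c * L \<le> ?F c" if c: "c \<in> {c1..c2}" for c
  proof -
    have c_pos: "0 < c" using c c1_pos by auto
    note T = bspec[OF TW c]
    obtain p_bar where p_bar: "\<And>n. AE x in lebesgue_on (Omega_H L (H c n)). pH c n x \<le> p_bar" using T by blast
    obtain C_P where C_P: "0 < C_P" "\<And>n. AE x in lebesgue_on (Omega_H L (H c n)).
        norm (weak_gradient (Omega_H L (H c n)) (pH c n) x) \<le> C_P" using T by blast
    have H: "filterlim (H c) at_top sequentially"
      and sol: "\<And>n. TW_H_solution g L k pc (H c n) c \<tau> F_inf s0 p0 (sH c n) (pH c n)" using T by blast+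
    note facts = limit_wave_if_limit_solution[OF pos c_pos C_P(1) s_star coeff s0 data H sol p_bar C_P(2) bspec[OF lim c]]
    show "\<exists>C_P p_bar. limit_wave g L \<tau> c s_star k pc s0 p0 (S c) (P c) C_P p_bar" using facts(1) by blast
    show "F_inf - c * L \<le> ?F c" by (rule facts(2))
  qed
  have f1: "0 < ?f c1"
  proof -
    have "(g * k s_star - c1 * s_star) * L = g * L * (k s_star + deriv k s_star * (1 - s_star)) - c1 * L"
      unfolding c1 by (simp add: algebra_simps)
    then show ?thesis using lower[of c1] c12 Finf by simp
  qed
  have f2: "?f c2 < 0"
  proof -
    obtain C_P p_bar where w: "limit_wave g L \<tau> c2 s_star k pc s0 p0 (S c2) (P c2) C_P p_bar"
      using wave[of c2] c12 by auto
    have "?F c2 < (g * k s_star - c2 * s_star) * L"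
    proof (rule limit_wave.bottom_flux_upper_bound[OF w])
      fix t assume t: "s_star < t" "t < 1"
      have "g * (k t - k s_star) < g * ((k 1 - k s_star) / (1 - s_star) * (t - s_star))"
        by (rule mult_strict_left_mono[OF k_below_chord[OF coeff s_star t] pos(1)])
      also have "\<dots> = c2 * (t - s_star)" unfolding c2 by simp
      finally show "g * k t - c2 * t < g * k s_star - c2 * s_star" by (simp add: algebra_simps)
    qed
    then show ?thesis by simp
  qed
  have "continuous_on {c1..c2} ?f" by (intro continuous_intros cont)
  then obtain c where c: "c1 \<le> c" "c \<le> c2" "?f c = 0"
    using IVT2'[of ?f c2 0 c1] f1 f2 c12 by auto
  have "c \<noteq> c1" "c \<noteq> c2" using c(3) f1 f2 by auto
  then show ?thesis using c by (intro bexI[of _ c]) auto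
qed

end
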